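(* Let $\mathbb K$ be an algebraically closed field of characteristic zero, let $A=(a,b)\in\mathbb K^2$ and $d\in\mathbb K\setminus\{0\}$, and let $\mathcal C\subset\mathbb K^2$ be a rational affine plane algebraic curve which is neither of the two lines $y_1\pm\sqrt{-1}\,y_2=0$, is not the circle $(y_1-a)^2+(y_2-b)^2=d^2$, and is not a line through $A$. Let $\mathfrak C(\mathcal C)$ be the conchoid of $\mathcal C$ from the focus $A$ and distance $d$. The following statements are equivalent: (1) $\mathfrak C(\mathcal C)$ is rational. (2) There exists a proper parametrization of $\mathcal C$ whose reparametrizing curve is rational. (3) The reparametrizing curve of every proper parametrization of $\mathcal C$ is rational.
   Context: Let $f$ be the irreducible defining polynomial of $\mathcal C$. For $P=(P_1,P_2)$ write $\|P\|^2=P_1^2+P_2^2$ (no conjugation). The conchoid $\mathfrak C(\mathcal C)$ is the Zariski closure in $\mathbb K^2$ of the set of points $\bar x\in\mathbb K^2$ for which there exist $\bar y\in\mathbb K^2$ and $\lambda\in\mathbb K$ with $f(\bar y)=0$, $\|\bar x-\bar y\|^2=d^2$ and $\bar x=A+\lambda(\bar y-A)$. A (rational) parametrization of an irreducible plane curve is a pair $\mathcal P(t)\in\mathbb K(t)^2$, not both entries constant, whose values are Zariski dense in the curve; it is proper if it is birational. A curve is rational if it is irreducible and has a parametrization (in particular, "rational" includes "irreducible"). Reparametrizing curve: for a parametrization $\mathcal P(t)=(P_1(t),P_2(t))$ of $\mathcal C$, the reparametrizing curve $\mathfrak G(\mathcal P)$ is the plane curve defined by the primitive part with respect to $x_2$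 of the numerator of $-2x_2(P_1(x_1)-a)+(x_2^2-1)(P_2(x_1)-b)$. *)

theory Defs
  imports
    "HOL-Computational_Algebra.Computational_Algebra"
    "HOL-Library.Product_Plus"
begin

(* The polynomial ring K[x1,x2] is represented as K[x1][x2]: an element of type 'a poly poly
   is a polynomial in x2 whose coefficients are polynomials in x1. *)

definition eval2 :: "'a::comm_ring_1 poly poly \<Rightarrow> 'a \<times> 'a \<Rightarrow> 'a" where
  "eval2 f x = poly (poly f [:snd x:]) (fst x)"

definition zero_set :: "'a::comm_ring_1 poly poly \<Rightarrow> ('a \<times> 'a) set" where
  "zero_set f = {x. eval2 f x = 0}"

definition zariski_closure :: "('a::comm_ring_1 \<times> 'a) set \<Rightarrow> ('a \<times> 'a) set" where
  "zariski_closure S = {x. \<forall>f. (\<forall>s\<in>S. eval2 f s = 0) \<longrightarrow> eval2 f x = 0}"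

definition irreducible_curve :: "('a::field \<times> 'a) set \<Rightarrow> bool" where
  "irreducible_curve C \<longleftrightarrow> (\<exists>f. irreducible f \<and> C = zero_set f)"


(* K(t) is the type 'a poly fract. A rational function r is defined at t if some representation
   p/q of r has q(t) nonzero; rat_value r t v says that r is defined at t and takes the value v. *)

definition rat_value :: "'a::field poly fract \<Rightarrow> 'a \<Rightarrow> 'a \<Rightarrow> bool" where
  "rat_value r t v \<longleftrightarrow> (\<exists>p q. r = Fract p q \<and> poly q t \<noteq> 0 \<and> v = poly p t / poly q t)"

definition pair_value ::
    "'a::field poly fract \<times> 'a poly fract \<Rightarrow> 'a \<Rightarrow> 'a \<times> 'a \<Rightarrow> bool" where
  "pair_value P t x \<longleftrightarrow> rat_value (fst P) t (fst x) \<and> rat_value (snd P) t (snd x)"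

definition rat_const :: "'a::field \<Rightarrow> 'a poly fract" where
  "rat_const c = to_fract [:c:]"

definition parametrization ::
    "('a::field \<times> 'a) set \<Rightarrow> 'a poly fract \<times> 'a poly fract \<Rightarrow> bool" where
  "parametrization C P \<longleftrightarrow>
     irreducible_curve C \<and>
     \<not> (fst P \<in> range rat_const \<and> snd P \<in> range rat_const) \<and>
     zariski_closure {x. \<exists>t. pair_value P t x} = C"

(* Properness is birationality of t \<mapsto> P(t) from the affine line to C: the rational function
   g/h on C is the inverse rational map. Equality of rational maps is expressed
   as equality of values wherever both sides are defined. *)

definition proper_parametrization ::
    "('a::field \<times> 'a) set \<Rightarrow> 'a poly fract \<times> 'a poly fract \<Rightarrow> bool" where
  "proper_parametrization C P \<longleftrightarrow>
     parametrization C P \<and>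
     (\<exists>g h. (\<exists>x\<in>C. eval2 h x \<noteq> 0) \<and>
        (\<forall>t x. pair_value P t x \<and> eval2 h x \<noteq> 0 \<longrightarrow> eval2 g x / eval2 h x = t) \<and>
        (\<forall>x\<in>C. eval2 h x \<noteq> 0 \<longrightarrow> (\<forall>y. pair_value P (eval2 g x / eval2 h x) y \<longrightarrow> y = x)))"

definition rational_curve :: "('a::field \<times> 'a) set \<Rightarrow> bool" where
  "rational_curve C \<longleftrightarrow> irreducible_curve C \<and> (\<exists>P. parametrization C P)"


(* The bilinear square norm: no conjugation. *)

definition norm_sq :: "'a::comm_ring_1 \<times> 'a \<Rightarrow> 'a" where
  "norm_sq p = (fst p)\<^sup>2 + (snd p)\<^sup>2"

definition conchoid :: "'a::field \<times> 'a \<Rightarrow> 'a \<Rightarrow> ('a \<times> 'a) set \<Rightarrow> ('a \<times> 'a) set" where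
  "conchoid A d C = zariski_closure
     {x. \<exists>y \<mu>. y \<in> C \<and> norm_sq (x - y) = d\<^sup>2 \<and>
          x = A + (\<mu> * fst (y - A), \<mu> * snd (y - A))}"


(* H \<in> K(x1)[x2] is written as N/D in lowest terms, with D \<in> K[x1] and N \<in> K[x1][x2].
   A common factor of N and D in K[x1][x2] necessarily lies in K[x1]. *)

definition is_numerator :: "'a::field poly fract poly \<Rightarrow> 'a poly poly \<Rightarrow> bool" where
  "is_numerator H N \<longleftrightarrow>
     (\<exists>D. D \<noteq> 0 \<and> fract_poly N = smult (to_fract D) H \<and>
          (\<forall>c. c dvd D \<and> [:c:] dvd N \<longrightarrow> c dvd 1))"

(* The library's primitive_part needs a gcd on 'a poly, which would restrict the coefficient
   field to the class field_gcd. As there is no canonical normalization,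
   primitive parts are determined up to a nonzero constant factor. *)

definition is_primitive_part :: "'a::field poly poly \<Rightarrow> 'a poly poly \<Rightarrow> bool" where
  "is_primitive_part N g \<longleftrightarrow>
     (\<exists>c. c \<noteq> 0 \<and> N = smult c g) \<and> (\<forall>c. [:c:] dvd g \<longrightarrow> c dvd 1)"

definition reparam_fun ::
    "'a::field \<times> 'a \<Rightarrow> 'a poly fract \<times> 'a poly fract \<Rightarrow> 'a poly fract poly" where
  "reparam_fun A P =
     (let x\<^sub>2 = [:0, 1:] in
        - 2 * x\<^sub>2 * [:fst P - rat_const (fst A):] + (x\<^sub>2\<^sup>2 - 1) * [:snd P - rat_const (snd A):])"

definition reparametrizing_curve ::
    "'a::field \<times> 'a \<Rightarrow> 'a poly fract \<times> 'a poly fract \<Rightarrow> ('a \<times> 'a) set" where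
  "reparametrizing_curve A P =
     zero_set (SOME g. \<exists>N. is_numerator (reparam_fun A P) N \<and> is_primitive_part N g)"

end

theory Submission
  imports Defs
begin

text \<open>
  Let \<open>A = (a, b)\<close> be the focus, \<open>f = 0\<close> the irreducible equation of \<open>C\<close>, \<open>P\<close> a proper
  parametrization of \<open>C\<close>, and \<open>n(y)\<close> the
  square norm of \<open>y - A\<close>. Adjoining a square root \<open>\<rho>\<close> of \<open>n\<close> gives a double cover of \<open>C\<close>, and both
  curves of the theorem are images of it. The conchoid is the closure of the set of points
  \<open>A + (1 + d/\<rho>)(y - A)\<close>, that is, of \<open>y\<close> moved by \<open>d\<close> along the unit vector \<open>(y - A)/\<rho>\<close>. The
  reparametrizing curve is quadratic in \<open>x\<^sub>2\<close> with discriminant \<open>4 n(P)\<close> up to a square.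
  Each of the two curves is rational exactly if \<open>n(P)\<close> is not a square in \<open>K(t)\<close> but becomes one
  after a substitution \<open>t := \<tau>\<close> with \<open>\<tau>\<close> nonconstant (\<open>splitting_condition\<close>): the double cover is
  irreducible, and some line dominates it. So the conchoid is rational if and only if
  the reparametrizing curve of \<open>P\<close> is, whatever the proper parametrization \<open>P\<close> may be. The three
  statements are then equivalent because a proper parametrization exists, by Lueroth's theorem.

  For the reparametrizing curve, the condition is read off the quadratic formula. For the
  conchoid, one direction composes the parametrization of the double cover with the map above.
  In the other direction, let \<open>Q\<close> parametrize the conchoid. Multiplying the values of
  \<open>f(A + (1 - d/s)(x - A))\<close> for the two square roots \<open>s\<close> of \<open>n(x)\<close> gives a polynomial in \<open>x\<close> that
  vanishes on the conchoid, hence at \<open>Q\<close>. Either \<open>n(Q)\<close> has a root \<open>v\<close> in \<open>K(t)\<close> for which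
  \<open>Q\<close> moved back by \<open>d\<close> is a point of \<open>C\<close> over \<open>K(t)\<close>, which by properness
  is \<open>P\<close> after a substitution and has square norm \<open>(v - d)\<^sup>2\<close> from the focus; or both ways of
  moving by \<open>d\<close> lead back to \<open>C\<close>, and \<open>C\<close> is invariant under shifts by \<open>2d\<close> along its rays from
  \<open>A\<close>. The latter puts infinitely many points of one ray on \<open>C\<close>, which only
  a line through \<open>A\<close> allows (\<open>not_invariant_under_shift\<close>). If \<open>n(P) = r\<^sup>2\<close>, the cover splits in
  two, both halves must map to the same irreducible conchoid, and a shift invariance of \<open>C\<close>
  along \<open>(P - A)/r\<close> leads to the same contradiction
  (\<open>rational_conchoid_imp_norm_not_square\<close>).

  All this is carried out with points whose coordinates lie in \<open>K(t)\<close>. A polynomial vanishes on a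
  parametrized curve if and only if it vanishes at the parametrization, as an element of \<open>K(t)\<close>
  (\<open>vanishes_on_curve_iff\<close>), and the polynomials vanishing at a nonconstant point over \<open>K(t)\<close> are
  the multiples of any irreducible one among them (\<open>irreducible_dvd_vanishing\<close>). These two facts
  replace the Nullstellensatz and the function fields of the curves involved.
\<close>


section \<open>Evaluation at rational functions\<close>

locale comm_ring_morphism =
  fixes \<phi> :: "'a::comm_ring_1 \<Rightarrow> 'b::comm_ring_1"
  assumes hom_add: "\<phi> (x + y) = \<phi> x + \<phi> y"
    and hom_mult: "\<phi> (x * y) = \<phi> x * \<phi> y"
    and hom_one: "\<phi> 1 = 1"
begin

lemma hom_zero: "\<phi> 0 = 0"
  using hom_add[of 0 0] by simp

lemma hom_minus: "\<phi> (- x) = - \<phi> x"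
  using hom_add[of x "- x"] by (simp add: hom_zero eq_neg_iff_add_eq_0 add.commute)

lemma hom_diff: "\<phi> (x - y) = \<phi> x - \<phi> y"
  using hom_add[of x "- y"] by (simp add: hom_minus)

lemma hom_sum: "\<phi> (sum f A) = (\<Sum>x\<in>A. \<phi> (f x))"
  by (induction A rule: infinite_finite_induct) (auto simp: hom_zero hom_add)

lemma hom_power: "\<phi> (x ^ n) = \<phi> x ^ n"
  by (induction n) (auto simp: hom_one hom_mult)

lemma hom_of_nat: "\<phi> (of_nat n) = of_nat n"
  by (induction n) (auto simp: hom_zero hom_one hom_add)

lemma hom_numeral: "\<phi> (numeral n) = numeral n"
  using hom_of_nat[of "numeral n"] by simp

lemma map_poly_morphism: "comm_ring_morphism (map_poly \<phi>)"
proof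
  fix p q :: "'a poly"
  show "map_poly \<phi> (p + q) = map_poly \<phi> p + map_poly \<phi> q"
    by (rule poly_eqI) (simp add: coeff_map_poly hom_zero hom_add)
  show "map_poly \<phi> (p * q) = map_poly \<phi> p * map_poly \<phi> q"
    by (rule poly_eqI) (simp add: coeff_map_poly hom_zero hom_mult coeff_mult hom_sum)
  show "map_poly \<phi> 1 = 1"
    by (simp add: hom_one)
qed

lemmas hom_simps = hom_zero hom_one hom_add hom_mult hom_minus hom_diff hom_power hom_numeral

end

lemma comm_ring_morphism_poly: "comm_ring_morphism (\<lambda>p. poly p x)"
  by unfold_locales auto

lemma comm_ring_morphism_comp:
  assumes "comm_ring_morphism f" "comm_ring_morphism g"
  shows "comm_ring_morphism (\<lambda>x. f (g x))"
proof -
  interpret f: comm_ring_morphism f by fact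
  interpret g: comm_ring_morphism g by fact
  show ?thesis by unfold_locales (auto simp: f.hom_simps g.hom_simps)
qed

instance fract :: ("{idom,ring_char_0}") field_char_0
proof
  show "inj (of_nat :: nat \<Rightarrow> 'a fract)"
    by (rule injI) (simp add: of_nat_fract eq_fract)
qed

interpretation rat_const: comm_ring_morphism rat_const
  by unfold_locales (auto simp: rat_const_def one_pCons[symmetric] simp flip: to_fract_add to_fract_mult)

lemma rat_const_eq_iff [simp]: "rat_const x = rat_const y \<longleftrightarrow> x = y"
  by (simp add: rat_const_def)

lemma rat_const_eq_0_iff [simp]: "rat_const x = 0 \<longleftrightarrow> x = 0"
  by (simp add: rat_const_def)

lemma rat_const_divide: "rat_const (x / y) = rat_const x / rat_const y"
proof (cases "y = 0")
  case False
  then have "rat_const (x / y) * rat_const y = rat_const x"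
    by (simp flip: rat_const.hom_mult)
  then show ?thesis using False by (simp add: field_simps)
qed (simp add: rat_const.hom_zero)

definition poly_at :: "'a::field poly \<Rightarrow> 'a poly fract \<Rightarrow> 'a poly fract" where
  "poly_at p z = poly (map_poly rat_const p) z"

definition feval :: "'a::field poly poly \<Rightarrow> 'a poly fract \<times> 'a poly fract \<Rightarrow> 'a poly fract" where
  "feval f R = poly (map_poly (\<lambda>c. poly_at c (fst R)) f) (snd R)"

abbreviation tvar :: "'a::field poly fract" where
  "tvar \<equiv> to_fract [:0, 1:]"

interpretation poly_at: comm_ring_morphism "\<lambda>p. poly_at p z"
  unfolding poly_at_def
  by (rule comm_ring_morphism_comp[OF comm_ring_morphism_poly rat_const.map_poly_morphism])

interpretation feval: comm_ring_morphism "\<lambda>f. feval f R"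
  unfolding feval_def
  by (rule comm_ring_morphism_comp[OF comm_ring_morphism_poly poly_at.map_poly_morphism])

interpretation eval2: comm_ring_morphism "\<lambda>f. eval2 f x"
  unfolding eval2_def by unfold_locales auto

lemma poly_at_pCons [simp]: "poly_at (pCons c p) z = rat_const c + z * poly_at p z"
  by (simp add: poly_at_def map_poly_pCons rat_const.hom_zero)

lemma poly_at_0 [simp]: "poly_at 0 z = 0"
  by (simp add: poly_at_def)

lemma feval_pCons [simp]: "feval (pCons c f) R = poly_at c (fst R) + snd R * feval f R"
  by (simp add: feval_def map_poly_pCons)

lemma feval_0 [simp]: "feval 0 R = 0"
  by (simp add: feval_def)

lemma eval2_pCons [simp]: "eval2 (pCons c f) x = poly c (fst x) + snd x * eval2 f x"
  by (simp add: eval2_def)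

lemma eval2_0 [simp]: "eval2 0 x = 0"
  by (simp add: eval2_def)

lemma feval_smult [simp]: "feval (smult z h) R = poly_at z (fst R) * feval h R"
  using feval.hom_mult[of "[:z:]" h] by simp

lemma eval2_smult [simp]: "eval2 (smult z h) x = poly z (fst x) * eval2 h x"
  using eval2.hom_mult[of "[:z:]" h] by simp

lemma poly_at_tvar [simp]: "poly_at p tvar = to_fract p"
proof (induction p)
  case (pCons c p)
  have "to_fract (pCons c p) = to_fract ([:c:] + [:0,1:] * p)" by simp
  also have "\<dots> = rat_const c + tvar * to_fract p"
    unfolding to_fract_add to_fract_mult rat_const_def ..
  finally show ?case using pCons by simp
qed simp

lemma poly_at_rat_const [simp]: "poly_at p (rat_const c) = rat_const (poly p c)"
  by (induction p) (auto simp: rat_const.hom_simps)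

lemma feval_rat_const: "feval f (rat_const x, rat_const y) = rat_const (eval2 f (x, y))"
  by (induction f) (auto simp: rat_const.hom_simps)

lemma feval_rat_const_fst: "feval f (rat_const c, Y) = poly_at (map_poly (\<lambda>p. poly p c) f) Y"
  by (induction f) (auto simp: map_poly_pCons)

text \<open>Over an algebraically closed field, every nonconstant rational function is
  transcendental: its only algebraic relations would come from linear factors.\<close>

lemma poly_at_eq_0_iff:
  fixes p :: "'a::alg_closed_field poly"
  assumes "z \<notin> range rat_const"
  shows "poly_at p z = 0 \<longleftrightarrow> p = 0"
proof
  assume "poly_at p z = 0"
  then show "p = 0"
  proof (induction "degree p" arbitrary: p)
    case 0
    then obtain c where "p = [:c:]" by (metis degree_eq_zeroE)
    then show ?case using 0 by simp
  next
    case (Suc n)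
    then obtain c where "poly p c = 0" by (metis alg_closed_imp_poly_has_root zero_less_Suc)
    then obtain q where q: "p = [:-c, 1:] * q" by (metis dvdE poly_eq_0_iff_dvd)
    with Suc have "q \<noteq> 0" by auto
    then have "degree p = Suc (degree q)" unfolding q by (subst degree_mult_eq) auto
    moreover have "z + rat_const (- c) \<noteq> 0"
      using assms by (metis add_eq_0_iff2 minus_minus rangeI rat_const.hom_minus)
    then have "poly_at q z = 0"
      using Suc.prems unfolding q poly_at.hom_mult by (simp add: rat_const.hom_one add.commute)
    ultimately show ?case using Suc \<open>q \<noteq> 0\<close> by auto
  qed
qed simp


section \<open>Values of rational functions\<close>

lemma rat_value_unique:
  assumes "rat_value r t v" "rat_value r t w"
  shows "v = w"
proof -
  obtain p q where 1: "r = Fract p q" "poly q t \<noteq> 0" "v = poly p t / poly q t"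
    using assms(1) by (auto simp: rat_value_def)
  obtain p' q' where 2: "r = Fract p' q'" "poly q' t \<noteq> 0" "w = poly p' t / poly q' t"
    using assms(2) by (auto simp: rat_value_def)
  have "p * q' = p' * q"
    using 1 2 by (metis eq_fract(1) poly_0)
  then have "poly p t * poly q' t = poly p' t * poly q t"
    by (metis poly_mult)
  then show ?thesis using 1 2 by (simp add: frac_eq_eq)
qed

lemma rat_value_add: "rat_value r t v \<Longrightarrow> rat_value s t w \<Longrightarrow> rat_value (r + s) t (v + w)"
  unfolding rat_value_def
proof (elim exE conjE)
  fix p q p' q'
  assume *: "r = Fract p q" "poly q t \<noteq> 0" "v = poly p t / poly q t"
    "s = Fract p' q'" "poly q' t \<noteq> 0" "w = poly p' t / poly q' t"
  have "q \<noteq> 0" "q' \<noteq> 0" using * by auto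
  then have "r + s = Fract (p * q' + p' * q) (q * q')" using * by simp
  moreover have "v + w = poly (p * q' + p' * q) t / poly (q * q') t"
    using * by (simp add: add_frac_eq)
  moreover have "poly (q * q') t \<noteq> 0" using * by simp
  ultimately show "\<exists>p q. r + s = Fract p q \<and> poly q t \<noteq> 0 \<and> v + w = poly p t / poly q t"
    by blast
qed

lemma rat_value_mult: "rat_value r t v \<Longrightarrow> rat_value s t w \<Longrightarrow> rat_value (r * s) t (v * w)"
  unfolding rat_value_def
proof (elim exE conjE)
  fix p q p' q'
  assume *: "r = Fract p q" "poly q t \<noteq> 0" "v = poly p t / poly q t"
    "s = Fract p' q'" "poly q' t \<noteq> 0" "w = poly p' t / poly q' t"
  have "r * s = Fract (p * p') (q * q')" using * by simp
  moreover have "v * w = poly (p * p') t / poly (q * q') t"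
    using * by simp
  moreover have "poly (q * q') t \<noteq> 0" using * by simp
  ultimately show "\<exists>p q. r * s = Fract p q \<and> poly q t \<noteq> 0 \<and> v * w = poly p t / poly q t"
    by blast
qed

lemma rat_value_to_fract: "rat_value (to_fract p) t (poly p t)"
  unfolding rat_value_def to_fract_def by (intro exI[of _ p] exI[of _ 1]) auto

lemma rat_value_rat_const: "rat_value (rat_const c) t c"
  using rat_value_to_fract[of "[:c:]" t] by (simp add: rat_const_def)

lemma rat_value_tvar: "rat_value tvar t t"
  using rat_value_to_fract[of "[:0, 1:]" t] by simp

lemma rat_value_poly_at: "rat_value r t v \<Longrightarrow> rat_value (poly_at p r) t (poly p v)"
proof (induction p)
  case 0
  then show ?case using rat_value_to_fract[of 0] by simp
qed (auto intro!: rat_value_add rat_value_mult rat_value_rat_const)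

lemma rat_value_feval: "pair_value R t x \<Longrightarrow> rat_value (feval f R) t (eval2 f x)"
proof (induction f)
  case 0
  then show ?case using rat_value_to_fract[of 0] by simp
qed (auto intro!: rat_value_add rat_value_mult rat_value_poly_at simp: pair_value_def)

lemma finite_undefined: "finite {t. \<nexists>v. rat_value r t v}"
proof -
  obtain p q where r: "r = Fract p q" "q \<noteq> 0" by (cases r) auto
  have "{t. \<nexists>v. rat_value r t v} \<subseteq> {t. poly q t = 0}"
    using r by (auto simp: rat_value_def)
  then show ?thesis using poly_roots_finite[OF r(2)] finite_subset by blast
qed

lemma finite_undefined_pair: "finite {t. \<nexists>x. pair_value R t x}"
proof -
  have "{t. \<nexists>x. pair_value R t x} \<subseteq>
    {t. \<nexists>v. rat_value (fst R) t v} \<union> {t. \<nexists>v. rat_value (snd R) t v}"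
    by (auto simp: pair_value_def)
  then show ?thesis using finite_undefined finite_subset finite_UnI by metis
qed

lemma rat_zeros_finite:
  assumes "r \<noteq> 0"
  shows "finite {t. rat_value r t 0}"
proof -
  obtain p q where r: "r = Fract p q" "q \<noteq> 0" by (cases r) auto
  then have "p \<noteq> 0" using assms by (auto simp: fract_collapse)
  have "{t. rat_value r t 0} \<subseteq> {t. poly p t = 0}"
  proof
    fix t assume "t \<in> {t. rat_value r t 0}"
    then obtain p' q' where *: "r = Fract p' q'" "poly q' t \<noteq> 0" "0 = poly p' t / poly q' t"
      by (auto simp: rat_value_def)
    then have "p * q' = p' * q" using r by (metis eq_fract(1) poly_0)
    then have "poly p t * poly q' t = poly p' t * poly q t" by (metis poly_mult)
    then show "t \<in> {t. poly p t = 0}" using * by simp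
  qed
  then show ?thesis using poly_roots_finite[OF \<open>p \<noteq> 0\<close>] finite_subset by blast
qed

text \<open>The field is infinite, so an identity of rational functions may be checked at almost all values.\<close>

lemma rat_eq_0I:
  fixes r :: "'a::field_char_0 poly fract"
  assumes "finite S" and "\<And>t. t \<notin> S \<Longrightarrow> rat_value r t 0"
  shows "r = 0"
proof (rule ccontr)
  assume "r \<noteq> 0"
  then have "finite (S \<union> {t. rat_value r t 0})" using assms rat_zeros_finite by blast
  moreover have "S \<union> {t. rat_value r t 0} = UNIV" using assms by auto
  ultimately show False using infinite_UNIV_char_0 by metis
qed


section \<open>Divisibility of bivariate polynomials\<close>

definition content_free :: "'a::comm_ring_1 poly poly \<Rightarrow> bool" where
  "content_free g \<longleftrightarrow> (\<forall>c. [:c:] dvd g \<longrightarrow> c dvd 1)"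

lemma map_poly_eval_eq_0_iff:
  fixes f :: "'a::field poly poly"
  shows "map_poly (\<lambda>p. poly p c) f = 0 \<longleftrightarrow> [:[:-c, 1:]:] dvd f"
  by (simp add: const_poly_dvd_iff poly_eq_0_iff_dvd[symmetric] poly_eq_iff coeff_map_poly)

interpretation eval_fst: comm_ring_morphism "map_poly (\<lambda>p. poly p (c::'a::comm_ring_1))"
  by (rule comm_ring_morphism.map_poly_morphism[OF comm_ring_morphism_poly])

text \<open>Gauss's lemma, one linear factor \<open>x\<^sub>1 - c\<close> of \<open>z\<close> at a time: setting \<open>x\<^sub>1 = c\<close> is a
  homomorphism to the domain \<open>K[x\<^sub>2]\<close>, so \<open>x\<^sub>1 - c\<close> divides \<open>m\<close> or the cofactor, and a polynomial
  without content has no such divisor.\<close>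

lemma content_free_dvd_smult:
  fixes m h :: "'a::alg_closed_field poly poly"
  assumes "content_free m" and "z \<noteq> 0" and "m dvd smult z h"
  shows "m dvd h"
  using assms(2,3)
proof (induction "degree z" arbitrary: z)
  case 0
  then obtain k where "z = [:k:]" "k \<noteq> 0" by (metis degree_eq_zeroE pCons_0_0)
  then have "smult [:inverse k:] (smult z h) = h" by (simp flip: one_pCons)
  then show ?case using 0 by (metis dvd_smult)
next
  case (Suc n)
  then obtain c where "poly z c = 0" by (metis alg_closed_imp_poly_has_root zero_less_Suc)
  then obtain z' where z: "z = [:-c, 1:] * z'" by (metis dvdE poly_eq_0_iff_dvd)
  with Suc have "z' \<noteq> 0" by auto
  obtain q where q: "smult z h = m * q" using Suc.prems by auto
  have *: "smult (l * z') h = [:l:] * smult z' h" for l by (simp add: mult.commute)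
  have "map_poly (\<lambda>p. poly p c) (m * q) = 0"
    unfolding q[symmetric] map_poly_eval_eq_0_iff z *[of "[:-c, 1:]"] by (rule dvd_triv_left)
  then have "map_poly (\<lambda>p. poly p c) m = 0 \<or> map_poly (\<lambda>p. poly p c) q = 0"
    by (simp add: eval_fst.hom_mult)
  moreover have "\<not> [:-c, 1:] dvd 1" by (simp add: is_unit_pCons_iff)
  ultimately have "[:[:-c, 1:]:] dvd q"
    using assms(1) unfolding map_poly_eval_eq_0_iff content_free_def by blast
  then obtain q' where q': "q = smult [:-c, 1:] q'" by (auto elim!: dvdE)
  have "smult [:-c, 1:] (smult z' h) = smult [:-c, 1:] (m * q')"
    using q unfolding z q' by (simp only: smult_smult mult_smult_right)
  then have "smult [:-c, 1:] (smult z' h - m * q') = 0" unfolding smult_diff_right by simp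
  then have "smult z' h = m * q'" unfolding smult_eq_0_iff by simp
  moreover have "n = degree z'"
    using Suc(2) \<open>z' \<noteq> 0\<close> unfolding z by (subst (asm) degree_mult_eq) auto
  ultimately show ?case using Suc.hyps(1) \<open>z' \<noteq> 0\<close> by simp
qed

text \<open>Splitting off a nonunit divisor in \<open>K[x\<^sub>1]\<close> lowers the degree of the leading coefficient, so
  the process ends.\<close>

lemma exists_content_free_part:
  fixes h :: "'a::field poly poly"
  assumes "h \<noteq> 0"
  obtains c g where "c \<noteq> 0" "h = smult c g" "content_free g"
proof -
  have "\<exists>c g. c \<noteq> 0 \<and> h = smult c g \<and> content_free g" using assms
  proof (induction "degree (lead_coeff h)" arbitrary: h rule: less_induct)
    case less
    show ?case
    proof (cases "content_free h")
      case True
      then show ?thesis by (intro exI[of _ 1] exI[of _ h]) auto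
    next
      case False
      then obtain c where c: "[:c:] dvd h" "\<not> c dvd 1" by (auto simp: content_free_def)
      then obtain h' where h': "h = smult c h'" by (auto elim!: dvdE)
      with less.prems have "c \<noteq> 0" "h' \<noteq> 0" by auto
      then have "degree c > 0" using c(2) by (auto simp: is_unit_iff_degree)
      have "lead_coeff h = c * lead_coeff h'" unfolding h' by simp
      then have "degree (lead_coeff h) = degree c + degree (lead_coeff h')"
        using \<open>c \<noteq> 0\<close> \<open>h' \<noteq> 0\<close> by (simp add: degree_mult_eq)
      then obtain c' g where "c' \<noteq> 0" "h' = smult c' g" "content_free g"
        using less.hyps[of h'] \<open>h' \<noteq> 0\<close> \<open>degree c > 0\<close> by auto
      then show ?thesis using h' \<open>c \<noteq> 0\<close>
        by (intro exI[of _ "c * c'"] exI[of _ g]) auto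
    qed
  qed
  then show ?thesis using that by blast
qed

lemma clear_denominators:
  fixes H :: "'a::field poly fract poly"
  obtains D N where "D \<noteq> 0" "fract_poly N = smult (to_fract D) H"
proof -
  have "\<exists>D N. D \<noteq> 0 \<and> fract_poly N = smult (to_fract D) H"
  proof (induction H)
    case 0
    then show ?case by (intro exI[of _ 1] exI[of _ 0]) auto
  next
    case (pCons c H)
    then obtain D N where DN: "D \<noteq> 0" "fract_poly N = smult (to_fract D) H" by auto
    obtain p q where c: "c = Fract p q" "q \<noteq> 0" by (cases c) auto
    have "fract_poly (pCons (p * D) (smult q N)) = smult (to_fract (q * D)) (pCons c H)"
      using c DN by (simp add: map_poly_pCons Fract_conv_to_fract)
    then show ?case using DN(1) c(2) by (metis mult_eq_0_iff)
  qed
  then show ?thesis using that by blast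
qed

text \<open>A factorization \<open>(u\<^sub>0 + u\<^sub>1 x\<^sub>2)(v\<^sub>0 + v\<^sub>1 x\<^sub>2)\<close> would exhibit the discriminant as the
  square of \<open>u\<^sub>0 v\<^sub>1 - u\<^sub>1 v\<^sub>0\<close>; a factor of degree 0 in \<open>x\<^sub>2\<close> is excluded by the content.\<close>

lemma irreducible_quadratic:
  fixes g :: "'a::field poly poly"
  assumes cf: "content_free g" and deg: "degree g = 2"
    and disc: "\<And>w. w\<^sup>2 \<noteq> (coeff g 1)\<^sup>2 - 4 * coeff g 0 * coeff g 2"
  shows "irreducible g"
proof (rule irreducibleI)
  show "g \<noteq> 0" using deg by auto
  show "\<not> g dvd 1" using deg by (auto simp: is_unit_poly_iff)
  fix u v assume uv: "g = u * v"
  have unit: "x dvd 1" if x: "x dvd g" "degree x = 0" for x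
  proof -
    obtain c where "x = [:c:]" using x(2) by (metis degree_eq_zeroE)
    then show ?thesis using cf x(1) by (simp add: content_free_def is_unit_const_poly_iff)
  qed
  have "u \<noteq> 0" "v \<noteq> 0" using uv deg by auto
  then have "degree u + degree v = 2" using uv deg by (simp add: degree_mult_eq)
  then consider "degree u = 0" | "degree v = 0" | "degree u = 1" "degree v = 1" by linarith
  then show "u dvd 1 \<or> v dvd 1"
  proof cases
    case 3
    then obtain u0 u1 where u: "u = [:u0, u1:]" by (metis degree1_coeffs)
    from 3 obtain v0 v1 where v: "v = [:v0, v1:]" by (metis degree1_coeffs)
    have "g = [:u0 * v0, u0 * v1 + u1 * v0, u1 * v1:]" by (simp add: uv u v)
    then have "(u0 * v1 - u1 * v0)\<^sup>2 = (coeff g 1)\<^sup>2 - 4 * coeff g 0 * coeff g 2"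
      by (simp add: power2_eq_square coeff_pCons numeral_2_eq_2 algebra_simps)
    then show ?thesis using disc by blast
  qed (use unit uv in auto)
qed

lemma irreducible_linear_bivariate:
  fixes u v c :: "'a::field"
  assumes "(u, v) \<noteq> (0, 0)"
  shows "irreducible [:[:c, u:], [:v:]:]"
proof (cases "v = 0")
  case True
  then show ?thesis using assms
    by (simp add: irreducible_const_poly_iff irreducible_linear_field_poly)
next
  case False
  show ?thesis
  proof (rule irreducibleI)
    fix x y assume xy: "[:[:c, u:], [:v:]:] = x * y"
    have unit: "z dvd 1" if z: "z dvd [:[:c, u:], [:v:]:]" "degree z = 0" for z
    proof -
      obtain k where k: "z = [:k:]" using z(2) by (metis degree_eq_zeroE)
      then have "k dvd coeff [:[:c, u:], [:v:]:] 1" using z(1) by (metis const_poly_dvd_iff)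
      moreover have "[:v:] dvd 1" using False by (simp add: is_unit_pCons_iff)
      ultimately have "k dvd 1" using dvd_trans by (simp, blast)
      then show ?thesis by (simp add: k is_unit_const_poly_iff)
    qed
    have "degree (x * y) = 1" using False by (simp flip: xy)
    moreover from this have "x \<noteq> 0" "y \<noteq> 0" by auto
    ultimately have "degree x + degree y = 1" by (simp add: degree_mult_eq)
    then have "degree x = 0 \<or> degree y = 0" by linarith
    then show "x dvd 1 \<or> y dvd 1" using unit by (metis dvd_triv_left dvd_triv_right xy)
  qed (use False in \<open>auto simp: is_unit_poly_iff\<close>)
qed


section \<open>The ideal of a rational point\<close>

definition nonconst :: "'a::field poly fract \<times> 'a poly fract \<Rightarrow> bool" where
  "nonconst R \<longleftrightarrow> \<not> (fst R \<in> range rat_const \<and> snd R \<in> range rat_const)"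

text \<open>If the first coordinate of \<open>Q\<close> is nonconstant, no nonzero polynomial in \<open>x\<^sub>1\<close> alone
  vanishes at \<open>Q\<close>. A vanishing polynomial of least degree in \<open>x\<^sub>2\<close> may then be freed from its content, and
  by pseudo-division and Gauss's lemma it divides all others. If the first coordinate is a
  constant \<open>c\<close>, the generator is \<open>x\<^sub>1 - c\<close>. The generator is irreducible because the ideal is prime.\<close>

lemma vanishing_ideal_principal:
  fixes Q :: "'a::alg_closed_field poly fract \<times> 'a poly fract"
  assumes Q: "nonconst Q" and F: "F \<noteq> 0" "feval F Q = 0"
  obtains m where "irreducible m" "feval m Q = 0" "\<And>h. feval h Q = 0 \<Longrightarrow> m dvd h"
proof -
  have "\<exists>m. m \<noteq> 0 \<and> feval m Q = 0 \<and> (\<forall>h. feval h Q = 0 \<longrightarrow> m dvd h)"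
  proof (cases "fst Q \<in> range rat_const")
    case True
    then obtain c where c: "fst Q = rat_const c" by auto
    then have "Q = (rat_const c, snd Q)" "snd Q \<notin> range rat_const"
      using Q by (auto simp: nonconst_def prod_eq_iff)
    then have *: "feval h Q = 0 \<longleftrightarrow> [:[:-c, 1:]:] dvd h" for h
      by (metis feval_rat_const_fst poly_at_eq_0_iff map_poly_eval_eq_0_iff)
    show ?thesis
    proof (intro exI conjI)
      show "feval [:[:-c, 1:]:] Q = 0" unfolding * by simp
    qed (use * in auto)
  next
    case False
    define n where "n = (LEAST n. \<exists>h. h \<noteq> 0 \<and> feval h Q = 0 \<and> degree h = n)"
    have "\<exists>h. h \<noteq> 0 \<and> feval h Q = 0 \<and> degree h = n"
      unfolding n_def by (rule LeastI_ex) (use F in blast)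
    then obtain h0 where h0: "h0 \<noteq> 0" "feval h0 Q = 0" "degree h0 = n" by blast
    have min: "n \<le> degree h" if "h \<noteq> 0" "feval h Q = 0" for h
      unfolding n_def by (rule Least_le) (use that in blast)
    obtain c m where m: "c \<noteq> 0" "h0 = smult c m" "content_free m"
      using exists_content_free_part[OF h0(1)] by blast
    have "m \<noteq> 0" "degree m = n" using h0 m by auto
    have mQ: "feval m Q = 0"
      using h0(2) m(1) False by (simp add: m(2) poly_at_eq_0_iff)
    have "m dvd h" if h: "feval h Q = 0" for h
    proof -
      obtain q r where qr: "pseudo_divmod h m = (q, r)" by fastforce
      define z where "z = lead_coeff m ^ (Suc (degree h) - degree m)"
      have *: "smult z h = m * q + r" "r = 0 \<or> degree r < degree m"
        using pseudo_divmod[OF \<open>m \<noteq> 0\<close> qr] unfolding z_def by auto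
      have "z \<noteq> 0" using \<open>m \<noteq> 0\<close> by (simp add: z_def)
      have "feval r Q = feval (smult z h) Q - feval (m * q) Q"
        unfolding *(1) by (simp add: feval.hom_add)
      then have "feval r Q = 0" by (simp add: feval.hom_mult h mQ)
      then have "r = 0" using *(2) min[of r] \<open>degree m = n\<close> by linarith
      then show ?thesis using content_free_dvd_smult[OF m(3) \<open>z \<noteq> 0\<close>] *(1) by simp
    qed
    then show ?thesis using mQ \<open>m \<noteq> 0\<close> by blast
  qed
  then obtain m where m: "m \<noteq> 0" "feval m Q = 0" "\<And>h. feval h Q = 0 \<Longrightarrow> m dvd h" by blast
  have "irreducible m"
  proof (rule irreducibleI)
    show "\<not> m dvd 1"
      using m(2) by (metis dvdE feval.hom_mult feval.hom_one mult_zero_left zero_neq_one)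
    have *: "w dvd 1" if uw: "m = u * w" "feval u Q = 0" for u w
    proof -
      obtain k where "u = m * k" using m(3)[OF uw(2)] by auto
      then have "m * 1 = m * (k * w)" using uw(1) by (metis mult.assoc mult.right_neutral)
      then have "1 = k * w" using m(1) by (metis mult_left_cancel)
      then show ?thesis by (metis dvd_triv_right)
    qed
    fix u v assume uv: "m = u * v"
    then have "feval u Q = 0 \<or> feval v Q = 0" using m(2) by (simp add: feval.hom_mult)
    then show "u dvd 1 \<or> v dvd 1"
      using *[of u v] *[of v u] uv by (auto simp: mult.commute)
  qed (use m in auto)
  then show ?thesis using that m by blast
qed

text \<open>An irreducible multiple of the generator is associated to it. This is the substitute for the
  Nullstellensatz: \<open>Q\<close> acts as a generic point of the curve \<open>f = 0\<close>.\<close>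

lemma irreducible_dvd_vanishing:
  fixes Q :: "'a::alg_closed_field poly fract \<times> 'a poly fract"
  assumes "nonconst Q" "irreducible f" "feval f Q = 0" "feval h Q = 0"
  shows "f dvd h"
proof -
  have "f \<noteq> 0" using assms(2) by auto
  obtain m where m: "irreducible m" "\<And>h. feval h Q = 0 \<Longrightarrow> m dvd h"
    by (rule vanishing_ideal_principal[OF assms(1) \<open>f \<noteq> 0\<close> assms(3)]) blast
  obtain k where k: "f = m * k" using m(2)[OF assms(3)] by auto
  then have "k dvd 1" using irreducibleD[OF assms(2) k] irreducible_not_unit[OF m(1)] by blast
  then have "f dvd m" unfolding k by (simp add: mult_unit_dvd_iff)
  then show ?thesis using m(2)[OF assms(4)] dvd_trans by blast
qed

lemma feval_eq_0_dvd:
  assumes "f dvd h" "feval f R = 0"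
  shows "feval h R = 0"
  using assms by (auto simp: feval.hom_mult)

lemma eval2_eq_0_dvd:
  assumes "f dvd h" "eval2 f x = 0"
  shows "eval2 h x = 0"
  using assms by (auto simp: eval2.hom_mult)


section \<open>Parametrized curves\<close>

lemma feval_eq_0_if_vanishes_on_values:
  fixes R :: "'a::field_char_0 poly fract \<times> 'a poly fract"
  assumes "\<And>t x. pair_value R t x \<Longrightarrow> eval2 h x = 0"
  shows "feval h R = 0"
proof (rule rat_eq_0I[OF finite_undefined_pair[of R]])
  fix t assume "t \<notin> {t. \<nexists>x. pair_value R t x}"
  then obtain x where "pair_value R t x" by blast
  then show "rat_value (feval h R) t 0" using rat_value_feval[of R t x h] assms by simp
qed

lemma eval2_eq_0_if_feval_eq_0:
  assumes "feval h R = 0" "pair_value R t x"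
  shows "eval2 h x = 0"
  using rat_value_feval[OF assms(2), of h] rat_value_unique rat_value_rat_const[of 0 t] assms(1)
  by (metis rat_const.hom_zero)

text \<open>This converts statements about all points of \<open>C\<close> into identities in \<open>K(t)\<close> and back.\<close>

lemma vanishes_on_curve_iff:
  fixes P :: "'a::field_char_0 poly fract \<times> 'a poly fract"
  assumes "parametrization C P"
  shows "(\<forall>x\<in>C. eval2 h x = 0) \<longleftrightarrow> feval h P = 0"
proof -
  have C: "C = zariski_closure {x. \<exists>t. pair_value P t x}"
    using assms by (simp add: parametrization_def)
  show ?thesis
  proof
    assume *: "\<forall>x\<in>C. eval2 h x = 0"
    show "feval h P = 0"
    proof (rule feval_eq_0_if_vanishes_on_values)
      fix t x assume "pair_value P t x"
      then have "x \<in> C" unfolding C zariski_closure_def by blast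
      then show "eval2 h x = 0" using * by blast
    qed
  next
    assume "feval h P = 0"
    then have "\<forall>s\<in>{x. \<exists>t. pair_value P t x}. eval2 h s = 0"
      using eval2_eq_0_if_feval_eq_0 by blast
    then show "\<forall>x\<in>C. eval2 h x = 0" unfolding C zariski_closure_def by blast
  qed
qed

text \<open>The Zariski closure is all of \<open>f = 0\<close> because a polynomial vanishing on the values vanishes at
  \<open>Q\<close> and is therefore a multiple of \<open>f\<close>.\<close>

lemma parametrization_zero_setI:
  fixes Q :: "'a::{alg_closed_field, field_char_0} poly fract \<times> 'a poly fract"
  assumes "irreducible f" "nonconst Q" "feval f Q = 0"
  shows "parametrization (zero_set f) Q"
proof -
  have "zariski_closure {x. \<exists>t. pair_value Q t x} = zero_set f"
  proof (intro equalityI subsetI)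
    fix x assume "x \<in> zariski_closure {x. \<exists>t. pair_value Q t x}"
    moreover have "\<forall>s\<in>{x. \<exists>t. pair_value Q t x}. eval2 f s = 0"
      using eval2_eq_0_if_feval_eq_0[OF assms(3)] by blast
    ultimately show "x \<in> zero_set f" unfolding zariski_closure_def zero_set_def by blast
  next
    fix x assume x: "x \<in> zero_set f"
    show "x \<in> zariski_closure {x. \<exists>t. pair_value Q t x}"
      unfolding zariski_closure_def
    proof (intro CollectI allI impI)
      fix h assume "\<forall>s\<in>{x. \<exists>t. pair_value Q t x}. eval2 h s = 0"
      then have "feval h Q = 0" by (intro feval_eq_0_if_vanishes_on_values) blast
      then have "f dvd h" using irreducible_dvd_vanishing assms by blast
      then show "eval2 h x = 0" using x eval2_eq_0_dvd unfolding zero_set_def by blast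
    qed
  qed
  then show ?thesis using assms
    by (auto simp: parametrization_def irreducible_curve_def nonconst_def)
qed

lemma parametrizationE:
  fixes P :: "'a::field_char_0 poly fract \<times> 'a poly fract"
  assumes "parametrization C P"
  obtains f where "irreducible f" "C = zero_set f" "nonconst P" "feval f P = 0"
proof -
  obtain f where f: "irreducible f" "C = zero_set f"
    using assms by (auto simp: parametrization_def irreducible_curve_def)
  then have "feval f P = 0"
    using vanishes_on_curve_iff[OF assms, of f] by (simp add: zero_set_def)
  then show ?thesis using that f assms by (auto simp: parametrization_def nonconst_def)
qed

lemma parametrized_curve_eq_zero_set:
  fixes P :: "'a::{alg_closed_field, field_char_0} poly fract \<times> 'a poly fract"
  assumes "parametrization C P" "irreducible f" "feval f P = 0"
  shows "C = zero_set f"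
proof -
  have "nonconst P" using assms(1) by (auto simp: parametrization_def nonconst_def)
  then have "parametrization (zero_set f) P" using parametrization_zero_setI assms by blast
  then show ?thesis using assms(1) by (simp add: parametrization_def)
qed


section \<open>Substitution of rational functions\<close>

text \<open>The substitution \<open>t := \<tau>\<close> in \<open>r\<close>. For nonconstant \<open>\<tau>\<close> no denominator becomes zero, since \<open>\<tau>\<close> is
  transcendental, and the value does not depend on the fraction that represents \<open>r\<close>; for constant \<open>\<tau>\<close>
  nothing is claimed.\<close>

definition rat_subst :: "'a::field poly fract \<Rightarrow> 'a poly fract \<Rightarrow> 'a poly fract" where
  "rat_subst \<tau> r = (THE s. \<exists>p q. q \<noteq> 0 \<and> r = Fract p q \<and> s = poly_at p \<tau> / poly_at q \<tau>)"

lemma rat_subst_Fract: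
  fixes \<tau> :: "'a::alg_closed_field poly fract"
  assumes "\<tau> \<notin> range rat_const" "q \<noteq> 0"
  shows "rat_subst \<tau> (Fract p q) = poly_at p \<tau> / poly_at q \<tau>"
  unfolding rat_subst_def
proof (rule the_equality)
  show "\<exists>p' q'. q' \<noteq> 0 \<and> Fract p q = Fract p' q' \<and>
      poly_at p \<tau> / poly_at q \<tau> = poly_at p' \<tau> / poly_at q' \<tau>"
    using assms by blast
next
  fix s assume "\<exists>p' q'. q' \<noteq> 0 \<and> Fract p q = Fract p' q' \<and> s = poly_at p' \<tau> / poly_at q' \<tau>"
  then obtain p' q' where *: "q' \<noteq> 0" "Fract p q = Fract p' q'" "s = poly_at p' \<tau> / poly_at q' \<tau>"
    by blast
  then have "p * q' = p' * q" using assms(2) by (simp add: eq_fract)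
  then have "poly_at p \<tau> * poly_at q' \<tau> = poly_at p' \<tau> * poly_at q \<tau>"
    by (metis poly_at.hom_mult)
  then show "s = poly_at p \<tau> / poly_at q \<tau>"
    using * assms by (simp add: frac_eq_eq poly_at_eq_0_iff)
qed

lemma rat_subst_to_fract:
  fixes \<tau> :: "'a::alg_closed_field poly fract"
  assumes "\<tau> \<notin> range rat_const"
  shows "rat_subst \<tau> (to_fract p) = poly_at p \<tau>"
  unfolding to_fract_def using assms by (simp add: rat_subst_Fract poly_at.hom_one)

lemma rat_subst_morphism:
  fixes \<tau> :: "'a::alg_closed_field poly fract"
  assumes "\<tau> \<notin> range rat_const"
  shows "comm_ring_morphism (rat_subst \<tau>)"
proof
  note nz = poly_at_eq_0_iff[OF assms]
  fix r s :: "'a poly fract"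
  obtain p q where r: "r = Fract p q" "q \<noteq> 0" by (cases r) auto
  obtain p' q' where s: "s = Fract p' q'" "q' \<noteq> 0" by (cases s) auto
  show "rat_subst \<tau> (r + s) = rat_subst \<tau> r + rat_subst \<tau> s"
    using r s by (simp add: rat_subst_Fract[OF assms] poly_at.hom_simps add_frac_eq nz)
  show "rat_subst \<tau> (r * s) = rat_subst \<tau> r * rat_subst \<tau> s"
    using r s by (simp add: rat_subst_Fract[OF assms] poly_at.hom_simps)
  show "rat_subst \<tau> 1 = 1"
    using rat_subst_to_fract[OF assms, of 1] by (simp add: poly_at.hom_one)
qed

lemma rat_subst_rat_const:
  fixes \<tau> :: "'a::alg_closed_field poly fract"
  assumes "\<tau> \<notin> range rat_const"
  shows "rat_subst \<tau> (rat_const c) = rat_const c"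
  using rat_subst_to_fract[OF assms, of "[:c:]"] by (simp add: rat_const_def)

lemma rat_subst_tvar:
  fixes \<tau> :: "'a::alg_closed_field poly fract"
  assumes "\<tau> \<notin> range rat_const"
  shows "rat_subst \<tau> tvar = \<tau>"
  using rat_subst_to_fract[OF assms, of "[:0, 1:]"] by (simp add: rat_const.hom_simps)

lemma rat_subst_eq_0_iff:
  fixes \<tau> :: "'a::alg_closed_field poly fract"
  assumes "\<tau> \<notin> range rat_const"
  shows "rat_subst \<tau> r = 0 \<longleftrightarrow> r = 0"
proof -
  obtain p q where r: "r = Fract p q" "q \<noteq> 0" by (cases r) auto
  then have "r = 0 \<longleftrightarrow> p = 0" by (simp add: Fract_conv_to_fract)
  then show ?thesis using assms r by (simp add: rat_subst_Fract poly_at_eq_0_iff)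
qed

lemma rat_subst_inject:
  fixes \<tau> :: "'a::alg_closed_field poly fract"
  assumes "\<tau> \<notin> range rat_const"
  shows "rat_subst \<tau> r = rat_subst \<tau> s \<longleftrightarrow> r = s"
proof -
  interpret \<sigma>: comm_ring_morphism "rat_subst \<tau>" by (rule rat_subst_morphism[OF assms])
  show ?thesis using rat_subst_eq_0_iff[OF assms, of "r - s"] by (simp add: \<sigma>.hom_diff)
qed

lemma rat_subst_divide:
  fixes \<tau> :: "'a::alg_closed_field poly fract"
  assumes "\<tau> \<notin> range rat_const"
  shows "rat_subst \<tau> (r / s) = rat_subst \<tau> r / rat_subst \<tau> s"
proof (cases "s = 0")
  interpret \<sigma>: comm_ring_morphism "rat_subst \<tau>" by (rule rat_subst_morphism[OF assms])
  case True
  then show ?thesis by (simp add: \<sigma>.hom_zero)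
next
  interpret \<sigma>: comm_ring_morphism "rat_subst \<tau>" by (rule rat_subst_morphism[OF assms])
  case False
  then have "rat_subst \<tau> (r / s) * rat_subst \<tau> s = rat_subst \<tau> r"
    by (simp flip: \<sigma>.hom_mult)
  then show ?thesis using False rat_subst_eq_0_iff[OF assms] by (metis nonzero_eq_divide_eq)
qed

lemma rat_subst_poly_at:
  fixes \<tau> :: "'a::alg_closed_field poly fract"
  assumes "\<tau> \<notin> range rat_const"
  shows "rat_subst \<tau> (poly_at p z) = poly_at p (rat_subst \<tau> z)"
proof -
  interpret \<sigma>: comm_ring_morphism "rat_subst \<tau>" by (rule rat_subst_morphism[OF assms])
  show ?thesis by (induction p) (auto simp: \<sigma>.hom_simps rat_subst_rat_const[OF assms])
qed

lemma rat_subst_feval: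
  fixes \<tau> :: "'a::alg_closed_field poly fract"
  assumes "\<tau> \<notin> range rat_const"
  shows "rat_subst \<tau> (feval f (X, Y)) = feval f (rat_subst \<tau> X, rat_subst \<tau> Y)"
proof -
  interpret \<sigma>: comm_ring_morphism "rat_subst \<tau>" by (rule rat_subst_morphism[OF assms])
  show ?thesis by (induction f) (auto simp: \<sigma>.hom_simps rat_subst_poly_at[OF assms])
qed

lemma rat_subst_notin_range:
  fixes \<tau> :: "'a::alg_closed_field poly fract"
  assumes "\<tau> \<notin> range rat_const" "r \<notin> range rat_const"
  shows "rat_subst \<tau> r \<notin> range rat_const"
  using assms rat_subst_inject[OF assms(1)] rat_subst_rat_const[OF assms(1)]
  by (metis imageE rangeI)

lemma tvar_notin_range: "tvar \<notin> range rat_const"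
  by (auto simp: rat_const_def)


section \<open>Proper parametrizations\<close>

text \<open>The polynomial \<open>h\<^sup>k \<cdot> p(g/h)\<close>; it lets an identity involving \<open>p(g/h)\<close> be transported
  between points of a curve.\<close>

lemma homogenization:
  fixes g h :: "'a::field poly poly"
  assumes "degree p \<le> k"
  obtains G where "\<And>R. feval h R \<noteq> 0 \<Longrightarrow> feval G R = feval h R ^ k * poly_at p (feval g R / feval h R)"
    and "\<And>x. eval2 h x \<noteq> 0 \<Longrightarrow> eval2 G x = eval2 h x ^ k * poly p (eval2 g x / eval2 h x)"
proof -
  have "\<exists>G. (\<forall>R. feval h R \<noteq> 0 \<longrightarrow> feval G R = feval h R ^ k * poly_at p (feval g R / feval h R)) \<and>
    (\<forall>x. eval2 h x \<noteq> 0 \<longrightarrow> eval2 G x = eval2 h x ^ k * poly p (eval2 g x / eval2 h x))"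
    using assms
  proof (induction p arbitrary: k)
    case 0
    then show ?case by (intro exI[of _ 0]) auto
  next
    case (pCons c p)
    show ?case
    proof (cases "p = 0")
      case True
      then show ?thesis
        by (intro exI[of _ "h ^ k * [:[:c:]:]"])
          (auto simp: feval.hom_simps eval2.hom_simps)
    next
      case False
      then obtain k' where k': "k = Suc k'" "degree p \<le> k'"
        using pCons.prems by (cases k) auto
      then obtain G where G:
        "\<And>R. feval h R \<noteq> 0 \<Longrightarrow> feval G R = feval h R ^ k' * poly_at p (feval g R / feval h R)"
        "\<And>x. eval2 h x \<noteq> 0 \<Longrightarrow> eval2 G x = eval2 h x ^ k' * poly p (eval2 g x / eval2 h x)"
        using pCons.IH by blast
      show ?thesis
        by (rule exI[of _ "h ^ k * [:[:c:]:] + g * G"])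
          (auto simp: feval.hom_simps eval2.hom_simps G k' algebra_simps)
    qed
  qed
  then show ?thesis using that by blast
qed

text \<open>If \<open>g/h\<close> inverts \<open>P\<close>, then \<open>X(P) = p(t)/q(t)\<close> says that \<open>X = p(g/h)/q(g/h)\<close> along the curve.
  The polynomial \<open>Z\<close> is this relation with denominators cleared; as it vanishes at \<open>P\<close>, the relation
  holds at every point of the curve at which \<open>h\<close> does not vanish.\<close>

lemma inverse_relation:
  fixes P :: "'a::field_char_0 poly fract \<times> 'a poly fract"
  assumes r: "feval X P = Fract p q" "q \<noteq> 0"
    and g: "feval h P \<noteq> 0" "feval g P = tvar * feval h P"
  obtains Z k where "feval Z P = 0"
    and "\<And>R. feval h R \<noteq> 0 \<Longrightarrow> feval Z R = feval h R ^ k *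
      (poly_at q (feval g R / feval h R) * feval X R - poly_at p (feval g R / feval h R))"
    and "\<And>x. eval2 h x \<noteq> 0 \<Longrightarrow> eval2 Z x = eval2 h x ^ k *
      (poly q (eval2 g x / eval2 h x) * eval2 X x - poly p (eval2 g x / eval2 h x))"
proof -
  define k where "k = max (degree p) (degree q)"
  obtain Gp where Gp: "\<And>R. feval h R \<noteq> 0 \<Longrightarrow> feval Gp R = feval h R ^ k * poly_at p (feval g R / feval h R)"
    "\<And>x. eval2 h x \<noteq> 0 \<Longrightarrow> eval2 Gp x = eval2 h x ^ k * poly p (eval2 g x / eval2 h x)"
    using homogenization[of p k h g] unfolding k_def by auto
  obtain Gq where Gq: "\<And>R. feval h R \<noteq> 0 \<Longrightarrow> feval Gq R = feval h R ^ k * poly_at q (feval g R / feval h R)"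
    "\<And>x. eval2 h x \<noteq> 0 \<Longrightarrow> eval2 Gq x = eval2 h x ^ k * poly q (eval2 g x / eval2 h x)"
    using homogenization[of q k h g] unfolding k_def by auto
  define Z where "Z = Gq * X - Gp"
  have Z: "feval Z R = feval h R ^ k *
      (poly_at q (feval g R / feval h R) * feval X R - poly_at p (feval g R / feval h R))"
    if "feval h R \<noteq> 0" for R
    using that by (simp add: Z_def feval.hom_simps Gp Gq algebra_simps)
  have "eval2 Z x = eval2 h x ^ k *
      (poly q (eval2 g x / eval2 h x) * eval2 X x - poly p (eval2 g x / eval2 h x))"
    if "eval2 h x \<noteq> 0" for x
    using that by (simp add: Z_def eval2.hom_simps Gp Gq algebra_simps)
  moreover have "feval Z P = 0"
    using Z[OF g(1)] g r by (simp add: Fract_conv_to_fract)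
  ultimately show ?thesis using Z that by blast
qed

text \<open>A single identity in \<open>K(t)\<close> suffices for birationality: that \<open>g/h\<close> recovers the parameter
  is this identity evaluated, and that \<open>P\<close> undoes \<open>g/h\<close> on the curve is the transported relation of
  \<open>inverse_relation\<close> for the two coordinate functions.\<close>

lemma proper_parametrizationI:
  fixes P :: "'a::field_char_0 poly fract \<times> 'a poly fract"
  assumes P: "parametrization C P" and g: "feval h P \<noteq> 0" "feval g P = tvar * feval h P"
  shows "proper_parametrization C P"
proof -
  have "\<exists>x\<in>C. eval2 h x \<noteq> 0" using vanishes_on_curve_iff[OF P, of h] g(1) by blast
  moreover have "eval2 g x / eval2 h x = t" if "pair_value P t x" "eval2 h x \<noteq> 0" for t x
  proof -
    have "rat_value (feval g P) t (t * eval2 h x)"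
      unfolding g(2) by (intro rat_value_mult rat_value_tvar rat_value_feval that)
    then have "eval2 g x = t * eval2 h x"
      using rat_value_feval[OF that(1)] rat_value_unique by blast
    then show ?thesis using that(2) by simp
  qed
  moreover have "y = x" if x: "x \<in> C" "eval2 h x \<noteq> 0" and y: "pair_value P (eval2 g x / eval2 h x) y"
    for x y
  proof -
    have *: "v = eval2 X x" if "rat_value (feval X P) (eval2 g x / eval2 h x) v" for X v
    proof -
      obtain p q where pq: "feval X P = Fract p q" "poly q (eval2 g x / eval2 h x) \<noteq> 0"
        "v = poly p (eval2 g x / eval2 h x) / poly q (eval2 g x / eval2 h x)"
        using \<open>rat_value (feval X P) _ v\<close> by (auto simp: rat_value_def)
      have "q \<noteq> 0" using pq by auto
      obtain Z k where Z: "feval Z P = 0" "eval2 Z x = eval2 h x ^ k *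
        (poly q (eval2 g x / eval2 h x) * eval2 X x - poly p (eval2 g x / eval2 h x))"
        by (rule inverse_relation[OF pq(1) \<open>q \<noteq> 0\<close> g]) (use x(2) in blast)
      then have "eval2 Z x = 0" using vanishes_on_curve_iff[OF P] x(1) by blast
      then have "eval2 X x * poly q (eval2 g x / eval2 h x) = poly p (eval2 g x / eval2 h x)"
        using Z(2) x(2) by (simp add: mult.commute)
      then show ?thesis using pq(2,3) by (metis nonzero_eq_divide_eq)
    qed
    have "fst y = fst x"
      using *[of "[:[:0, 1:]:]"] y by (simp add: pair_value_def rat_const.hom_simps)
    moreover have "snd y = snd x"
      using *[of "[:0, 1:]"] y by (simp add: pair_value_def poly_at.hom_simps rat_const.hom_simps)
    ultimately show ?thesis by (simp add: prod_eq_iff)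
  qed
  ultimately show ?thesis using P unfolding proper_parametrization_def by blast
qed

lemma proper_parametrization_inverse:
  fixes P :: "'a::field_char_0 poly fract \<times> 'a poly fract"
  assumes "proper_parametrization C P"
  obtains g h where "feval h P \<noteq> 0" "feval g P = tvar * feval h P"
proof -
  have P: "parametrization C P" using assms by (simp add: proper_parametrization_def)
  obtain g h where h: "\<exists>x\<in>C. eval2 h x \<noteq> 0"
    and g: "\<And>t x. pair_value P t x \<Longrightarrow> eval2 h x \<noteq> 0 \<Longrightarrow> eval2 g x / eval2 h x = t"
    using assms unfolding proper_parametrization_def by blast
  have "feval h P \<noteq> 0" using h vanishes_on_curve_iff[OF P, of h] by blast
  have "feval h P * (feval g P - tvar * feval h P) = 0"
  proof (rule rat_eq_0I[OF finite_undefined_pair[of P]])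
    fix t assume "t \<notin> {t. \<nexists>x. pair_value P t x}"
    then obtain x where x: "pair_value P t x" by blast
    have "rat_value (feval h P * (feval g P + rat_const (-1) * (tvar * feval h P))) t
      (eval2 h x * (eval2 g x + (-1) * (t * eval2 h x)))"
      by (intro rat_value_mult rat_value_add rat_value_feval rat_value_tvar rat_value_rat_const x)
    moreover have "eval2 h x * (eval2 g x + (-1) * (t * eval2 h x)) = 0"
      using g[OF x] by (cases "eval2 h x = 0") (auto simp: field_simps)
    ultimately have "rat_value (feval h P * (feval g P + rat_const (-1) * (tvar * feval h P))) t 0"
      by metis
    then show "rat_value (feval h P * (feval g P - tvar * feval h P)) t 0"
      by (simp add: rat_const.hom_minus rat_const.hom_one)
  qed
  then show ?thesis using that \<open>feval h P \<noteq> 0\<close> by auto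
qed

text \<open>The substitution is \<open>\<tau> = g(y)/h(y)\<close>, where \<open>g/h\<close> inverts \<open>P\<close>. Since \<open>P\<close> and \<open>y\<close> are both generic
  points of \<open>C\<close>, the same polynomials vanish at them; this gives \<open>h(y) \<noteq> 0\<close>, the
  nonconstancy of \<open>\<tau>\<close>, and the equations relating \<open>y\<close> to \<open>P\<close>.\<close>

lemma proper_parametrization_lift:
  fixes P y :: "'a::{alg_closed_field, field_char_0} poly fract \<times> 'a poly fract"
  assumes P: "proper_parametrization C P" and f: "irreducible f" "C = zero_set f"
    and y: "nonconst y" "feval f y = 0"
  obtains \<tau> where "\<tau> \<notin> range rat_const" "y = (rat_subst \<tau> (fst P), rat_subst \<tau> (snd P))"
proof -
  obtain g h where g: "feval h P \<noteq> 0" "feval g P = tvar * feval h P"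
    using proper_parametrization_inverse[OF P] .
  have par: "parametrization C P" using P by (simp add: proper_parametrization_def)
  have dvd: "feval Z P = 0" if "feval Z y = 0" for Z
  proof -
    have "f dvd Z" using irreducible_dvd_vanishing f y that by blast
    moreover have "feval f P = 0"
      using vanishes_on_curve_iff[OF par, of f] f(2) by (simp add: zero_set_def)
    ultimately show ?thesis using feval_eq_0_dvd by blast
  qed
  have dvd': "feval Z y = 0" if "feval Z P = 0" for Z
  proof -
    have "nonconst P" using par by (auto simp: parametrization_def nonconst_def)
    moreover have "feval f P = 0"
      using vanishes_on_curve_iff[OF par, of f] f(2) by (simp add: zero_set_def)
    ultimately have "f dvd Z" using irreducible_dvd_vanishing f that by blast
    then show ?thesis using feval_eq_0_dvd y by blast
  qed
  have hy: "feval h y \<noteq> 0" using g(1) dvd by blast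
  define \<tau> where "\<tau> = feval g y / feval h y"
  have \<tau>: "\<tau> \<notin> range rat_const"
  proof
    assume "\<tau> \<in> range rat_const"
    then obtain c where "feval g y = rat_const c * feval h y" using hy by (auto simp: \<tau>_def field_simps)
    then have "feval (g - [:[:c:]:] * h) y = 0" by (simp add: feval.hom_diff feval.hom_mult)
    then have "feval (g - [:[:c:]:] * h) P = 0" by (rule dvd)
    then have "tvar = rat_const c" using g by (simp add: feval.hom_diff feval.hom_mult)
    then show False using tvar_notin_range by (metis rangeI)
  qed
  have *: "rat_subst \<tau> (feval X P) = feval X y" for X
  proof -
    obtain p q where pq: "feval X P = Fract p q" "q \<noteq> 0" by (cases "feval X P") auto
    obtain Z k where Z: "feval Z P = 0" "feval Z y = feval h y ^ k *
        (poly_at q (feval g y / feval h y) * feval X y - poly_at p (feval g y / feval h y))"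
      by (rule inverse_relation[OF pq g]) (use hy in blast)
    have "poly_at q \<tau> * feval X y = poly_at p \<tau>"
      using Z(2) dvd'[OF Z(1)] hy by (simp add: \<tau>_def)
    moreover have "poly_at q \<tau> \<noteq> 0" using pq(2) poly_at_eq_0_iff[OF \<tau>] by blast
    ultimately show ?thesis
      unfolding pq(1) rat_subst_Fract[OF \<tau> pq(2)] by (simp add: field_simps)
  qed
  have "y = (rat_subst \<tau> (fst P), rat_subst \<tau> (snd P))"
    using *[of "[:[:0, 1:]:]"] *[of "[:0, 1:]"] by (simp add: prod_eq_iff rat_const.hom_simps poly_at.hom_simps)
  then show ?thesis using that \<tau> by blast
qed


section \<open>Lueroth's theorem\<close>

locale intermediate_field =
  fixes L :: "'a::{alg_closed_field, field_char_0} poly fract set"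
  assumes const_mem: "rat_const c \<in> L"
    and add_mem: "x \<in> L \<Longrightarrow> y \<in> L \<Longrightarrow> x + y \<in> L"
    and mult_mem: "x \<in> L \<Longrightarrow> y \<in> L \<Longrightarrow> x * y \<in> L"
    and inverse_mem: "x \<in> L \<Longrightarrow> inverse x \<in> L"
begin

lemma zero_mem: "0 \<in> L"
  using const_mem[of 0] by (simp add: rat_const.hom_zero)

lemma minus_mem: "x \<in> L \<Longrightarrow> - x \<in> L"
  using mult_mem[OF const_mem[of "-1"], of x] by (simp add: rat_const.hom_simps)

lemma diff_mem: "x \<in> L \<Longrightarrow> y \<in> L \<Longrightarrow> x - y \<in> L"
  using add_mem[of x "- y"] minus_mem by simp

lemma divide_mem: "x \<in> L \<Longrightarrow> y \<in> L \<Longrightarrow> x / y \<in> L"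
  by (simp add: divide_inverse mult_mem inverse_mem)

lemma poly_at_mem: "x \<in> L \<Longrightarrow> poly_at p x \<in> L"
  by (induction p) (auto intro: zero_mem add_mem mult_mem const_mem)

lemma rat_subst_mem:
  assumes "\<tau> \<in> L" "\<tau> \<notin> range rat_const"
  shows "rat_subst \<tau> r \<in> L"
proof -
  obtain p q where "r = Fract p q" "q \<noteq> 0" by (cases r) auto
  then show ?thesis using assms by (simp add: rat_subst_Fract divide_mem poly_at_mem)
qed

definition poly_over :: "'a poly fract poly \<Rightarrow> bool" where
  "poly_over p \<longleftrightarrow> (\<forall>n. coeff p n \<in> L)"

lemma poly_over_map_const: "poly_over (map_poly rat_const p)"
  by (simp add: poly_over_def coeff_map_poly rat_const.hom_zero const_mem)

lemma poly_over_smult: "c \<in> L \<Longrightarrow> poly_over p \<Longrightarrow> poly_over (smult c p)"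
  by (simp add: poly_over_def mult_mem)

lemma poly_over_diff: "poly_over p \<Longrightarrow> poly_over q \<Longrightarrow> poly_over (p - q)"
  by (simp add: poly_over_def diff_mem)

lemma poly_over_pCons: "c \<in> L \<Longrightarrow> poly_over p \<Longrightarrow> poly_over (pCons c p)"
  by (simp add: poly_over_def coeff_pCons split: nat.split)

lemma poly_over_0: "poly_over 0"
  by (simp add: poly_over_def zero_mem)

lemma poly_over_mod:
  assumes "poly_over p" "poly_over m" "m \<noteq> 0"
  shows "poly_over (p mod m)"
  using assms(1)
proof (induction p)
  case (pCons c p)
  have "c \<in> L" "poly_over p"
    using pCons.prems by (auto simp: poly_over_def coeff_pCons split: nat.splits)
  then have "poly_over (p mod m)" using pCons by blast
  then have "poly_over (pCons c (p mod m))" using \<open>c \<in> L\<close> by (rule poly_over_pCons[rotated])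
  then show ?case unfolding mod_pCons[OF assms(3)]
    using assms(2) by (intro poly_over_diff poly_over_smult divide_mem) (auto simp: poly_over_def)
qed (simp add: poly_over_0)

end

lemma intermediate_field_rat_subst:
  fixes \<tau> :: "'a::{alg_closed_field, field_char_0} poly fract"
  assumes "\<tau> \<notin> range rat_const"
  shows "intermediate_field (range (rat_subst \<tau>))"
proof
  interpret \<sigma>: comm_ring_morphism "rat_subst \<tau>" by (rule rat_subst_morphism[OF assms])
  fix c x y
  show "rat_const c \<in> range (rat_subst \<tau>)"
    using rat_subst_rat_const[OF assms] by (metis rangeI)
  assume "x \<in> range (rat_subst \<tau>)"
  then obtain r where r: "x = rat_subst \<tau> r" by blast
  have "inverse x = rat_subst \<tau> (1 / r)"
    by (simp add: r rat_subst_divide[OF assms] \<sigma>.hom_one field_simps)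
  then show "inverse x \<in> range (rat_subst \<tau>)" by blast
  assume "y \<in> range (rat_subst \<tau>)"
  then obtain s where s: "y = rat_subst \<tau> s" by blast
  show "x + y \<in> range (rat_subst \<tau>)" "x * y \<in> range (rat_subst \<tau>)"
    unfolding r s by (simp_all flip: \<sigma>.hom_add \<sigma>.hom_mult)
qed

text \<open>The denominator \<open>v\<close> is chosen of least degree. A nonzero remainder in the division of another
  denominator by \<open>v\<close> would be a smaller one.\<close>

lemma lowest_terms:
  fixes r :: "'a::field poly fract"
  obtains u v where "v \<noteq> 0" "r = Fract u v"
    and "\<And>p q. q \<noteq> 0 \<Longrightarrow> r = Fract p q \<Longrightarrow> \<exists>g. g \<noteq> 0 \<and> p = g * u \<and> q = g * v"
proof -
  define n where "n = (LEAST n. \<exists>u v. v \<noteq> 0 \<and> r = Fract u v \<and> degree v = n)"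
  have "\<exists>n u v. v \<noteq> 0 \<and> r = Fract u v \<and> degree v = n" by (cases r) auto
  then have "\<exists>u v. v \<noteq> 0 \<and> r = Fract u v \<and> degree v = n"
    unfolding n_def by (rule LeastI_ex)
  then obtain u v where uv: "v \<noteq> 0" "r = Fract u v" "degree v = n" by blast
  have min: "n \<le> degree q" if "q \<noteq> 0" "r = Fract p q" for p q
    unfolding n_def by (rule Least_le) (use that in blast)
  have "\<exists>g. g \<noteq> 0 \<and> p = g * u \<and> q = g * v" if pq: "q \<noteq> 0" "r = Fract p q" for p q
  proof -
    define g where "g = q div v"
    have eq: "p * v = u * q" using pq uv by (simp add: eq_fract)
    have q: "q = g * v + q mod v" by (simp add: g_def)
    have rem: "(p - g * u) * v = u * (q mod v)"
      using eq by (subst (asm) q) (simp add: algebra_simps)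
    have "q mod v = 0"
    proof (rule ccontr)
      assume nz: "q mod v \<noteq> 0"
      then have "r = Fract (p - g * u) (q mod v)" using rem uv by (simp add: eq_fract)
      then have "n \<le> degree (q mod v)" using min nz by blast
      then show False using degree_mod_less'[OF uv(1) nz] uv(3) by simp
    qed
    then show ?thesis using q rem uv pq by (intro exI[of _ g]) auto
  qed
  then show ?thesis using that uv by blast
qed

text \<open>In \<open>K[t][X]\<close>, the coefficient of \<open>t\<^sup>j\<close> is a polynomial in \<open>X\<close>; so the degree in \<open>t\<close> of a product
  can be computed after specializing \<open>X\<close> to a scalar avoiding finitely many roots.\<close>

lemma coeff_poly_const:
  fixes w :: "'a::comm_ring_1 poly poly"
  shows "coeff (poly w [:x:]) j = poly (map_poly (\<lambda>p. coeff p j) w) x"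
  by (induction w) (auto simp: map_poly_pCons)

text \<open>Let \<open>M\<close> be the minimal polynomial of \<open>t\<close> over \<open>L\<close>, \<open>m \<in> K[t][X]\<close> its multiple without content,
  and \<open>\<tau> = u/v\<close> a nonconstant coefficient of \<open>M\<close> in lowest terms. With \<open>k = max(deg u, deg v)\<close>, the
  polynomial \<open>m\<close> has degree at least \<open>k\<close> in \<open>t\<close>, because \<open>u\<close> and \<open>v\<close> divide two of its coefficients
  with the same quotient. By Gauss's lemma it divides \<open>\<Psi> = u(X) v(t) - v(X) u(t)\<close>, whose degree in \<open>t\<close>
  is at most \<open>k\<close>. So the cofactor is free of \<open>t\<close>, and it has no root, since no specialization of
  \<open>\<Psi>\<close> at a scalar vanishes. Hence \<open>M\<close> is proportional to \<open>u(X) - \<tau> v(X)\<close>, and \<open>t\<close> has the same minimal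
  polynomial over \<open>L\<close> and over \<open>K(\<tau>)\<close>; this forces \<open>L = K(\<tau>)\<close>.\<close>

theorem lueroth:
  fixes L :: "'a::{alg_closed_field, field_char_0} poly fract set"
  assumes "intermediate_field L" and r: "r \<in> L" "r \<notin> range rat_const"
  obtains \<tau> where "\<tau> \<in> L" "\<tau> \<notin> range rat_const" "L \<subseteq> range (rat_subst \<tau>)"
proof -
  interpret L: intermediate_field L by fact
  have poly_tvar: "poly (map_poly rat_const p) tvar = to_fract p" for p :: "'a poly"
    using poly_at_tvar[of p] by (simp add: poly_at_def)
  \<comment> \<open>The polynomial \<open>u(X) - s v(X)\<close> over \<open>K(t)\<close>; for \<open>s = u(t)/v(t)\<close> it has the root \<open>t\<close>.\<close>
  define T where "T u v s = map_poly rat_const u - smult s (map_poly rat_const v)"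
    for u v :: "'a poly" and s
  have T_over: "L.poly_over (T u v s)" if "s \<in> L" for u v s
    unfolding T_def by (intro L.poly_over_diff L.poly_over_smult L.poly_over_map_const that)
  have T_root: "poly (T u v (Fract u v)) tvar = 0" if "v \<noteq> 0" for u v
    using that by (simp add: T_def poly_tvar Fract_conv_to_fract)
  have T_nz: "T u v s \<noteq> 0" if "v \<noteq> 0" "s \<notin> range rat_const" for u v s
  proof
    assume "T u v s = 0"
    then have "coeff (T u v s) (degree v) = 0" by simp
    then have "rat_const (coeff u (degree v)) = s * rat_const (lead_coeff v)"
      by (simp add: T_def coeff_map_poly rat_const.hom_zero)
    then have "s = rat_const (coeff u (degree v) / lead_coeff v)"
      using that(1) by (simp add: rat_const_divide field_simps)
    then show False using that(2) by blast
  qed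
  define n where "n = (LEAST n. \<exists>M. M \<noteq> 0 \<and> L.poly_over M \<and> poly M tvar = 0 \<and> degree M = n)"
  have "\<exists>n M. M \<noteq> 0 \<and> L.poly_over M \<and> poly M tvar = 0 \<and> degree M = n"
  proof -
    obtain u v where "r = Fract u v" "v \<noteq> 0" by (cases r) auto
    then show ?thesis using T_over[OF r(1)] T_root T_nz r(2) by metis
  qed
  then have "\<exists>M. M \<noteq> 0 \<and> L.poly_over M \<and> poly M tvar = 0 \<and> degree M = n"
    unfolding n_def by (rule LeastI_ex)
  then obtain M0 where M0: "M0 \<noteq> 0" "L.poly_over M0" "poly M0 tvar = 0" "degree M0 = n" by blast
  have min: "n \<le> degree h" if "h \<noteq> 0" "L.poly_over h" "poly h tvar = 0" for h
    unfolding n_def by (rule Least_le) (use that in blast)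
  define M where "M = smult (inverse (lead_coeff M0)) M0"
  have M: "M \<noteq> 0" "L.poly_over M" "poly M tvar = 0" "degree M = n" "lead_coeff M = 1"
    using M0 by (auto simp: M_def L.poly_over_def intro!: L.mult_mem L.inverse_mem)
  have small: "h = 0" if "L.poly_over h" "poly h tvar = 0" "h = 0 \<or> degree h < n" for h
    using min[of h] that by fastforce
  have M_dvd: "M dvd h" if h: "L.poly_over h" "poly h tvar = 0" for h
  proof -
    have "poly (h mod M) tvar = 0" using h(2) M(3) by (simp add: poly_mod)
    then have "h mod M = 0"
      using small[OF L.poly_over_mod[OF h(1) M(2,1)]] degree_mod_less[OF M(1), of h] M(4) by blast
    then show ?thesis by (simp add: dvd_eq_mod_eq_0)
  qed
  \<comment> \<open>Not all coefficients of \<open>M\<close> are scalars, as \<open>t\<close> is transcendental.\<close>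
  obtain i where i: "coeff M i \<notin> range rat_const"
  proof (rule ccontr)
    assume "\<not> thesis"
    then have *: "coeff M i \<in> range rat_const" for i using that by blast
    define M' where "M' = map_poly (inv rat_const) M"
    have inv0: "inv rat_const 0 = (0::'a)"
      by (metis inv_f_f injI rat_const.hom_zero rat_const_eq_iff)
    have "M = map_poly rat_const M'"
      unfolding M'_def using * by (intro poly_eqI)
        (simp add: coeff_map_poly rat_const.hom_zero inv0 f_inv_into_f)
    moreover from this have "to_fract M' = 0" using M(3) poly_tvar by metis
    ultimately show False using M(1) by simp
  qed
  define \<tau> where "\<tau> = coeff M i"
  have \<tau>: "\<tau> \<in> L" "\<tau> \<notin> range rat_const" using M(2) i by (auto simp: \<tau>_def L.poly_over_def)
  obtain D N where DN: "D \<noteq> 0" "fract_poly N = smult (to_fract D) M"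
    using clear_denominators .
  then have "N \<noteq> 0" using M(1) by force
  then obtain c m where m: "c \<noteq> 0" "N = smult c m" "content_free m"
    using exists_content_free_part by blast
  define \<kappa> where "\<kappa> = to_fract D / to_fract c"
  have "\<kappa> \<noteq> 0" using DN m by (simp add: \<kappa>_def)
  have "smult (to_fract c) (fract_poly m) = smult (to_fract c) (smult \<kappa> M)"
    using DN(2) m(1) unfolding m(2) by (simp add: \<kappa>_def)
  then have "smult (to_fract c) (fract_poly m - smult \<kappa> M) = 0" unfolding smult_diff_right by simp
  then have mM: "fract_poly m = smult \<kappa> M" using m(1) by simp
  have coeff_m: "to_fract (coeff m j) = \<kappa> * coeff M j" for j
    using arg_cong[OF mM, of "\<lambda>p. coeff p j"] by (simp add: coeff_map_poly)
  define e where "e = degree M"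
  have me: "to_fract (coeff m e) = \<kappa>" using coeff_m[of e] M(5) by (simp add: e_def)
  then have "coeff m e \<noteq> 0" using \<open>\<kappa> \<noteq> 0\<close> by auto
  have \<tau>_eq: "\<tau> = Fract (coeff m i) (coeff m e)"
    using coeff_m[of i] me \<open>\<kappa> \<noteq> 0\<close> by (simp add: Fract_conv_to_fract \<tau>_def)
  obtain u v where uv: "v \<noteq> 0" "\<tau> = Fract u v"
    and low: "\<And>p q. q \<noteq> 0 \<Longrightarrow> \<tau> = Fract p q \<Longrightarrow> \<exists>g. g \<noteq> 0 \<and> p = g * u \<and> q = g * v"
    using lowest_terms[of \<tau>] by metis
  define k where "k = max (degree u) (degree v)"
  obtain g where g: "g \<noteq> 0" "coeff m i = g * u" "coeff m e = g * v"
    using low[OF \<open>coeff m e \<noteq> 0\<close> \<tau>_eq] by blast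
  have "u \<noteq> 0" using \<tau>(2) uv(2) rat_const.hom_zero by (metis Fract_conv_to_fract div_0 rangeI to_fract_0)
  obtain l where l: "coeff m l \<noteq> 0" "k \<le> degree (coeff m l)"
  proof (cases "degree u \<le> degree v")
    case True
    then show ?thesis using that[of e] g uv(1) by (simp add: k_def degree_mult_eq)
  next
    case False
    then show ?thesis using that[of i] g \<open>u \<noteq> 0\<close> by (simp add: k_def degree_mult_eq)
  qed
  \<comment> \<open>A relation between \<open>u\<close> and \<open>v\<close> would make \<open>\<tau>\<close> a scalar, unless both vanish at \<open>x\<close>;
      then \<open>t - x\<close> cancels, contrary to lowest terms.\<close>
  have spec_nz: "smult (poly u x) v - smult (poly v x) u \<noteq> 0" for x
  proof
    assume eq: "smult (poly u x) v - smult (poly v x) u = 0"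
    show False
    proof (cases "poly v x = 0")
      case False
      then have "v \<noteq> 0" by auto
      have "rat_const (poly u x) * to_fract v = rat_const (poly v x) * to_fract u"
        using eq unfolding rat_const_def to_fract_mult[symmetric] by simp
      then have "\<tau> = rat_const (poly u x / poly v x)"
        using False \<open>v \<noteq> 0\<close> by (simp add: uv(2) Fract_conv_to_fract rat_const_divide frac_eq_eq mult.commute)
      then show False using \<tau>(2) by blast
    next
      case True
      then have "poly u x = 0" using eq uv(1) by simp
      then obtain u' v' where u'v': "u = [:-x, 1:] * u'" "v = [:-x, 1:] * v'"
        using True by (metis dvdE poly_eq_0_iff_dvd)
      then have "v' \<noteq> 0" using uv(1) by auto
      moreover have "\<tau> = Fract u' v'"
        unfolding uv(2) u'v' using \<open>v' \<noteq> 0\<close> by (intro mult_fract_cancel) auto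
      ultimately obtain g where "g \<noteq> 0" "v' = g * v" using low by blast
      then have "degree v' = degree g + degree v" using uv(1) by (simp add: degree_mult_eq)
      moreover have "degree v = Suc (degree v')" unfolding u'v'(2)
        using \<open>v' \<noteq> 0\<close> by (subst degree_mult_eq) auto
      ultimately show False by simp
    qed
  qed
  define cp :: "'a poly \<Rightarrow> 'a poly poly" where "cp = map_poly (\<lambda>c. [:c:])"
  define \<Psi> where "\<Psi> = smult v (cp u) - smult u (cp v)"
  have poly_cp: "poly (cp p) [:x:] = [:poly p x:]" for p x
    unfolding cp_def by (induction p) (auto simp: map_poly_pCons)
  have fract_cp: "fract_poly (cp p) = map_poly rat_const p" for p
    unfolding cp_def by (rule poly_eqI) (simp add: coeff_map_poly rat_const_def)
  have \<Psi>T: "fract_poly \<Psi> = smult (to_fract v) (T u v \<tau>)"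
    using uv(1) by (simp add: \<Psi>_def T_def fract_cp uv(2) Fract_conv_to_fract smult_diff_right)
  have \<Psi>_spec: "poly \<Psi> [:x:] = smult (poly u x) v - smult (poly v x) u" for x
    by (simp add: \<Psi>_def poly_cp)
  have "M dvd T u v \<tau>" using M_dvd T_over[OF \<tau>(1)] T_root[OF uv(1)] uv(2) by metis
  then have "fract_poly m dvd fract_poly \<Psi>"
    unfolding mM \<Psi>T using \<open>\<kappa> \<noteq> 0\<close> by (simp add: smult_dvd_iff dvd_smult)
  then obtain q' where q': "fract_poly \<Psi> = fract_poly m * q'" by auto
  obtain D' N' where D'N': "D' \<noteq> 0" "fract_poly N' = smult (to_fract D') q'"
    using clear_denominators .
  have "fract_poly (smult D' \<Psi>) = fract_poly (m * N')" using q' D'N'(2) by simp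
  then have "smult D' \<Psi> = m * N'" unfolding fract_poly_eq_iff .
  then have "m dvd \<Psi>" using content_free_dvd_smult[OF m(3) D'N'(1)] by (metis dvd_triv_left)
  then obtain w where w: "\<Psi> = m * w" by auto
  \<comment> \<open>A power \<open>t\<^sup>j\<close> with \<open>j \<ge> 1\<close> in the cofactor would raise the degree of \<open>\<Psi>\<close> in \<open>t\<close> above \<open>k\<close>.\<close>
  have Wj: "map_poly (\<lambda>p. coeff p j) w = 0" if "j \<ge> 1" for j
  proof (rule ccontr)
    define W where "W = map_poly (\<lambda>p. coeff p j) w"
    define W' where "W' = map_poly (\<lambda>p. coeff p (degree (coeff m l))) m"
    assume "map_poly (\<lambda>p. coeff p j) w \<noteq> 0"
    then have "W \<noteq> 0" by (simp add: W_def)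
    moreover have "coeff W' l \<noteq> 0" using l by (simp add: W'_def coeff_map_poly)
    then have "W' \<noteq> 0" by auto
    ultimately have "finite {x. poly (W * W') x = 0}" using poly_roots_finite by (metis mult_eq_0_iff)
    then obtain x where "poly (W * W') x \<noteq> 0"
      using ex_new_if_finite[OF infinite_UNIV_char_0] by blast
    then have "coeff (poly w [:x:]) j \<noteq> 0" "coeff (poly m [:x:]) (degree (coeff m l)) \<noteq> 0"
      by (auto simp: coeff_poly_const W_def W'_def)
    then have "j \<le> degree (poly w [:x:])" "k \<le> degree (poly m [:x:])"
      "poly w [:x:] \<noteq> 0" "poly m [:x:] \<noteq> 0"
      using le_degree l(2) le_trans by (blast, blast, auto)
    then have "k + 1 \<le> degree (poly m [:x:] * poly w [:x:])" using that by (simp add: degree_mult_eq)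
    also have "poly m [:x:] * poly w [:x:] = smult (poly u x) v - smult (poly v x) u"
      by (simp flip: \<Psi>_spec add: w)
    also have "degree \<dots> \<le> k"
      unfolding k_def by (intro degree_diff_le order.trans[OF degree_smult_le]) auto
    finally show False by simp
  qed
  define w0 where "w0 = map_poly (\<lambda>p. coeff p 0) w"
  have w_spec: "poly w [:x:] = [:poly w0 x:]" for x
  proof (rule poly_eqI)
    fix j show "coeff (poly w [:x:]) j = coeff [:poly w0 x:] j"
      using Wj[of j] by (cases j) (auto simp: coeff_poly_const w0_def)
  qed
  have "poly w0 x \<noteq> 0" for x
    using \<Psi>_spec[of x] spec_nz[of x] w_spec[of x] by (auto simp: w)
  then have "degree w0 = 0" using alg_closed_imp_poly_has_root by (metis gr0I)
  then obtain c0 where c0: "w0 = [:c0:]" by (metis degree_eq_zeroE)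
  have w_const: "w = [:[:c0:]:]"
  proof (intro poly_eqI)
    fix a j
    have "coeff (coeff w a) j = coeff (map_poly (\<lambda>p. coeff p j) w) a" by (simp add: coeff_map_poly)
    also have "\<dots> = (if j = 0 then coeff w0 a else 0)" using Wj[of j] by (auto simp: w0_def)
    finally show "coeff (coeff w a) j = coeff (coeff [:[:c0:]:] a) j"
      by (auto simp: c0 coeff_pCons split: nat.splits)
  qed
  have "c0 \<noteq> 0" using \<open>\<And>x. poly w0 x \<noteq> 0\<close>[of 0] by (simp add: c0)
  interpret E: intermediate_field "range (rat_subst \<tau>)"
    by (rule intermediate_field_rat_subst[OF \<tau>(2)])
  have "\<tau> \<in> range (rat_subst \<tau>)" using rat_subst_tvar[OF \<tau>(2)] by (metis rangeI)
  then have TE: "E.poly_over (T u v \<tau>)"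
    unfolding T_def by (intro E.poly_over_diff E.poly_over_smult E.poly_over_map_const)
  have "smult (to_fract v) (T u v \<tau>) = fract_poly m * fract_poly w"
    using \<Psi>T by (simp add: w)
  also have "\<dots> = smult (rat_const c0 * \<kappa>) M"
    by (simp add: mM w_const map_poly_pCons rat_const_def)
  finally have TM: "smult (to_fract v) (T u v \<tau>) = smult (rat_const c0 * \<kappa>) M" .
  define \<eta> where "\<eta> = rat_const c0 * \<kappa> / to_fract v"
  have TM: "coeff (T u v \<tau>) j = \<eta> * coeff M j" for j
    using arg_cong[OF TM, of "\<lambda>p. coeff p j"] uv(1) by (simp add: \<eta>_def field_simps)
  have "\<eta> \<noteq> 0" using \<open>c0 \<noteq> 0\<close> \<open>\<kappa> \<noteq> 0\<close> uv(1) by (simp add: \<eta>_def)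
  have "coeff M j = coeff (T u v \<tau>) j / coeff (T u v \<tau>) e" for j
    using TM[of j] TM[of e] M(5) \<open>\<eta> \<noteq> 0\<close> by (simp add: e_def)
  then have ME: "E.poly_over M"
    using TE by (auto simp: E.poly_over_def intro!: E.divide_mem)
  have E_sub: "L.poly_over p" if "E.poly_over p" for p
    using that L.rat_subst_mem[OF \<tau>] by (metis E.poly_over_def L.poly_over_def imageE)
  \<comment> \<open>For \<open>\<xi> = a/b\<close>, the remainders of \<open>a\<close> and \<open>\<xi> b\<close> modulo \<open>M\<close> agree at \<open>t\<close>, hence are equal; so \<open>\<xi>\<close>
      is a quotient of coefficients of remainders that have coefficients in \<open>K(\<tau>)\<close>.\<close>
  have "\<xi> \<in> range (rat_subst \<tau>)" if \<xi>: "\<xi> \<in> L" for \<xi>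
  proof -
    obtain a b where ab: "\<xi> = Fract a b" "b \<noteq> 0" by (cases \<xi>) auto
    define a1 where "a1 = map_poly rat_const a mod M"
    define b1 where "b1 = map_poly rat_const b mod M"
    have ov: "E.poly_over a1" "E.poly_over b1"
      unfolding a1_def b1_def by (intro E.poly_over_mod E.poly_over_map_const ME M(1))+
    have val: "poly a1 tvar = to_fract a" "poly b1 tvar = to_fract b"
      using M(3) by (simp_all add: a1_def b1_def poly_mod poly_tvar)
    have "a1 - smult \<xi> b1 = (map_poly rat_const a - smult \<xi> (map_poly rat_const b)) mod M"
      by (simp add: a1_def b1_def poly_mod_diff_left mod_smult_left)
    then have "a1 - smult \<xi> b1 = 0 \<or> degree (a1 - smult \<xi> b1) < n"
      using degree_mod_less[OF M(1)] M(4) by metis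
    moreover have "poly (a1 - smult \<xi> b1) tvar = 0"
      using ab by (simp add: val Fract_conv_to_fract)
    moreover have "L.poly_over (a1 - smult \<xi> b1)"
      by (intro L.poly_over_diff L.poly_over_smult E_sub ov \<xi>)
    ultimately have "a1 - smult \<xi> b1 = 0" using small by blast
    moreover have "b1 \<noteq> 0" using val(2) ab(2) by auto
    ultimately have "\<xi> = coeff a1 (degree b1) / coeff b1 (degree b1)" by simp
    then show ?thesis using ov E.divide_mem unfolding E.poly_over_def by metis
  qed
  then show ?thesis using that \<tau> by blast
qed

text \<open>Lueroth's theorem for the field generated by the coordinates of a parametrization \<open>R\<close> gives
  \<open>R = P(\<tau>)\<close> with \<open>\<tau>\<close> a rational function of \<open>R\<close>. Cancelling the substitution \<open>\<tau>\<close>, the parameter \<open>t\<close> is the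
  same rational function of \<open>P\<close>.\<close>

theorem exists_proper_parametrization:
  fixes C :: "('a::{alg_closed_field, field_char_0} \<times> 'a) set"
  assumes "rational_curve C"
  obtains P where "proper_parametrization C P"
proof -
  obtain R where R: "parametrization C R" using assms by (auto simp: rational_curve_def)
  obtain f where f: "irreducible f" "C = zero_set f" "nonconst R" "feval f R = 0"
    using parametrizationE[OF R] .
  define L where "L = {feval g R / feval h R | g h. feval h R \<noteq> 0}"
  have LI: "feval g R / feval h R \<in> L" if "feval h R \<noteq> 0" for g h
    using that unfolding L_def by blast
  have "intermediate_field L"
  proof
    fix c x y
    show "rat_const c \<in> L" using LI[of 1 "[:[:c:]:]"] by (simp add: feval.hom_one)
    assume "x \<in> L"
    then obtain g h where x: "x = feval g R / feval h R" "feval h R \<noteq> 0" unfolding L_def by blast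
    show "inverse x \<in> L"
    proof (cases "feval g R = 0")
      case True
      then show ?thesis using LI[of 1 0] x by (simp add: feval.hom_one)
    next
      case False
      then show ?thesis using LI[of g h] x by simp
    qed
    assume "y \<in> L"
    then obtain g' h' where y: "y = feval g' R / feval h' R" "feval h' R \<noteq> 0" unfolding L_def by blast
    show "x + y \<in> L" using LI[of "h * h'" "g * h' + g' * h"] x y
      by (simp add: feval.hom_simps add_frac_eq)
    show "x * y \<in> L" using LI[of "h * h'" "g * g'"] x y by (simp add: feval.hom_simps)
  qed
  moreover have RL: "fst R \<in> L" "snd R \<in> L"
    using LI[of 1 "[:[:0, 1:]:]"] LI[of 1 "[:0, 1:]"]
    by (simp_all add: feval.hom_one rat_const.hom_simps poly_at.hom_simps)
  moreover have "fst R \<notin> range rat_const \<or> snd R \<notin> range rat_const"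
    using f(3) by (auto simp: nonconst_def)
  ultimately obtain \<tau> where \<tau>: "\<tau> \<in> L" "\<tau> \<notin> range rat_const" "L \<subseteq> range (rat_subst \<tau>)"
    using lueroth by metis
  interpret \<sigma>: comm_ring_morphism "rat_subst \<tau>" by (rule rat_subst_morphism[OF \<tau>(2)])
  obtain P1 P2 where P: "fst R = rat_subst \<tau> P1" "snd R = rat_subst \<tau> P2"
    using RL \<tau>(3) by blast
  have RP: "feval q R = rat_subst \<tau> (feval q (P1, P2))" for q
    using rat_subst_feval[OF \<tau>(2), of q P1 P2] P by (metis prod.collapse)
  have "feval f (P1, P2) = 0" using f(4) RP rat_subst_eq_0_iff[OF \<tau>(2)] by metis
  moreover have "nonconst (P1, P2)"
    using f(3) P rat_subst_rat_const[OF \<tau>(2)] unfolding nonconst_def by (metis fst_conv image_iff snd_conv)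
  ultimately have "parametrization C (P1, P2)" using parametrization_zero_setI f by blast
  moreover obtain g h where gh: "\<tau> = feval g R / feval h R" "feval h R \<noteq> 0"
    using \<tau>(1) unfolding L_def by blast
  have "feval h (P1, P2) \<noteq> 0" using gh(2) RP \<sigma>.hom_zero by metis
  moreover have "feval g R = \<tau> * feval h R" using gh by simp
  then have "rat_subst \<tau> (feval g (P1, P2)) = rat_subst \<tau> (tvar * feval h (P1, P2))"
    unfolding RP \<sigma>.hom_mult rat_subst_tvar[OF \<tau>(2)] .
  then have "feval g (P1, P2) = tvar * feval h (P1, P2)" unfolding rat_subst_inject[OF \<tau>(2)] .
  ultimately show ?thesis using that proper_parametrizationI by blast
qed


section \<open>Rays through the focus\<close>

text \<open>The homothety with centre \<open>A\<close> and ratio \<open>\<mu>\<close>.\<close>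

definition ray :: "'b::comm_ring_1 \<times> 'b \<Rightarrow> 'b \<Rightarrow> 'b \<times> 'b \<Rightarrow> 'b \<times> 'b" where
  "ray A \<mu> y = (fst A + \<mu> * (fst y - fst A), snd A + \<mu> * (snd y - snd A))"

definition sqdist :: "'b::comm_ring_1 \<times> 'b \<Rightarrow> 'b \<times> 'b \<Rightarrow> 'b" where
  "sqdist A y = (fst y - fst A)\<^sup>2 + (snd y - snd A)\<^sup>2"

abbreviation const_point :: "'a::field \<times> 'a \<Rightarrow> 'a poly fract \<times> 'a poly fract" where
  "const_point x \<equiv> (rat_const (fst x), rat_const (snd x))"

lemma ray_ray: "ray A \<mu> (ray A \<nu> y) = ray A (\<mu> * \<nu>) y"
  by (simp add: ray_def mult.assoc)

lemma ray_1: "ray A 1 y = y"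
  by (simp add: ray_def)

lemma sqdist_ray: "sqdist A (ray A \<mu> y) = \<mu>\<^sup>2 * sqdist A y"
  by (simp add: sqdist_def ray_def power_mult_distrib distrib_left)

lemma const_point_ray: "const_point (ray A \<mu> y) = ray (const_point A) (rat_const \<mu>) (const_point y)"
  by (simp add: ray_def rat_const.hom_simps)

lemma sqdist_const_point: "sqdist (const_point A) (const_point y) = rat_const (sqdist A y)"
  by (simp add: sqdist_def rat_const.hom_simps)

lemma feval_const_point: "feval f (const_point x) = rat_const (eval2 f x)"
  using feval_rat_const[of f "fst x" "snd x"] by simp

text \<open>A point at signed distance \<open>\<rho>\<close> from \<open>A\<close> is moved to signed distance \<open>\<rho> + \<delta>\<close> by the ratio
  \<open>1 + \<delta>/\<rho>\<close>; successive shifts along a ray add up.\<close>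

lemma ray_shift:
  fixes \<rho> :: "'b::field"
  assumes "\<rho> \<noteq> 0" "\<rho> + \<delta> \<noteq> 0"
  shows "ray A (1 + \<epsilon> / (\<rho> + \<delta>)) (ray A (1 + \<delta> / \<rho>) y) = ray A (1 + (\<delta> + \<epsilon>) / \<rho>) y"
proof -
  have "(1 + \<epsilon> / (\<rho> + \<delta>)) * (1 + \<delta> / \<rho>) = 1 + (\<delta> + \<epsilon>) / \<rho>"
    using assms by (simp add: divide_simps)
  then show ?thesis by (simp add: ray_ray)
qed

lemma sqdist_ray_shift:
  fixes \<rho> :: "'b::field"
  assumes "\<rho> \<noteq> 0" "\<rho>\<^sup>2 = sqdist A y"
  shows "sqdist A (ray A (1 + \<delta> / \<rho>) y) = (\<rho> + \<delta>)\<^sup>2"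
proof -
  have "(1 + \<delta> / \<rho>) * \<rho> = \<rho> + \<delta>" using assms(1) by (simp add: field_simps)
  then show ?thesis unfolding sqdist_ray assms(2)[symmetric] by (metis power_mult_distrib)
qed

definition sqdist_poly :: "'a::field \<times> 'a \<Rightarrow> 'a poly poly" where
  "sqdist_poly A = [:[:- fst A, 1:]:]\<^sup>2 + [:[:- snd A:], 1:]\<^sup>2"

lemma feval_sqdist_poly [simp]: "feval (sqdist_poly A) y = sqdist (const_point A) y"
  by (simp add: sqdist_poly_def sqdist_def feval.hom_simps rat_const.hom_simps poly_at.hom_simps
      add.commute)

lemma eval2_sqdist_poly [simp]: "eval2 (sqdist_poly A) y = sqdist A y"
  by (simp add: sqdist_poly_def sqdist_def eval2.hom_simps)

definition line_poly :: "'a::field \<times> 'a \<Rightarrow> 'a \<Rightarrow> 'a \<Rightarrow> 'a poly poly" where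
  "line_poly A u v = [:[:- (u * fst A + v * snd A), u:], [:v:]:]"

lemma feval_line_poly:
  "feval (line_poly A u v) y =
     rat_const u * (fst y - rat_const (fst A)) + rat_const v * (snd y - rat_const (snd A))"
  by (simp add: line_poly_def rat_const.hom_simps algebra_simps)

lemma eval2_line_poly: "eval2 (line_poly A u v) y = u * (fst y - fst A) + v * (snd y - snd A)"
  by (simp add: line_poly_def algebra_simps)


section \<open>Functions on the double cover by the distance from the focus\<close>

text \<open>Functions on the double cover \<open>s\<^sup>2 = n(y)\<close> of the plane with poles only along \<open>n = 0\<close>. Since
  \<open>1/s = s/n\<close>, all of them have the form \<open>(\<alpha> + \<beta> s)/n\<^sup>k\<close> with polynomials \<open>\<alpha>\<close> and \<open>\<beta>\<close>.\<close>

definition regular ::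
    "'a::field \<times> 'a \<Rightarrow> ('a poly fract \<times> 'a poly fract \<Rightarrow> 'a poly fract \<Rightarrow> 'a poly fract) \<Rightarrow> bool" where
  "regular A \<phi> \<longleftrightarrow> (\<exists>\<alpha> \<beta> k. \<forall>y s. s \<noteq> 0 \<and> s\<^sup>2 = sqdist (const_point A) y \<longrightarrow>
     sqdist (const_point A) y ^ k * \<phi> y s = feval \<alpha> y + feval \<beta> y * s)"

lemma regular_feval: "regular A (\<lambda>y s. feval g y)"
  unfolding regular_def by (intro exI[of _ g] exI[of _ 0]) simp

lemma regular_const: "regular A (\<lambda>y s. rat_const c)"
  using regular_feval[of A "[:[:c:]:]"] by simp

lemma regular_dist: "regular A (\<lambda>y s. s)"
  unfolding regular_def by (intro exI[of _ 0] exI[of _ 1]) (simp add: feval.hom_one)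

lemma regular_inverse_dist: "regular A (\<lambda>y s. 1 / s)"
  unfolding regular_def
proof (intro exI allI impI)
  fix y and s :: "'a poly fract" assume "s \<noteq> 0 \<and> s\<^sup>2 = sqdist (const_point A) y"
  then show "sqdist (const_point A) y ^ 1 * (1 / s) = feval 0 y + feval 1 y * s"
    by (simp add: feval.hom_one power2_eq_square flip: \<open>s \<noteq> 0 \<and> _\<close>[THEN conjunct2])
qed

lemma regular_add:
  assumes "regular A \<phi>" "regular A \<psi>"
  shows "regular A (\<lambda>y s. \<phi> y s + \<psi> y s)"
proof -
  let ?n = "sqdist (const_point A)"
  obtain \<alpha> \<beta> k where 1: "\<And>y s. s \<noteq> 0 \<and> s\<^sup>2 = ?n y \<Longrightarrow> ?n y ^ k * \<phi> y s = feval \<alpha> y + feval \<beta> y * s"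
    using assms(1) unfolding regular_def by blast
  obtain \<alpha>' \<beta>' k' where 2: "\<And>y s. s \<noteq> 0 \<and> s\<^sup>2 = ?n y \<Longrightarrow> ?n y ^ k' * \<psi> y s = feval \<alpha>' y + feval \<beta>' y * s"
    using assms(2) unfolding regular_def by blast
  show ?thesis unfolding regular_def
  proof (intro exI allI impI)
    fix y s assume *: "s \<noteq> 0 \<and> s\<^sup>2 = ?n y"
    have "?n y ^ (k + k') * (\<phi> y s + \<psi> y s) =
      ?n y ^ k' * (?n y ^ k * \<phi> y s) + ?n y ^ k * (?n y ^ k' * \<psi> y s)"
      by (simp add: power_add algebra_simps)
    then show "?n y ^ (k + k') * (\<phi> y s + \<psi> y s) =
      feval (sqdist_poly A ^ k' * \<alpha> + sqdist_poly A ^ k * \<alpha>') y +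
      feval (sqdist_poly A ^ k' * \<beta> + sqdist_poly A ^ k * \<beta>') y * s"
      unfolding 1[OF *] 2[OF *] by (simp add: feval.hom_simps algebra_simps)
  qed
qed

lemma regular_mult:
  assumes "regular A \<phi>" "regular A \<psi>"
  shows "regular A (\<lambda>y s. \<phi> y s * \<psi> y s)"
proof -
  let ?n = "sqdist (const_point A)"
  obtain \<alpha> \<beta> k where 1: "\<And>y s. s \<noteq> 0 \<and> s\<^sup>2 = ?n y \<Longrightarrow> ?n y ^ k * \<phi> y s = feval \<alpha> y + feval \<beta> y * s"
    using assms(1) unfolding regular_def by blast
  obtain \<alpha>' \<beta>' k' where 2: "\<And>y s. s \<noteq> 0 \<and> s\<^sup>2 = ?n y \<Longrightarrow> ?n y ^ k' * \<psi> y s = feval \<alpha>' y + feval \<beta>' y * s"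
    using assms(2) unfolding regular_def by blast
  show ?thesis unfolding regular_def
  proof (intro exI allI impI)
    fix y s assume *: "s \<noteq> 0 \<and> s\<^sup>2 = ?n y"
    have "?n y ^ (k + k') * (\<phi> y s * \<psi> y s) = (?n y ^ k * \<phi> y s) * (?n y ^ k' * \<psi> y s)"
      by (simp add: power_add algebra_simps)
    also have "\<dots> = feval \<alpha> y * feval \<alpha>' y + feval \<beta> y * feval \<beta>' y * s\<^sup>2 +
        (feval \<alpha> y * feval \<beta>' y + feval \<beta> y * feval \<alpha>' y) * s"
      unfolding 1[OF *] 2[OF *] by (simp add: power2_eq_square algebra_simps)
    finally show "?n y ^ (k + k') * (\<phi> y s * \<psi> y s) =
      feval (\<alpha> * \<alpha>' + \<beta> * \<beta>' * sqdist_poly A) y + feval (\<alpha> * \<beta>' + \<beta> * \<alpha>') y * s"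
      using * by (simp add: feval.hom_simps)
  qed
qed

lemma regular_diff:
  assumes "regular A \<phi>" "regular A \<psi>"
  shows "regular A (\<lambda>y s. \<phi> y s - \<psi> y s)"
  using regular_add[OF assms(1) regular_mult[OF regular_const[of A "-1"] assms(2)]]
  by (simp add: rat_const.hom_simps)

lemma regular_poly_at: "regular A \<phi> \<Longrightarrow> regular A (\<lambda>y s. poly_at p (\<phi> y s))"
proof (induction p)
  case 0
  then show ?case using regular_const[of A 0] by (simp add: rat_const.hom_zero)
qed (auto intro: regular_add regular_mult regular_const)

lemma regular_feval_comp:
  assumes "regular A \<phi>" "regular A \<psi>"
  shows "regular A (\<lambda>y s. feval f (\<phi> y s, \<psi> y s))"
proof (induction f)
  case 0
  then show ?case using regular_const[of A 0] by (simp add: rat_const.hom_zero)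
next
  case (pCons c f)
  then show ?case
    using regular_add[OF regular_poly_at[OF assms(1)] regular_mult[OF assms(2) pCons.IH]] by simp
qed

lemma regular_ray: "regular A (\<lambda>y s. feval f (ray (const_point A) (1 + rat_const \<delta> / s) y))"
proof -
  have 1: "regular A (\<lambda>y s. rat_const (fst A) + (rat_const 1 + rat_const \<delta> * (1 / s)) *
      (feval [:[:0, 1:]:] y - rat_const (fst A)))"
    by (intro regular_add regular_mult regular_diff regular_const regular_inverse_dist regular_feval)
  have 2: "regular A (\<lambda>y s. rat_const (snd A) + (rat_const 1 + rat_const \<delta> * (1 / s)) *
      (feval [:0, 1:] y - rat_const (snd A)))"
    by (intro regular_add regular_mult regular_diff regular_const regular_inverse_dist regular_feval)
  show ?thesis using regular_feval_comp[OF 1 2]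
    by (simp add: ray_def rat_const.hom_simps poly_at.hom_simps)
qed

text \<open>The same \<open>\<alpha>\<close>, \<open>\<beta>\<close> and \<open>k\<close> serve for points over \<open>K(t)\<close> and for points of \<open>K\<^sup>2\<close>, because the
  latter are the constant points over \<open>K(t)\<close>.\<close>

lemma ray_expansion:
  fixes A :: "'a::field \<times> 'a"
  obtains \<alpha> \<beta> k where
    "\<And>y s. s \<noteq> 0 \<Longrightarrow> s\<^sup>2 = sqdist (const_point A) y \<Longrightarrow>
       sqdist (const_point A) y ^ k * feval f (ray (const_point A) (1 + rat_const \<delta> / s) y) =
       feval \<alpha> y + feval \<beta> y * s"
    "\<And>y s. s \<noteq> 0 \<Longrightarrow> s\<^sup>2 = sqdist A y \<Longrightarrow>
       sqdist A y ^ k * eval2 f (ray A (1 + \<delta> / s) y) = eval2 \<alpha> y + eval2 \<beta> y * s"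
proof -
  obtain \<alpha> \<beta> k where *: "\<And>y s. s \<noteq> 0 \<Longrightarrow> s\<^sup>2 = sqdist (const_point A) y \<Longrightarrow>
       sqdist (const_point A) y ^ k * feval f (ray (const_point A) (1 + rat_const \<delta> / s) y) =
       feval \<alpha> y + feval \<beta> y * s"
    using regular_ray[of A f \<delta>] unfolding regular_def by blast
  have "sqdist A y ^ k * eval2 f (ray A (1 + \<delta> / s) y) = eval2 \<alpha> y + eval2 \<beta> y * s"
    if s: "s \<noteq> 0" "s\<^sup>2 = sqdist A y" for y s
  proof -
    have "rat_const s \<noteq> 0" "(rat_const s)\<^sup>2 = sqdist (const_point A) (const_point y)"
      using s by (simp_all add: sqdist_const_point flip: rat_const.hom_power)
    note * [OF this]
    moreover have "ray (const_point A) (1 + rat_const \<delta> / rat_const s) (const_point y) =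
        const_point (ray A (1 + \<delta> / s) y)"
      unfolding const_point_ray by (simp add: rat_const.hom_simps rat_const_divide)
    ultimately have "rat_const (sqdist A y ^ k * eval2 f (ray A (1 + \<delta> / s) y)) =
        rat_const (eval2 \<alpha> y + eval2 \<beta> y * s)"
      by (simp only: feval_const_point sqdist_const_point rat_const.hom_simps)
    then show ?thesis by simp
  qed
  then show ?thesis using that * by blast
qed

text \<open>The polynomial is the norm \<open>\<alpha>\<^sup>2 - \<beta>\<^sup>2 n = (\<alpha> + \<beta> s)(\<alpha> - \<beta> s)\<close>. It turns an equation that
  involves a square root of \<open>n\<close> into one between polynomials, which can be moved from one generic point
  of a curve to all its points.\<close>

lemma regular_norm:
  assumes "regular A \<phi>"
  obtains F where "\<And>y s. s \<noteq> 0 \<Longrightarrow> s\<^sup>2 = sqdist (const_point A) y \<Longrightarrow>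
    feval F y = 0 \<longleftrightarrow> \<phi> y s = 0 \<or> \<phi> y (- s) = 0"
proof -
  let ?n = "sqdist (const_point A)"
  obtain \<alpha> \<beta> k where *: "\<And>y s. s \<noteq> 0 \<and> s\<^sup>2 = ?n y \<Longrightarrow> ?n y ^ k * \<phi> y s = feval \<alpha> y + feval \<beta> y * s"
    using assms unfolding regular_def by blast
  have "feval (\<alpha>\<^sup>2 - \<beta>\<^sup>2 * sqdist_poly A) y = 0 \<longleftrightarrow> \<phi> y s = 0 \<or> \<phi> y (- s) = 0"
    if s: "s \<noteq> 0" "s\<^sup>2 = ?n y" for y s
  proof -
    have "feval (\<alpha>\<^sup>2 - \<beta>\<^sup>2 * sqdist_poly A) y = (feval \<alpha> y)\<^sup>2 - (feval \<beta> y)\<^sup>2 * s\<^sup>2"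
      by (simp add: feval.hom_simps s(2))
    also have "\<dots> = (feval \<alpha> y + feval \<beta> y * s) * (feval \<alpha> y + feval \<beta> y * (- s))"
      by (simp add: power2_eq_square algebra_simps)
    also have "\<dots> = (?n y ^ k * \<phi> y s) * (?n y ^ k * \<phi> y (- s))"
      using *[of s y] *[of "- s" y] s by simp
    finally show ?thesis using s by auto
  qed
  then show ?thesis using that by blast
qed


section \<open>A curve and its focus\<close>

locale focal_curve =
  fixes A :: "'a::{alg_closed_field, field_char_0} \<times> 'a"
    and C :: "('a \<times> 'a) set" and f :: "'a poly poly"
    and P :: "'a poly fract \<times> 'a poly fract"
  assumes parametrization: "parametrization C P"
    and irreducible: "irreducible f"
    and curve_eq: "C = zero_set f"
    and not_line: "(u, v) \<noteq> (0, 0) \<Longrightarrow> C \<noteq> {y. u * (fst y - fst A) + v * (snd y - snd A) = 0}"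
begin

abbreviation "A\<^sub>F \<equiv> const_point A"
abbreviation "n \<equiv> sqdist A\<^sub>F"

lemma nonconst_P: "nonconst P"
  using parametrization by (auto simp: parametrization_def nonconst_def)

lemma vanishes_iff: "(\<forall>x\<in>C. eval2 h x = 0) \<longleftrightarrow> feval h P = 0"
  by (rule vanishes_on_curve_iff[OF parametrization])

lemma f_P: "feval f P = 0"
  using vanishes_iff[of f] curve_eq by (simp add: zero_set_def)

lemma vanishes_at_point: "feval h P = 0 \<Longrightarrow> feval f y = 0 \<Longrightarrow> feval h y = 0"
  using irreducible_dvd_vanishing[OF nonconst_P irreducible f_P] feval_eq_0_dvd by blast

lemma vanishes_at_P: "nonconst y \<Longrightarrow> feval f y = 0 \<Longrightarrow> feval h y = 0 \<Longrightarrow> feval h P = 0"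
  using irreducible_dvd_vanishing[OF _ irreducible] feval_eq_0_dvd f_P by blast

lemma line_poly_P:
  assumes "(u, v) \<noteq> (0, 0)"
  shows "feval (line_poly A u v) P \<noteq> 0"
proof
  assume 0: "feval (line_poly A u v) P = 0"
  have "irreducible (line_poly A u v)"
    unfolding line_poly_def by (rule irreducible_linear_bivariate[OF assms])
  then have "C = zero_set (line_poly A u v)"
    using parametrized_curve_eq_zero_set[OF parametrization] 0 by blast
  then show False using not_line[OF assms] by (simp add: zero_set_def eval2_line_poly)
qed

text \<open>If a generic point of \<open>C\<close> lies on a line through \<open>A\<close>, so does \<open>P\<close>, and \<open>C\<close> is that line.\<close>

lemma off_lines:
  assumes "nonconst y" "feval f y = 0" "(u, v) \<noteq> (0, 0)"
  shows "rat_const u * (fst y - rat_const (fst A)) + rat_const v * (snd y - rat_const (snd A)) \<noteq> 0"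
  using vanishes_at_P[OF assms(1,2), of "line_poly A u v"] line_poly_P[OF assms(3)]
  unfolding feval_line_poly by blast

text \<open>Over the algebraically closed field, \<open>n\<close> is a product of two linear forms in \<open>y - A\<close>, and \<open>y\<close>
  lies on neither of the two lines through \<open>A\<close> that they define.\<close>

lemma n_nonzero:
  assumes "nonconst y" "feval f y = 0"
  shows "n y \<noteq> 0"
proof -
  obtain i :: 'a where i: "i\<^sup>2 = -1" using nth_root_exists[of 2 "-1"] by auto
  then have i': "rat_const i * rat_const i = -1"
    by (metis power2_eq_square rat_const.hom_mult rat_const.hom_minus rat_const.hom_one)
  define X where "X = fst y - rat_const (fst A)"
  define Y where "Y = snd y - rat_const (snd A)"
  have "(X + rat_const i * Y) * (X + rat_const (- i) * Y) = X\<^sup>2 - rat_const i * rat_const i * Y\<^sup>2"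
    by (simp add: rat_const.hom_minus algebra_simps power2_eq_square)
  then have n: "n y = (X + rat_const i * Y) * (X + rat_const (- i) * Y)"
    unfolding i' by (simp add: sqdist_def X_def[symmetric] Y_def[symmetric])
  have "X + rat_const i * Y \<noteq> 0" for i
    using off_lines[OF assms, of 1 i] by (simp add: X_def Y_def rat_const.hom_one)
  then show ?thesis unfolding n mult_eq_0_iff by blast
qed

lemma exists_point_off_focus: obtains y \<rho> where "y \<in> C" "\<rho> \<noteq> 0" "\<rho>\<^sup>2 = sqdist A y"
proof -
  have "feval (sqdist_poly A) P \<noteq> 0" using n_nonzero[OF nonconst_P f_P] by simp
  then obtain y where y: "y \<in> C" "sqdist A y \<noteq> 0"
    using vanishes_iff[of "sqdist_poly A"] by auto
  obtain \<rho> where \<rho>: "\<rho>\<^sup>2 = sqdist A y" using nth_root_exists[of 2 "sqdist A y"] by auto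
  then have "\<rho> \<noteq> 0" using y(2) by auto
  then show ?thesis using that y(1) \<rho> by blast
qed

text \<open>The ratio \<open>\<mu>\<close> and the root \<open>\<rho>\<close> determine each other by \<open>\<rho> = d/(\<mu> - 1)\<close>.\<close>

lemma conchoid_eq:
  assumes "d \<noteq> 0"
  shows "conchoid A d C =
    zariski_closure {ray A (1 + d / \<rho>) y | y \<rho>. y \<in> C \<and> \<rho> \<noteq> 0 \<and> \<rho>\<^sup>2 = sqdist A y}"
proof -
  have eq: "A + (\<mu> * fst (y - A), \<mu> * snd (y - A)) = ray A \<mu> y" for \<mu> y
    by (simp add: ray_def prod_eq_iff)
  have nrm: "norm_sq (ray A \<mu> y - y) = (\<mu> - 1)\<^sup>2 * sqdist A y" for \<mu> y
  proof -
    have "c + \<mu> * (z - c) - z = (\<mu> - 1) * (z - c)" for c z by (simp add: algebra_simps)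
    then show ?thesis
      by (simp add: norm_sq_def ray_def sqdist_def power_mult_distrib distrib_left)
  qed
  have *: "(\<exists>\<mu>. norm_sq (x - y) = d\<^sup>2 \<and> x = ray A \<mu> y) \<longleftrightarrow>
    (\<exists>\<rho>. \<rho> \<noteq> 0 \<and> \<rho>\<^sup>2 = sqdist A y \<and> x = ray A (1 + d / \<rho>) y)" for x y
  proof
    assume "\<exists>\<mu>. norm_sq (x - y) = d\<^sup>2 \<and> x = ray A \<mu> y"
    then obtain \<mu> where "norm_sq (x - y) = d\<^sup>2" "x = ray A \<mu> y" by blast
    then have \<mu>: "(\<mu> - 1)\<^sup>2 * sqdist A y = d\<^sup>2" "x = ray A \<mu> y" by (simp_all only: nrm)
    then have nz: "\<mu> - 1 \<noteq> 0" using assms by auto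
    have "(d / (\<mu> - 1))\<^sup>2 = sqdist A y"
      using nz unfolding power_divide \<mu>(1)[symmetric] by simp
    moreover have "1 + d / (d / (\<mu> - 1)) = \<mu>" using assms nz by simp
    moreover have "d / (\<mu> - 1) \<noteq> 0" using assms nz by simp
    ultimately show "\<exists>\<rho>. \<rho> \<noteq> 0 \<and> \<rho>\<^sup>2 = sqdist A y \<and> x = ray A (1 + d / \<rho>) y"
      using \<mu>(2) by (intro exI[of _ "d / (\<mu> - 1)"]) (simp only: simp_thms)
  next
    assume "\<exists>\<rho>. \<rho> \<noteq> 0 \<and> \<rho>\<^sup>2 = sqdist A y \<and> x = ray A (1 + d / \<rho>) y"
    then obtain \<rho> where \<rho>: "\<rho> \<noteq> 0" "\<rho>\<^sup>2 = sqdist A y" "x = ray A (1 + d / \<rho>) y" by blast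
    have "norm_sq (x - y) = d\<^sup>2"
      unfolding \<rho>(3) nrm \<rho>(2)[symmetric] using \<rho>(1) by (simp add: power_divide)
    then show "\<exists>\<mu>. norm_sq (x - y) = d\<^sup>2 \<and> x = ray A \<mu> y" using \<rho>(3) by blast
  qed
  have "{x. \<exists>y \<mu>. y \<in> C \<and> norm_sq (x - y) = d\<^sup>2 \<and> x = ray A \<mu> y} =
    {ray A (1 + d / \<rho>) y | y \<rho>. y \<in> C \<and> \<rho> \<noteq> 0 \<and> \<rho>\<^sup>2 = sqdist A y}" (is "?L = ?R")
  proof (intro equalityI subsetI)
    fix x assume "x \<in> ?L"
    then obtain y where "y \<in> C" "\<exists>\<mu>. norm_sq (x - y) = d\<^sup>2 \<and> x = ray A \<mu> y" by blast
    then show "x \<in> ?R" unfolding * by (elim exE conjE) (intro CollectI exI conjI)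
  next
    fix x assume "x \<in> ?R"
    then obtain y \<rho> where y: "y \<in> C" "\<rho> \<noteq> 0" "\<rho>\<^sup>2 = sqdist A y" "x = ray A (1 + d / \<rho>) y"
      by (elim CollectE exE conjE)
    then have "\<exists>\<mu>. norm_sq (x - y) = d\<^sup>2 \<and> x = ray A \<mu> y"
      unfolding * by (intro exI conjI)
    then show "x \<in> ?L" using y(1) by blast
  qed
  then show ?thesis unfolding conchoid_def eq by (simp only:)
qed

lemma vanishes_on_conchoid_iff:
  assumes "d \<noteq> 0"
  shows "(\<forall>x\<in>conchoid A d C. eval2 h x = 0) \<longleftrightarrow>
    (\<forall>y \<rho>. y \<in> C \<longrightarrow> \<rho> \<noteq> 0 \<longrightarrow> \<rho>\<^sup>2 = sqdist A y \<longrightarrow> eval2 h (ray A (1 + d / \<rho>) y) = 0)"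
proof -
  let ?S = "{ray A (1 + d / \<rho>) y | y \<rho>. y \<in> C \<and> \<rho> \<noteq> 0 \<and> \<rho>\<^sup>2 = sqdist A y}"
  have "(\<forall>x\<in>zariski_closure S. eval2 h x = 0) \<longleftrightarrow> (\<forall>x\<in>S. eval2 h x = 0)" for S
    unfolding zariski_closure_def by blast
  then have "(\<forall>x\<in>conchoid A d C. eval2 h x = 0) \<longleftrightarrow> (\<forall>x\<in>?S. eval2 h x = 0)"
    unfolding conchoid_eq[OF assms] .
  also have "\<dots> \<longleftrightarrow> (\<forall>y \<rho>. y \<in> C \<and> \<rho> \<noteq> 0 \<and> \<rho>\<^sup>2 = sqdist A y \<longrightarrow> eval2 h (ray A (1 + d / \<rho>) y) = 0)"
    by blast
  finally show ?thesis by blast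
qed

text \<open>Passage from points over \<open>K\<close> to points over \<open>K(t)\<close>. Over a point of \<open>C\<close> both square roots of \<open>n\<close>
  contribute to the conchoid, so the even part \<open>\<alpha>\<close> and the odd part \<open>\<beta>\<close> of \<open>h\<close> vanish separately on
  \<open>C\<close>, away from \<open>n = 0\<close>, and therefore at all points of \<open>C\<close> over \<open>K(t)\<close> off \<open>n = 0\<close>.\<close>

lemma vanishes_on_conchoid_point:
  assumes d: "d \<noteq> 0" and h: "\<forall>x\<in>conchoid A d C. eval2 h x = 0"
    and y: "feval f y = 0" "\<rho> \<noteq> 0" "\<rho>\<^sup>2 = n y"
  shows "feval h (ray A\<^sub>F (1 + rat_const d / \<rho>) y) = 0"
proof -
  obtain \<alpha> \<beta> k where
    F: "\<And>y s. s \<noteq> 0 \<Longrightarrow> s\<^sup>2 = n y \<Longrightarrow>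
       n y ^ k * feval h (ray A\<^sub>F (1 + rat_const d / s) y) = feval \<alpha> y + feval \<beta> y * s"
    and K: "\<And>y s. s \<noteq> 0 \<Longrightarrow> s\<^sup>2 = sqdist A y \<Longrightarrow>
       sqdist A y ^ k * eval2 h (ray A (1 + d / s) y) = eval2 \<alpha> y + eval2 \<beta> y * s"
    by (rule ray_expansion[where A = A and f = h and \<delta> = d]) (rule that)
  have *: "eval2 \<alpha> x = 0 \<and> eval2 \<beta> x = 0" if x: "x \<in> C" "sqdist A x \<noteq> 0" for x
  proof -
    obtain s where s: "s\<^sup>2 = sqdist A x" using nth_root_exists[of 2 "sqdist A x"] by auto
    then have "s \<noteq> 0" using x by auto
    have *: "eval2 \<alpha> x + eval2 \<beta> x * \<rho> = 0" if \<rho>: "\<rho> \<noteq> 0" "\<rho>\<^sup>2 = sqdist A x" for \<rho>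
    proof -
      have "eval2 h (ray A (1 + d / \<rho>) x) = 0"
        using h x(1) \<rho> unfolding vanishes_on_conchoid_iff[OF d] by blast
      then show ?thesis by (simp flip: K[OF \<rho>])
    qed
    have 1: "eval2 \<alpha> x + eval2 \<beta> x * s = 0" by (rule *[OF \<open>s \<noteq> 0\<close> s])
    have 2: "eval2 \<alpha> x + eval2 \<beta> x * (- s) = 0" by (rule *) (use \<open>s \<noteq> 0\<close> s in simp_all)
    from 2 have "eval2 \<alpha> x = eval2 \<beta> x * s" by simp
    with 1 have "2 * (eval2 \<beta> x * s) = 0" by (simp only: mult_2)
    then have "eval2 \<beta> x = 0" using \<open>s \<noteq> 0\<close> by simp
    with 1 show ?thesis by simp
  qed
  then have "\<forall>x\<in>C. eval2 (sqdist_poly A * \<alpha>) x = 0" "\<forall>x\<in>C. eval2 (sqdist_poly A * \<beta>) x = 0"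
    by (auto simp: eval2.hom_mult)
  then have "feval (sqdist_poly A * \<alpha>) y = 0" "feval (sqdist_poly A * \<beta>) y = 0"
    by (simp_all add: vanishes_iff vanishes_at_point[OF _ y(1)])
  moreover have "n y \<noteq> 0" using y(2) by (simp flip: y(3))
  ultimately have "feval \<alpha> y = 0" "feval \<beta> y = 0" by (simp_all add: feval.hom_mult)
  then have "n y ^ k * feval h (ray A\<^sub>F (1 + rat_const d / \<rho>) y) = 0" by (simp add: F[OF y(2,3)])
  then show ?thesis using \<open>n y \<noteq> 0\<close> by simp
qed

end


section \<open>The reparametrizing curve\<close>

lemma numerator_exists:
  fixes H :: "'a::field poly fract poly"
  obtains N where "is_numerator H N"
proof -
  define m where "m = (LEAST m. \<exists>D N. D \<noteq> 0 \<and> fract_poly N = smult (to_fract D) H \<and> degree D = m)"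
  have "\<exists>m D N. D \<noteq> 0 \<and> fract_poly N = smult (to_fract D) H \<and> degree D = m"
    using clear_denominators[of H] by metis
  then have "\<exists>D N. D \<noteq> 0 \<and> fract_poly N = smult (to_fract D) H \<and> degree D = m"
    unfolding m_def by (rule LeastI_ex)
  then obtain D N where DN: "D \<noteq> 0" "fract_poly N = smult (to_fract D) H" "degree D = m" by blast
  have min: "m \<le> degree D'" if "D' \<noteq> 0" "fract_poly N' = smult (to_fract D') H" for D' N'
    unfolding m_def by (rule Least_le) (use that in blast)
  have "c dvd 1" if c: "c dvd D" "[:c:] dvd N" for c
  proof -
    obtain D' where D': "D = c * D'" using c(1) by auto
    obtain N' where N': "N = smult c N'" using c(2) by auto
    have nz: "c \<noteq> 0" "D' \<noteq> 0" using D' DN(1) by auto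
    have "smult (to_fract c) (fract_poly N' - smult (to_fract D') H) = 0"
      using DN(2) unfolding D' N' by (simp add: smult_diff_right)
    then have "fract_poly N' = smult (to_fract D') H" using nz(1) by simp
    then have "m \<le> degree D'" using min nz(2) by blast
    then have "degree c = 0" using DN(3) nz by (simp add: D' degree_mult_eq)
    then show ?thesis using nz(1) by (simp add: is_unit_iff_degree)
  qed
  then have "is_numerator H N" unfolding is_numerator_def using DN by blast
  then show ?thesis using that by blast
qed

text \<open>Whichever primitive part is chosen, it is proportional over \<open>K(t)\<close> to the rational
  function that defines the curve.\<close>

lemma reparametrizing_polynomial:
  fixes P :: "'a::field poly fract \<times> 'a poly fract"
  assumes "reparam_fun A P \<noteq> 0"
  obtains g \<kappa> where "reparametrizing_curve A P = zero_set g" "content_free g" "\<kappa> \<noteq> 0"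
    "fract_poly g = smult \<kappa> (reparam_fun A P)"
proof -
  let ?H = "reparam_fun A P"
  define g where "g = (SOME g. \<exists>N. is_numerator ?H N \<and> is_primitive_part N g)"
  obtain N where N: "is_numerator ?H N" using numerator_exists .
  then have "N \<noteq> 0" using assms by (auto simp: is_numerator_def)
  then obtain c g0 where "c \<noteq> 0" "N = smult c g0" "content_free g0"
    using exists_content_free_part by blast
  then have "is_primitive_part N g0"
    unfolding is_primitive_part_def content_free_def by blast
  then have "\<exists>g N. is_numerator ?H N \<and> is_primitive_part N g" using N by blast
  then have "\<exists>N. is_numerator ?H N \<and> is_primitive_part N g"
    unfolding g_def by (rule someI_ex)
  then obtain N where N: "is_numerator ?H N" "is_primitive_part N g" by blast
  then obtain D c where D: "D \<noteq> 0" "fract_poly N = smult (to_fract D) ?H"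
    and c: "c \<noteq> 0" "N = smult c g" and cf: "content_free g"
    unfolding is_numerator_def is_primitive_part_def content_free_def by blast
  have "smult (to_fract c) (fract_poly g - smult (to_fract D / to_fract c) ?H) = 0"
    using D(2) c(1) unfolding c(2) by (simp add: smult_diff_right)
  then have "fract_poly g = smult (to_fract D / to_fract c) ?H" using c(1) by simp
  moreover have "reparametrizing_curve A P = zero_set g"
    by (simp add: reparametrizing_curve_def g_def)
  ultimately show ?thesis using that[of g "to_fract D / to_fract c"] cf D(1) c(1) by simp
qed

lemma reparam_fun_eq:
  "reparam_fun A P =
    [: - (snd P - rat_const (snd A)), - 2 * (fst P - rat_const (fst A)), snd P - rat_const (snd A) :]"
proof -
  have "- 2 * [:0, 1:] * [:p:] + ([:0, 1:]\<^sup>2 - 1) * [:q:] = [:- q, - 2 * p, q:]"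
    for p q :: "'a poly fract"
    by (simp add: power2_eq_square one_pCons numeral_poly)
  then show ?thesis unfolding reparam_fun_def Let_def .
qed

lemma rat_subst_id:
  fixes r :: "'a::alg_closed_field poly fract"
  shows "rat_subst tvar r = r"
proof -
  obtain u v where "r = Fract u v" "v \<noteq> 0" by (cases r) auto
  then show ?thesis by (simp add: rat_subst_Fract[OF tvar_notin_range] flip: Fract_conv_to_fract)
qed

text \<open>At a point with nonconstant first coordinate \<open>X\<close>, evaluation factors through \<open>K(t)[x\<^sub>2]\<close>; so
  \<open>g\<close> may be replaced there by the polynomial over \<open>K(t)\<close> to which it is proportional.\<close>

lemma feval_via_fract_poly:
  fixes X :: "'a::alg_closed_field poly fract"
  assumes "X \<notin> range rat_const"
  shows "feval g (X, Y) = poly (map_poly (rat_subst X) (fract_poly g)) Y"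
proof -
  interpret \<sigma>: comm_ring_morphism "rat_subst X" by (rule rat_subst_morphism[OF assms])
  show ?thesis unfolding feval_def
    by (simp add: map_poly_map_poly \<sigma>.hom_zero o_def rat_subst_to_fract[OF assms])
qed

context focal_curve
begin

text \<open>The double cover of \<open>C\<close> by the square root of \<open>n\<close> is irreducible, and it has a nonconstant
  point over \<open>K(t)\<close>.\<close>

definition splitting_condition :: bool where
  "splitting_condition \<longleftrightarrow> (\<nexists>r. n P = r\<^sup>2) \<and>
     (\<exists>\<tau> r. \<tau> \<notin> range rat_const \<and> rat_subst \<tau> (n P) = r\<^sup>2)"

abbreviation "p \<equiv> fst P - rat_const (fst A)"
abbreviation "q \<equiv> snd P - rat_const (snd A)"

lemma q_nonzero: "q \<noteq> 0"
  using off_lines[OF nonconst_P f_P, of 0 1] by (simp add: rat_const.hom_simps)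

lemma p_nonzero: "p \<noteq> 0"
  using off_lines[OF nonconst_P f_P, of 1 0] by (simp add: rat_const.hom_simps)

text \<open>The discriminant of \<open>\<kappa>(q x\<^sub>2\<^sup>2 - 2 p x\<^sub>2 - q)\<close> is \<open>(2\<kappa>)\<^sup>2 (p\<^sup>2 + q\<^sup>2) = (2\<kappa>)\<^sup>2 n(P)\<close>.\<close>

lemma reparam_polynomial:
  obtains g where "reparametrizing_curve A P = zero_set g" "content_free g" "degree g = 2"
    and "(\<nexists>r. n P = r\<^sup>2) \<Longrightarrow> irreducible g"
    and "\<And>X Y. X \<notin> range rat_const \<Longrightarrow> feval g (X, Y) = 0 \<longleftrightarrow>
      rat_subst X q * Y\<^sup>2 - 2 * rat_subst X p * Y - rat_subst X q = 0"
proof -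
  have "reparam_fun A P \<noteq> 0" using q_nonzero by (simp add: reparam_fun_eq)
  then obtain g \<kappa> where g: "reparametrizing_curve A P = zero_set g" "content_free g" "\<kappa> \<noteq> 0"
    "fract_poly g = smult \<kappa> (reparam_fun A P)"
    using reparametrizing_polynomial by blast
  have fg: "fract_poly g = [: - (\<kappa> * q), - 2 * (\<kappa> * p), \<kappa> * q :]"
    unfolding g(4) reparam_fun_eq by (simp add: algebra_simps)
  have deg: "degree g = 2"
  proof -
    have "degree g = degree (fract_poly g)" by (rule degree_map_poly[symmetric]) simp
    also have "\<dots> = 2" unfolding fg using g(3) q_nonzero by simp
    finally show ?thesis .
  qed
  have cg: "to_fract (coeff g i) = coeff [: - (\<kappa> * q), - 2 * (\<kappa> * p), \<kappa> * q :] i" for i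
    unfolding fg[symmetric] by (simp add: coeff_map_poly)
  have irr: "irreducible g" if nonsq: "\<nexists>r. n P = r\<^sup>2"
  proof (rule irreducible_quadratic[OF g(2) deg])
    fix w show "w\<^sup>2 \<noteq> (coeff g 1)\<^sup>2 - 4 * coeff g 0 * coeff g 2"
    proof
      assume "w\<^sup>2 = (coeff g 1)\<^sup>2 - 4 * coeff g 0 * coeff g 2"
      then have "w * w = coeff g 1 * coeff g 1 - (2 * 2) * coeff g 0 * coeff g 2"
        by (simp add: power2_eq_square)
      then have "to_fract w * to_fract w = to_fract (coeff g 1) * to_fract (coeff g 1)
        - (to_fract 2 * to_fract 2) * to_fract (coeff g 0) * to_fract (coeff g 2)"
        by (metis to_fract_diff to_fract_mult)
      moreover have "to_fract (2 :: 'a poly) = 2" by (metis one_add_one to_fract_1 to_fract_add)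
      ultimately have "(to_fract w)\<^sup>2 = (2 * \<kappa>)\<^sup>2 * n P"
        by (simp add: cg sqdist_def power2_eq_square numeral_2_eq_2 algebra_simps)
      then have "n P = (to_fract w / (2 * \<kappa>))\<^sup>2" using g(3) by (simp add: power_divide)
      then show False using nonsq by blast
    qed
  qed
  have "feval g (X, Y) = 0 \<longleftrightarrow>
      rat_subst X q * Y\<^sup>2 - 2 * rat_subst X p * Y - rat_subst X q = 0"
    if X: "X \<notin> range rat_const" for X Y
  proof -
    interpret \<sigma>: comm_ring_morphism "rat_subst X" by (rule rat_subst_morphism[OF X])
    have "feval g (X, Y) = rat_subst X \<kappa> *
      (rat_subst X q * Y\<^sup>2 - 2 * rat_subst X p * Y - rat_subst X q)"
      unfolding feval_via_fract_poly[OF X] fg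
      by (simp add: map_poly_pCons \<sigma>.hom_simps power2_eq_square algebra_simps)
    then show ?thesis using rat_subst_eq_0_iff[OF X] g(3) by simp
  qed
  then show ?thesis using that g deg irr by blast
qed

lemma rat_subst_n:
  assumes "\<tau> \<notin> range rat_const"
  shows "rat_subst \<tau> (n y) = n (rat_subst \<tau> (fst y), rat_subst \<tau> (snd y))"
proof -
  interpret \<sigma>: comm_ring_morphism "rat_subst \<tau>" by (rule rat_subst_morphism[OF assms])
  show ?thesis by (simp add: sqdist_def \<sigma>.hom_simps rat_subst_rat_const[OF assms])
qed

text \<open>If \<open>n(P) = r\<^sup>2\<close>, the equation has the two roots \<open>(p + r)/q\<close> and \<open>(p - r)/q\<close> in \<open>K(t)\<close>. An
  irreducible equation of the curve vanishing at the first divides a polynomial that is linear in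
  \<open>x\<^sub>2\<close>, so the roots agree and \<open>r = 0\<close>. For the substitution one takes the first coordinate \<open>X\<close> of a
  parametrization of the curve: with the second coordinate \<open>Y\<close>, solving the equation for \<open>p(X)\<close> gives
  \<open>n(P(X)) = (q(X) (Y\<^sup>2 + 1)/(2 Y))\<^sup>2\<close>.\<close>

lemma splitting_if_reparametrizing_curve_rational:
  assumes "rational_curve (reparametrizing_curve A P)"
  shows splitting_condition
proof -
  obtain g where g: "reparametrizing_curve A P = zero_set g" "content_free g" "degree g = 2"
    and gX: "\<And>X Y. X \<notin> range rat_const \<Longrightarrow> feval g (X, Y) = 0 \<longleftrightarrow>
      rat_subst X q * Y\<^sup>2 - 2 * rat_subst X p * Y - rat_subst X q = 0"
    using reparam_polynomial by metis
  obtain T where T: "parametrization (zero_set g) T"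
    using assms unfolding g(1) rational_curve_def by blast
  obtain e where e: "irreducible e" "zero_set g = zero_set e" "nonconst T" "feval e T = 0"
    using parametrizationE[OF T] .
  have gT: "feval g T = 0" using vanishes_on_curve_iff[OF T, of g] by (simp add: zero_set_def)
  have "\<nexists>r. n P = r\<^sup>2"
  proof
    assume "\<exists>r. n P = r\<^sup>2"
    then obtain r where r: "n P = r\<^sup>2" by blast
    define Y where "Y s = (p + s) / q" for s
    have eY: "feval e (tvar, Y s) = 0" if s: "s\<^sup>2 = n P" for s
    proof -
      have qY: "q * Y s = p + s" using q_nonzero by (simp add: Y_def)
      have "q * (q * (Y s)\<^sup>2 - 2 * p * Y s - q) = (q * Y s)\<^sup>2 - 2 * p * (q * Y s) - q\<^sup>2"
        by (simp add: power2_eq_square algebra_simps)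
      also have "\<dots> = s\<^sup>2 - (p\<^sup>2 + q\<^sup>2)" unfolding qY by (simp add: power2_eq_square algebra_simps)
      also have "\<dots> = 0" unfolding s by (simp add: sqdist_def)
      finally have "feval g (tvar, Y s) = 0"
        using gX[OF tvar_notin_range] q_nonzero by (simp add: rat_subst_id)
      then have "eval2 g x = 0" if "pair_value (tvar, Y s) t x" for t x
        using eval2_eq_0_if_feval_eq_0 that by blast
      then have "eval2 e x = 0" if "pair_value (tvar, Y s) t x" for t x
        using that e(2) unfolding zero_set_def by blast
      then show ?thesis by (rule feval_eq_0_if_vanishes_on_values)
    qed
    obtain u w where uw: "Y r = Fract u w" "w \<noteq> 0" by (cases "Y r") auto
    have h: "feval [:- u, w:] (tvar, y) = - to_fract u + y * to_fract w" for y by simp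
    have "nonconst (tvar, Y r)" using tvar_notin_range unfolding nonconst_def fst_conv by blast
    moreover have "feval [:- u, w:] (tvar, Y r) = 0"
      unfolding h using uw by (simp add: Fract_conv_to_fract)
    ultimately have "e dvd [:- u, w:]"
      using irreducible_dvd_vanishing[OF _ e(1) eY[OF r[symmetric]]] by blast
    then have "feval [:- u, w:] (tvar, Y (- r)) = 0"
      by (rule feval_eq_0_dvd) (use eY[of "- r"] r in simp)
    then have "Y (- r) = to_fract u / to_fract w" unfolding h using uw(2) by (simp add: nonzero_eq_divide_eq)
    then have "Y (- r) = Y r" using uw(1) by (simp add: Fract_conv_to_fract)
    then have "r = 0" using q_nonzero by (simp add: Y_def)
    then show False using r n_nonzero[OF nonconst_P f_P] by simp
  qed
  moreover have "\<exists>\<tau> r. \<tau> \<notin> range rat_const \<and> rat_subst \<tau> (n P) = r\<^sup>2"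
  proof -
    define X where "X = fst T"
    define Y where "Y = snd T"
    have TXY: "T = (X, Y)" by (simp add: X_def Y_def)
    \<comment> \<open>A constant first coordinate would make \<open>x\<^sub>1 - c\<close> a factor of the primitive polynomial \<open>g\<close>.\<close>
    have X: "X \<notin> range rat_const"
    proof
      assume "X \<in> range rat_const"
      then obtain c where c: "X = rat_const c" by blast
      then have "Y \<notin> range rat_const" using e(3) by (auto simp: nonconst_def TXY)
      moreover have "poly_at (map_poly (\<lambda>p. poly p c) g) Y = 0"
        using gT by (simp add: TXY c feval_rat_const_fst)
      ultimately have "[:[:- c, 1:]:] dvd g"
        by (simp add: poly_at_eq_0_iff map_poly_eval_eq_0_iff)
      then have "[:- c, 1:] dvd 1" using g(2) by (simp add: content_free_def)
      then show False by (simp add: is_unit_pCons_iff)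
    qed
    interpret \<sigma>: comm_ring_morphism "rat_subst X" by (rule rat_subst_morphism[OF X])
    define p' where "p' = rat_subst X p"
    define q' where "q' = rat_subst X q"
    have eq: "q' * Y\<^sup>2 - 2 * p' * Y - q' = 0" using gT gX[OF X] by (simp add: TXY p'_def q'_def)
    have "q' \<noteq> 0" using q_nonzero rat_subst_eq_0_iff[OF X] by (simp add: q'_def)
    then have "Y \<noteq> 0" using eq by auto
    have n': "rat_subst X (n P) = p'\<^sup>2 + q'\<^sup>2" by (simp add: sqdist_def p'_def q'_def \<sigma>.hom_simps)
    have "2 * p' * Y = q' * (Y\<^sup>2 - 1)" using eq by (simp add: algebra_simps)
    then have "(2 * p' * Y)\<^sup>2 + (2 * q' * Y)\<^sup>2 = (q' * (Y\<^sup>2 - 1))\<^sup>2 + (2 * q' * Y)\<^sup>2" by simp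
    also have "\<dots> = (q' * (Y\<^sup>2 + 1))\<^sup>2" by (simp add: power2_eq_square algebra_simps)
    finally have "(2 * Y)\<^sup>2 * (p'\<^sup>2 + q'\<^sup>2) = (q' * (Y\<^sup>2 + 1))\<^sup>2"
      by (simp add: power2_eq_square algebra_simps)
    then have "p'\<^sup>2 + q'\<^sup>2 = (q' * (Y\<^sup>2 + 1) / (2 * Y))\<^sup>2"
      using \<open>Y \<noteq> 0\<close> unfolding power_divide by (simp add: nonzero_eq_divide_eq mult.commute)
    then show ?thesis using X n' by metis
  qed
  ultimately show ?thesis unfolding splitting_condition_def by blast
qed

text \<open>If \<open>n(P)\<close> becomes \<open>r\<^sup>2\<close> under \<open>\<tau>\<close>, the quadratic formula gives the root \<open>(p(\<tau>) + r)/q(\<tau>)\<close> over \<open>\<tau>\<close>.\<close>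

lemma reparametrizing_curve_rational_if_splitting:
  assumes splitting_condition
  shows "rational_curve (reparametrizing_curve A P)"
proof -
  have nonsq: "\<nexists>r. n P = r\<^sup>2" using assms by (simp add: splitting_condition_def)
  obtain \<tau> r where \<tau>: "\<tau> \<notin> range rat_const" "rat_subst \<tau> (n P) = r\<^sup>2"
    using assms unfolding splitting_condition_def by blast
  obtain g where g: "reparametrizing_curve A P = zero_set g" "irreducible g"
    and gX: "\<And>X Y. X \<notin> range rat_const \<Longrightarrow> feval g (X, Y) = 0 \<longleftrightarrow>
      rat_subst X q * Y\<^sup>2 - 2 * rat_subst X p * Y - rat_subst X q = 0"
    using reparam_polynomial nonsq by metis
  interpret \<sigma>: comm_ring_morphism "rat_subst \<tau>" by (rule rat_subst_morphism[OF \<tau>(1)])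
  define p' where "p' = rat_subst \<tau> p"
  define q' where "q' = rat_subst \<tau> q"
  have "q' \<noteq> 0" using q_nonzero rat_subst_eq_0_iff[OF \<tau>(1)] by (simp add: q'_def)
  define Y where "Y = (p' + r) / q'"
  have qY: "q' * Y = p' + r" using \<open>q' \<noteq> 0\<close> by (simp add: Y_def)
  have r: "r\<^sup>2 = p'\<^sup>2 + q'\<^sup>2" using \<tau>(2) by (simp add: sqdist_def p'_def q'_def \<sigma>.hom_simps)
  have "q' * (q' * Y\<^sup>2 - 2 * p' * Y - q') = (q' * Y)\<^sup>2 - 2 * p' * (q' * Y) - q'\<^sup>2"
    by (simp add: power2_eq_square algebra_simps)
  also have "\<dots> = r\<^sup>2 - (p'\<^sup>2 + q'\<^sup>2)" unfolding qY by (simp add: power2_eq_square algebra_simps)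
  also have "\<dots> = 0" unfolding r by simp
  finally have "feval g (\<tau>, Y) = 0"
    using gX[OF \<tau>(1)] \<open>q' \<noteq> 0\<close> by (simp add: p'_def q'_def)
  moreover have "nonconst (\<tau>, Y)" using \<tau>(1) by (simp add: nonconst_def)
  ultimately have "parametrization (zero_set g) (\<tau>, Y)" using parametrization_zero_setI g(2) by blast
  then show ?thesis unfolding g(1) rational_curve_def parametrization_def by blast
qed


section \<open>From the splitting condition to the conchoid\<close>

text \<open>A constant value would fix the direction of the ray, and \<open>y\<close> would lie on a line through \<open>A\<close>.\<close>

lemma nonconst_ray:
  assumes "nonconst y" "feval f y = 0" "\<mu> \<noteq> 0"
  shows "nonconst (ray A\<^sub>F \<mu> y)"
  unfolding nonconst_def
proof
  assume "fst (ray A\<^sub>F \<mu> y) \<in> range rat_const \<and> snd (ray A\<^sub>F \<mu> y) \<in> range rat_const"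
  then obtain c1 c2 where c: "fst (ray A\<^sub>F \<mu> y) = rat_const c1" "snd (ray A\<^sub>F \<mu> y) = rat_const c2"
    by blast
  define X where "X = fst y - rat_const (fst A)"
  define Y where "Y = snd y - rat_const (snd A)"
  have X: "\<mu> * X = rat_const (c1 - fst A)" using c(1) by (simp add: ray_def X_def rat_const.hom_diff algebra_simps)
  have Y: "\<mu> * Y = rat_const (c2 - snd A)" using c(2) by (simp add: ray_def Y_def rat_const.hom_diff algebra_simps)
  have "\<mu> * (rat_const (c2 - snd A) * X + rat_const (- (c1 - fst A)) * Y) = 0"
    unfolding X[symmetric] Y[symmetric] rat_const.hom_minus by (simp add: algebra_simps)
  then have "rat_const (c2 - snd A) * X + rat_const (- (c1 - fst A)) * Y = 0" using assms(3) by simp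
  then have "(c2 - snd A, - (c1 - fst A)) = (0, 0)"
    using off_lines[OF assms(1,2)] unfolding X_def Y_def by blast
  then have "X = 0" "Y = 0" using X Y assms(3) by (simp_all add: rat_const.hom_simps)
  then show False using assms(1) by (auto simp: X_def Y_def nonconst_def)
qed

lemma conchoid_memI:
  assumes "\<And>h. \<forall>z\<in>conchoid A d C. eval2 h z = 0 \<Longrightarrow> eval2 h x = 0"
  shows "x \<in> conchoid A d C"
proof -
  have "x \<in> zariski_closure S" if "\<And>h. \<forall>z\<in>zariski_closure S. eval2 h z = 0 \<Longrightarrow> eval2 h x = 0" for S
    using that unfolding zariski_closure_def by blast
  then show ?thesis using assms unfolding conchoid_def by blast
qed

text \<open>Moving the conchoid point back by \<open>d\<close> gives \<open>y\<close>, so the norm of \<open>f(A + (1 - d/s)(x - A))\<close>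
  vanishes there. It is not the zero polynomial: otherwise \<open>f\<close> would vanish at a nonconstant
  point of the line through \<open>A\<close> on which the second coordinate is constant.\<close>

lemma conchoid_equation_exists:
  assumes d: "d \<noteq> 0" and y: "feval f y = 0" "\<rho> \<noteq> 0" "\<rho>\<^sup>2 = n y" "\<rho> + rat_const d \<noteq> 0"
  obtains F where "F \<noteq> 0" "feval F (ray A\<^sub>F (1 + rat_const d / \<rho>) y) = 0"
proof -
  obtain F where F: "\<And>x s. s \<noteq> 0 \<Longrightarrow> s\<^sup>2 = n x \<Longrightarrow> feval F x = 0 \<longleftrightarrow>
    feval f (ray A\<^sub>F (1 + rat_const (- d) / s) x) = 0 \<or>
    feval f (ray A\<^sub>F (1 + rat_const (- d) / (- s)) x) = 0"
    using regular_norm[OF regular_ray[of A f "- d"]] by blast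
  have "F \<noteq> 0"
  proof
    assume "F = 0"
    define x where "x = (rat_const (fst A) + tvar, rat_const (snd A))"
    have off: "feval f (ray A\<^sub>F (1 + rat_const c / tvar) x) \<noteq> 0" for c
    proof
      assume 0: "feval f (ray A\<^sub>F (1 + rat_const c / tvar) x) = 0"
      have eq: "ray A\<^sub>F (1 + rat_const c / tvar) x = (rat_const (fst A) + tvar + rat_const c, rat_const (snd A))"
        by (simp add: ray_def x_def algebra_simps)
      have "(tvar :: 'a poly fract) \<in> range rat_const" if mem: "rat_const (fst A) + tvar + rat_const c \<in> range rat_const"
      proof -
        obtain z where "rat_const (fst A) + tvar + rat_const c = rat_const z" using mem by blast
        then have "tvar = rat_const (z - fst A - c)"
          unfolding rat_const.hom_diff by (simp add: algebra_simps flip: \<open>_ = rat_const z\<close>)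
        then show ?thesis by (metis rangeI)
      qed
      then have "nonconst (ray A\<^sub>F (1 + rat_const c / tvar) x)"
        unfolding eq nonconst_def using tvar_notin_range by auto
      from off_lines[OF this 0, of 0 1] show False by (simp add: eq rat_const.hom_zero)
    qed
    have "tvar\<^sup>2 = n x" by (simp add: sqdist_def x_def)
    then show False using F[of tvar x] off[of d] off[of "- d"] \<open>F = 0\<close>
      by (simp add: rat_const.hom_minus)
  qed
  moreover have "feval F (ray A\<^sub>F (1 + rat_const d / \<rho>) y) = 0"
  proof -
    have "ray A\<^sub>F (1 + rat_const (- d) / (\<rho> + rat_const d)) (ray A\<^sub>F (1 + rat_const d / \<rho>) y) = y"
      using ray_shift[OF y(2,4), of "A\<^sub>F" "rat_const (- d)" y] by (simp add: rat_const.hom_minus ray_1)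
    then show ?thesis
      using F[OF y(4) sqdist_ray_shift[OF y(2,3), symmetric]] y(1) by simp
  qed
  ultimately show ?thesis using that by blast
qed

text \<open>The point \<open>Q\<close> over \<open>K(t)\<close> is the image of the point of the double cover that the splitting
  condition provides. Let \<open>e\<close> generate the ideal of \<open>Q\<close>. On the cover \<open>e\<close> has the form \<open>\<alpha> + \<beta> \<rho>\<close> up to a
  power of \<open>n\<close>; as it vanishes at \<open>Q\<close>, the norm \<open>\<alpha>\<^sup>2 - \<beta>\<^sup>2 n\<close> vanishes at \<open>P\<close>, and since \<open>n(P)\<close> is not a square
  this gives \<open>\<alpha> = \<beta> = 0\<close> on \<open>C\<close>. So \<open>e\<close> vanishes on the whole conchoid, which is thus \<open>e = 0\<close>.\<close>

lemma conchoid_rational_if_splitting: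
  assumes d: "d \<noteq> 0" and split: splitting_condition
  shows "rational_curve (conchoid A d C)"
proof -
  have nonsq: "\<nexists>r. n P = r\<^sup>2" using split by (simp add: splitting_condition_def)
  obtain \<tau> \<rho> where \<tau>: "\<tau> \<notin> range rat_const" "rat_subst \<tau> (n P) = \<rho>\<^sup>2"
    using split unfolding splitting_condition_def by blast
  interpret \<sigma>: comm_ring_morphism "rat_subst \<tau>" by (rule rat_subst_morphism[OF \<tau>(1)])
  define y where "y = (rat_subst \<tau> (fst P), rat_subst \<tau> (snd P))"
  have fy: "feval h y = rat_subst \<tau> (feval h P)" for h
    using rat_subst_feval[OF \<tau>(1), of h "fst P" "snd P"] by (simp add: y_def)
  have y: "feval f y = 0" by (simp add: fy f_P \<sigma>.hom_zero)
  have ncy: "nonconst y"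
    using nonconst_P rat_subst_notin_range[OF \<tau>(1)] unfolding nonconst_def y_def by auto
  have ny: "\<rho>\<^sup>2 = n y" using \<tau>(2) rat_subst_n[OF \<tau>(1), of P] by (simp add: y_def)
  have "\<rho> \<noteq> 0" using n_nonzero[OF ncy y] ny by auto
  have \<rho>d: "\<rho> + rat_const d \<noteq> 0"
  proof
    assume "\<rho> + rat_const d = 0"
    then have "\<rho> = rat_const (- d)" by (simp add: rat_const.hom_minus eq_neg_iff_add_eq_0)
    then have "rat_subst \<tau> (n P) = rat_subst \<tau> ((rat_const (- d))\<^sup>2)"
      unfolding \<tau>(2) \<sigma>.hom_power rat_subst_rat_const[OF \<tau>(1)] by simp
    then show False using nonsq rat_subst_inject[OF \<tau>(1)] by blast
  qed
  define Q where "Q = ray A\<^sub>F (1 + rat_const d / \<rho>) y"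
  have "1 + rat_const d / \<rho> \<noteq> 0" using \<rho>d \<open>\<rho> \<noteq> 0\<close> by (simp add: field_simps)
  then have Q: "nonconst Q" unfolding Q_def by (rule nonconst_ray[OF ncy y])
  obtain F where "F \<noteq> 0" "feval F Q = 0"
    unfolding Q_def using conchoid_equation_exists[OF d y \<open>\<rho> \<noteq> 0\<close> ny \<rho>d] .
  then obtain e where e: "irreducible e" "feval e Q = 0" "\<And>h. feval h Q = 0 \<Longrightarrow> e dvd h"
    using vanishing_ideal_principal[OF Q] by blast
  have "\<forall>x\<in>conchoid A d C. eval2 e x = 0"
  proof -
    obtain \<alpha> \<beta> k where
      F: "\<And>y s. s \<noteq> 0 \<Longrightarrow> s\<^sup>2 = n y \<Longrightarrow>
         n y ^ k * feval e (ray A\<^sub>F (1 + rat_const d / s) y) = feval \<alpha> y + feval \<beta> y * s"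
      and K: "\<And>y s. s \<noteq> 0 \<Longrightarrow> s\<^sup>2 = sqdist A y \<Longrightarrow>
         sqdist A y ^ k * eval2 e (ray A (1 + d / s) y) = eval2 \<alpha> y + eval2 \<beta> y * s"
      by (rule ray_expansion[where A = A and f = e and \<delta> = d]) (rule that)
    have "feval \<alpha> y + feval \<beta> y * \<rho> = 0"
      using F[OF \<open>\<rho> \<noteq> 0\<close> ny] e(2) by (simp add: Q_def)
    then have "feval \<alpha> y = - (feval \<beta> y * \<rho>)" by (simp add: eq_neg_iff_add_eq_0)
    then have "(feval \<alpha> y)\<^sup>2 = (feval \<beta> y)\<^sup>2 * \<rho>\<^sup>2" by (simp add: power_mult_distrib)
    then have "rat_subst \<tau> ((feval \<alpha> P)\<^sup>2) = rat_subst \<tau> ((feval \<beta> P)\<^sup>2 * n P)"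
      by (simp add: fy \<sigma>.hom_simps \<tau>(2))
    then have sq: "(feval \<alpha> P)\<^sup>2 = (feval \<beta> P)\<^sup>2 * n P" unfolding rat_subst_inject[OF \<tau>(1)] .
    have "feval \<beta> P = 0"
    proof (rule ccontr)
      assume nz: "feval \<beta> P \<noteq> 0"
      then have "n P = (feval \<alpha> P / feval \<beta> P)\<^sup>2" using sq by (simp add: power_divide)
      then show False using nonsq by blast
    qed
    moreover from this have "feval \<alpha> P = 0" using sq by simp
    ultimately have ab: "\<forall>x\<in>C. eval2 \<alpha> x = 0" "\<forall>x\<in>C. eval2 \<beta> x = 0"
      unfolding vanishes_iff by blast+
    show ?thesis unfolding vanishes_on_conchoid_iff[OF d]
    proof (intro allI impI)
      fix y \<rho> assume *: "y \<in> C" "\<rho> \<noteq> 0" "\<rho>\<^sup>2 = sqdist A y"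
      then have "sqdist A y ^ k * eval2 e (ray A (1 + d / \<rho>) y) = 0"
        using K[OF *(2,3)] ab by simp
      moreover have "sqdist A y \<noteq> 0" using *(2) by (simp flip: *(3))
      ultimately show "eval2 e (ray A (1 + d / \<rho>) y) = 0" by simp
    qed
  qed
  moreover have "x \<in> conchoid A d C" if x: "eval2 e x = 0" for x
  proof (rule conchoid_memI)
    fix h assume "\<forall>z\<in>conchoid A d C. eval2 h z = 0"
    then have "feval h Q = 0" unfolding Q_def
      using vanishes_on_conchoid_point[OF d _ y \<open>\<rho> \<noteq> 0\<close> ny] by blast
    then have "e dvd h" by (rule e(3))
    then show "eval2 h x = 0" using eval2_eq_0_dvd x by blast
  qed
  ultimately have "conchoid A d C = zero_set e" unfolding zero_set_def by blast
  then show ?thesis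
    using parametrization_zero_setI[OF e(1) Q e(2)] unfolding rational_curve_def parametrization_def by metis
qed

end


section \<open>From the conchoid to the splitting condition\<close>

lemma feval_affine_poly:
  fixes f :: "'a::field poly poly"
  obtains W where "\<And>Z. poly W Z = feval f (a + Z * b, c + Z * e)"
proof -
  have 1: "\<exists>W. \<forall>Z. poly W Z = poly_at p (a + Z * b)" for p :: "'a poly"
  proof (induction p)
    case 0
    then show ?case by (intro exI[of _ 0]) simp
  next
    case (pCons k p)
    then obtain W where "\<And>Z. poly W Z = poly_at p (a + Z * b)" by blast
    then show ?case by (intro exI[of _ "[:rat_const k:] + [:a, b:] * W"]) (simp add: algebra_simps)
  qed
  have "\<exists>W. \<forall>Z. poly W Z = feval f (a + Z * b, c + Z * e)"
  proof (induction f)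
    case 0
    then show ?case by (intro exI[of _ 0]) simp
  next
    case (pCons k f)
    then obtain W where W: "\<And>Z. poly W Z = feval f (a + Z * b, c + Z * e)" by blast
    obtain V where V: "\<And>Z. poly V Z = poly_at k (a + Z * b)" using 1 by blast
    show ?case by (intro exI[of _ "V + [:c, e:] * W"]) (simp add: W V algebra_simps)
  qed
  then show ?thesis using that by blast
qed

lemma feval_vertical_line: "feval [:[:- c, 1:]:] R = fst R - rat_const c"
  unfolding feval_pCons poly_at_pCons rat_const.hom_minus rat_const.hom_one by simp

context focal_curve
begin

lemma line_poly_ray: "eval2 (line_poly A u v) (ray A \<mu> y) = \<mu> * eval2 (line_poly A u v) y"
  by (simp add: eval2_line_poly ray_def algebra_simps)

lemma feval_line_poly_ray:
  "feval (line_poly A u v) (ray A\<^sub>F \<mu> y) = \<mu> * feval (line_poly A u v) y"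
  by (simp add: feval_line_poly ray_def algebra_simps)

text \<open>If \<open>f\<close> vanishes at infinitely many points of a line through \<open>A\<close>, it vanishes at the generic point
  \<open>A + t(y - A)\<close>, and \<open>C\<close> is that line.\<close>

lemma no_infinite_subset_of_ray:
  assumes y: "y \<noteq> A" and inf: "infinite Z" and Z: "\<And>z. z \<in> Z \<Longrightarrow> eval2 f (ray A z y) = 0"
  shows False
proof -
  define R where "R = ray A\<^sub>F tvar (const_point y)"
  have val: "pair_value R z (ray A z y)" for z
  proof -
    have "rat_value (rat_const c + tvar * rat_const k) z (c + z * k)" for c k
      by (intro rat_value_add rat_value_mult rat_value_rat_const rat_value_tvar)
    from this[of "fst A" "fst y - fst A"] this[of "snd A" "snd y - snd A"] show ?thesis
      by (simp add: pair_value_def R_def ray_def rat_const.hom_diff)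
  qed
  have fR: "feval f R = 0"
  proof (rule ccontr)
    assume "feval f R \<noteq> 0"
    then have "finite {t. rat_value (feval f R) t 0}" by (rule rat_zeros_finite)
    moreover have "Z \<subseteq> {t. rat_value (feval f R) t 0}"
    proof
      fix z assume "z \<in> Z"
      then show "z \<in> {t. rat_value (feval f R) t 0}" using rat_value_feval[OF val, of f z] Z by simp
    qed
    ultimately show False using inf finite_subset by blast
  qed
  define u where "u = fst y - fst A"
  define v where "v = snd y - snd A"
  have R: "fst R = rat_const (fst A) + tvar * rat_const u" "snd R = rat_const (snd A) + tvar * rat_const v"
    by (simp_all add: R_def ray_def u_def v_def rat_const.hom_diff)
  have uv: "(v, - u) \<noteq> (0, 0)" using y by (auto simp: u_def v_def prod_eq_iff)
  have t: "k = 0" if "rat_const c + tvar * rat_const k \<in> range rat_const" for c k :: 'a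
  proof (rule ccontr)
    assume k: "k \<noteq> 0"
    obtain z where "rat_const c + tvar * rat_const k = rat_const z"
      using \<open>_ \<in> range rat_const\<close> by blast
    then have "tvar * rat_const k = rat_const (z - c)" by (simp add: rat_const.hom_diff algebra_simps)
    then have "tvar = rat_const ((z - c) / k)" using k by (simp add: rat_const_divide nonzero_eq_divide_eq)
    then show False using tvar_notin_range by (metis rangeI)
  qed
  have "nonconst R" unfolding nonconst_def R
  proof
    assume mem: "rat_const (fst A) + tvar * rat_const u \<in> range rat_const \<and>
      rat_const (snd A) + tvar * rat_const v \<in> range rat_const"
    show False using t[OF conjunct1[OF mem]] t[OF conjunct2[OF mem]] uv by simp
  qed
  from off_lines[OF this fR uv] show False unfolding R by (simp add: rat_const.hom_minus algebra_simps)
qed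

text \<open>Iterating the shift by \<open>2d\<close> produces infinitely many points of \<open>C\<close> on one ray.\<close>

lemma not_invariant_under_shift:
  assumes d: "d \<noteq> 0"
    and step: "\<And>y \<rho>. y \<in> C \<Longrightarrow> \<rho> \<noteq> 0 \<Longrightarrow> \<rho>\<^sup>2 = sqdist A y \<Longrightarrow> \<rho> + d \<noteq> 0 \<Longrightarrow>
      ray A (1 + 2 * d / \<rho>) y \<in> C"
  shows False
proof -
  obtain y \<rho>\<^sub>0 where y: "y \<in> C" "\<rho>\<^sub>0 \<noteq> 0" "\<rho>\<^sub>0\<^sup>2 = sqdist A y" using exists_point_off_focus .
  \<comment> \<open>The iteration breaks off if it meets the focus or the circle where \<open>\<rho> + d = 0\<close>. This can happen
      for one sign of the root only, because \<open>(i + j) d = 0\<close> implies \<open>i = j = 0\<close>.\<close>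
  obtain \<rho> where \<rho>: "\<rho>\<^sup>2 = sqdist A y" "\<And>j. \<rho> + of_nat j * d \<noteq> 0"
  proof (cases "\<exists>i. \<rho>\<^sub>0 + of_nat i * d = 0")
    case False
    then show ?thesis using that y by blast
  next
    case True
    then obtain i where i: "\<rho>\<^sub>0 + of_nat i * d = 0" by blast
    have "- \<rho>\<^sub>0 + of_nat j * d \<noteq> 0" for j
    proof
      assume "- \<rho>\<^sub>0 + of_nat j * d = 0"
      then have "of_nat (i + j) * d = 0" using i by (simp add: algebra_simps)
      then have "i + j = 0" using d by (metis mult_eq_0_iff of_nat_eq_0_iff)
      then show False using i y(2) by simp
    qed
    then show ?thesis using that[of "- \<rho>\<^sub>0"] y by simp
  qed
  have \<rho>0: "\<rho> \<noteq> 0" using \<rho>(2)[of 0] by simp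
  have *: "ray A (1 + of_nat (2 * j) * d / \<rho>) y \<in> C" for j
  proof (induction j)
    case 0
    then show ?case using y(1) by (simp add: ray_1)
  next
    case (Suc j)
    define \<delta> where "\<delta> = of_nat (2 * j) * d"
    have nz: "\<rho> + \<delta> \<noteq> 0" using \<rho>(2)[of "2 * j"] by (simp add: \<delta>_def)
    have "\<rho> + \<delta> + d \<noteq> 0" using \<rho>(2)[of "2 * j + 1"] by (simp add: \<delta>_def algebra_simps)
    then have "ray A (1 + 2 * d / (\<rho> + \<delta>)) (ray A (1 + \<delta> / \<rho>) y) \<in> C"
      using Suc nz sqdist_ray_shift[OF \<rho>0 \<rho>(1), of \<delta>] by (intro step) (simp_all add: \<delta>_def)
    then have "ray A (1 + (\<delta> + 2 * d) / \<rho>) y \<in> C" unfolding ray_shift[OF \<rho>0 nz] .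
    moreover have "\<delta> + 2 * d = of_nat (2 * Suc j) * d" by (simp add: \<delta>_def algebra_simps)
    ultimately show ?case by simp
  qed
  have "inj (\<lambda>j. 1 + of_nat (2 * j) * d / \<rho>)"
    by (rule injI) (use d \<rho>0 in simp)
  then have "infinite (range (\<lambda>j. 1 + of_nat (2 * j) * d / \<rho>))" by (rule range_inj_infinite)
  moreover have "y \<noteq> A" using \<rho>0 \<rho>(1) by (auto simp: sqdist_def)
  moreover have "eval2 f (ray A z y) = 0" if "z \<in> range (\<lambda>j. 1 + of_nat (2 * j) * d / \<rho>)" for z
  proof -
    obtain j where "z = 1 + of_nat (2 * j) * d / \<rho>" using \<open>z \<in> range _\<close> by (elim rangeE)
    then show ?thesis using *[of j] curve_eq by (simp add: zero_set_def)
  qed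
  ultimately show False by (intro no_infinite_subset_of_ray[of y])
qed

text \<open>Moving the generic point \<open>Q\<close> of the conchoid back by \<open>d\<close> leads to a generic point of \<open>C\<close>. The
  norm of \<open>f(A + (1 - d/s)(x - A))\<close> vanishes on the conchoid, so \<open>\<alpha>(Q)\<^sup>2 = \<beta>(Q)\<^sup>2 n(Q)\<close> and
  \<open>v = - \<alpha>(Q)/\<beta>(Q)\<close> is the required square root, provided that \<open>\<beta>(Q) \<noteq> 0\<close>.\<close>

lemma rational_conchoid_point:
  assumes d: "d \<noteq> 0" and Q: "parametrization (conchoid A d C) Q"
  obtains v where "v\<^sup>2 = n Q" "v \<noteq> 0" "v - rat_const d \<noteq> 0"
    "feval f (ray A\<^sub>F (1 + rat_const (- d) / v) Q) = 0"
    "nonconst (ray A\<^sub>F (1 + rat_const (- d) / v) Q)"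
proof -
  note van = vanishes_on_curve_iff[OF Q]
  have vanI: "feval h Q = 0" if "\<And>y \<rho>. y \<in> C \<Longrightarrow> \<rho> \<noteq> 0 \<Longrightarrow> \<rho>\<^sup>2 = sqdist A y \<Longrightarrow>
      eval2 h (ray A (1 + d / \<rho>) y) = 0" for h
    using that unfolding van[symmetric] vanishes_on_conchoid_iff[OF d] by blast
  have vanD: "eval2 h (ray A (1 + d / \<rho>) y) = 0"
    if "feval h Q = 0" "y \<in> C" "\<rho> \<noteq> 0" "\<rho>\<^sup>2 = sqdist A y" for h y \<rho>
    using that unfolding van[symmetric] vanishes_on_conchoid_iff[OF d] by blast
  \<comment> \<open>Each point of \<open>C\<close> off \<open>n = 0\<close> yields two conchoid points, at signed distances \<open>\<rho> + d\<close> and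
      \<open>- \<rho> + d\<close> from \<open>A\<close>; their squares differ, so \<open>n\<close> is not constant on the conchoid.\<close>
  have norm_const: "n Q \<noteq> rat_const c" for c
  proof
    assume "n Q = rat_const c"
    then have "feval (sqdist_poly A - [:[:c:]:]) Q = 0" by (simp add: feval.hom_diff)
    note * = vanD[OF this]
    obtain y \<rho> where y: "y \<in> C" "\<rho> \<noteq> 0" "\<rho>\<^sup>2 = sqdist A y" using exists_point_off_focus .
    have 1: "(s + d)\<^sup>2 = c" if "s \<noteq> 0" "s\<^sup>2 = sqdist A y" for s
      using *[OF y(1) that] sqdist_ray_shift[OF that, of d] by (simp add: eval2.hom_diff)
    have "(\<rho> + d)\<^sup>2 = c" "(- \<rho> + d)\<^sup>2 = c" using 1[of \<rho>] 1[of "- \<rho>"] y by auto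
    moreover have "4 * (\<rho> * d) = (\<rho> + d)\<^sup>2 - (- \<rho> + d)\<^sup>2" by (simp add: power2_eq_square algebra_simps)
    ultimately have "4 * (\<rho> * d) = 0" by simp
    then show False using y d by simp
  qed
  obtain \<alpha> \<beta> k where
    F: "\<And>y s. s \<noteq> 0 \<Longrightarrow> s\<^sup>2 = n y \<Longrightarrow>
       n y ^ k * feval f (ray A\<^sub>F (1 + rat_const (- d) / s) y) = feval \<alpha> y + feval \<beta> y * s"
    and K: "\<And>y s. s \<noteq> 0 \<Longrightarrow> s\<^sup>2 = sqdist A y \<Longrightarrow>
       sqdist A y ^ k * eval2 f (ray A (1 + - d / s) y) = eval2 \<alpha> y + eval2 \<beta> y * s"
    by (rule ray_expansion[where A = A and f = f and \<delta> = "- d"]) (rule that)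
  \<comment> \<open>The extra factor \<open>n\<close> takes care of the focus, where the expansion says nothing.\<close>
  have "feval (sqdist_poly A * (\<alpha>\<^sup>2 - \<beta>\<^sup>2 * sqdist_poly A)) Q = 0"
  proof (rule vanI)
    fix y \<rho> assume y: "y \<in> C" "\<rho> \<noteq> 0" "\<rho>\<^sup>2 = sqdist A y"
    define x where "x = ray A (1 + d / \<rho>) y"
    have x: "(\<rho> + d)\<^sup>2 = sqdist A x" unfolding x_def by (rule sqdist_ray_shift[OF y(2,3), symmetric])
    have "eval2 (sqdist_poly A * (\<alpha>\<^sup>2 - \<beta>\<^sup>2 * sqdist_poly A)) x = 0"
    proof (cases "\<rho> + d = 0")
      case True
      then have "sqdist A x = 0" using x by simp
      then show ?thesis by (simp add: eval2.hom_mult)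
    next
      case False
      have "ray A (1 + - d / (\<rho> + d)) x = y"
        unfolding x_def ray_shift[OF y(2) False] by (simp add: ray_1)
      then have "eval2 \<alpha> x + eval2 \<beta> x * (\<rho> + d) = 0"
        using K[OF False x] y(1) curve_eq by (simp add: zero_set_def)
      then have "eval2 \<alpha> x = - (eval2 \<beta> x * (\<rho> + d))" by (simp add: eq_neg_iff_add_eq_0)
      then have "(eval2 \<alpha> x)\<^sup>2 = (eval2 \<beta> x)\<^sup>2 * sqdist A x"
        by (simp add: power_mult_distrib flip: x)
      then show ?thesis by (simp add: eval2.hom_simps)
    qed
    then show "eval2 (sqdist_poly A * (\<alpha>\<^sup>2 - \<beta>\<^sup>2 * sqdist_poly A)) (ray A (1 + d / \<rho>) y) = 0"
      by (simp add: x_def)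
  qed
  then have sq: "(feval \<alpha> Q)\<^sup>2 = (feval \<beta> Q)\<^sup>2 * n Q"
    using norm_const[of 0] by (simp add: feval.hom_simps rat_const.hom_zero)
  \<comment> \<open>Otherwise \<open>\<alpha>\<close> and \<open>\<beta>\<close> vanish on the conchoid, and moving a conchoid point by \<open>d\<close> in either direction
      leads to \<open>C\<close>. One direction undoes the original shift; the other completes a shift of \<open>C\<close> by \<open>2d\<close>.\<close>
  have \<beta>: "feval \<beta> Q \<noteq> 0"
  proof
    assume \<beta>0: "feval \<beta> Q = 0"
    then have \<alpha>0: "feval \<alpha> Q = 0" using sq by simp
    show False
    proof (rule not_invariant_under_shift[OF d])
      fix y \<rho> assume y: "y \<in> C" "\<rho> \<noteq> 0" "\<rho>\<^sup>2 = sqdist A y" and nz: "\<rho> + d \<noteq> 0"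
      define x where "x = ray A (1 + d / \<rho>) y"
      have x: "(\<rho> + d)\<^sup>2 = sqdist A x" unfolding x_def by (rule sqdist_ray_shift[OF y(2,3), symmetric])
      have "eval2 \<alpha> x = 0" "eval2 \<beta> x = 0" unfolding x_def by (rule vanD[OF \<alpha>0 y], rule vanD[OF \<beta>0 y])
      moreover obtain s where s: "s = - (\<rho> + d)" by blast
      have "s \<noteq> 0" "s\<^sup>2 = sqdist A x" unfolding s power2_minus neg_equal_0_iff_equal by (fact nz x)+
      note K[OF this]
      ultimately have "sqdist A x ^ k * eval2 f (ray A (1 + - d / s) x) = 0" by (simp only: mult_zero_left add_0_left)
      moreover have "sqdist A x \<noteq> 0" unfolding x[symmetric] using nz by simp
      ultimately have "eval2 f (ray A (1 + - d / s) x) = 0" unfolding mult_eq_0_iff power_eq_0_iff by blast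
      moreover have "- d / s = d / (\<rho> + d)" unfolding s by (rule minus_divide_divide)
      ultimately have "eval2 f (ray A (1 + d / (\<rho> + d)) x) = 0" by metis
      then show "ray A (1 + 2 * d / \<rho>) y \<in> C"
        unfolding x_def ray_shift[OF y(2) nz] curve_eq zero_set_def mult_2 by (rule CollectI)
    qed
  qed
  define v where "v = - (feval \<alpha> Q / feval \<beta> Q)"
  have v2: "v\<^sup>2 = n Q" using sq \<beta> by (simp add: v_def power_divide)
  have v0: "v \<noteq> 0" using v2 norm_const[of 0] by (auto simp: rat_const.hom_zero)
  have vd: "v - rat_const d \<noteq> 0" using v2 norm_const[of "d\<^sup>2"] by (auto simp: rat_const.hom_power)
  define y where "y = ray A\<^sub>F (1 + rat_const (- d) / v) Q"
  have "feval \<alpha> Q + feval \<beta> Q * v = 0" using \<beta> by (simp add: v_def)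
  then have "n Q ^ k * feval f y = 0" unfolding y_def F[OF v0 v2] .
  moreover have "n Q \<noteq> 0" using norm_const[of 0] by (simp add: rat_const.hom_zero)
  ultimately have fy: "feval f y = 0" by simp
  have ny: "n y = (v - rat_const d)\<^sup>2"
    using sqdist_ray_shift[OF v0 v2, of "rat_const (- d)"] by (simp add: y_def rat_const.hom_minus)
  \<comment> \<open>A constant \<open>y\<close> puts \<open>Q\<close>, hence the conchoid, hence \<open>C\<close> itself, on the line through \<open>A\<close> and \<open>y\<close>.\<close>
  have "nonconst y"
  proof (rule ccontr)
    assume "\<not> nonconst y"
    then obtain c where c: "y = const_point c" by (auto simp: nonconst_def prod_eq_iff)
    define u where "u = snd c - snd A"
    define w where "w = - (fst c - fst A)"
    have "c \<noteq> A" using ny vd unfolding c sqdist_const_point by (auto simp: sqdist_def rat_const.hom_zero)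
    then have uw: "(u, w) \<noteq> (0, 0)" by (auto simp: u_def w_def prod_eq_iff)
    have "feval (line_poly A u w) y = 0"
      unfolding c feval_const_point eval2_line_poly by (simp add: u_def w_def rat_const.hom_zero algebra_simps)
    then have "(1 + rat_const (- d) / v) * feval (line_poly A u w) Q = 0"
      unfolding y_def feval_line_poly_ray .
    moreover have "1 + rat_const (- d) / v \<noteq> 0"
      using vd v0 by (simp add: rat_const.hom_minus field_simps)
    ultimately have "feval (line_poly A u w) Q = 0" by simp
    note * = vanD[OF this]
    have "eval2 (sqdist_poly A * line_poly A u w) z = 0" if z: "z \<in> C" for z
    proof (cases "sqdist A z = 0")
      case False
      obtain s where s: "s\<^sup>2 = sqdist A z" using nth_root_exists[of 2 "sqdist A z"] by auto
      then have "s \<noteq> 0" using False by auto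
      \<comment> \<open>The root with \<open>\<rho> + d = 0\<close> would only give the focus.\<close>
      obtain \<rho> where \<rho>: "\<rho> \<noteq> 0" "\<rho>\<^sup>2 = sqdist A z" "\<rho> + d \<noteq> 0"
      proof (cases "s + d = 0")
        case True
        have "- s + d \<noteq> 0"
        proof
          assume "- s + d = 0"
          then have "s = d" by simp
          then have "2 * d = 0" using True by (simp only: mult_2)
          then show False using d by simp
        qed
        then show ?thesis using that[of "- s"] s \<open>s \<noteq> 0\<close> by simp
      qed (use that s \<open>s \<noteq> 0\<close> in blast)
      have "(1 + d / \<rho>) * eval2 (line_poly A u w) z = 0"
        using *[OF z \<rho>(1,2)] unfolding line_poly_ray .
      moreover have "1 + d / \<rho> \<noteq> 0" using \<rho> by (simp add: field_simps)
      ultimately show ?thesis by (simp add: eval2.hom_mult)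
    qed (simp add: eval2.hom_mult)
    then have "feval (sqdist_poly A * line_poly A u w) P = 0" using vanishes_iff by blast
    then show False
      using line_poly_P[OF uw] n_nonzero[OF nonconst_P f_P] by (simp add: feval.hom_mult)
  qed
  then show ?thesis using that v2 v0 vd fy unfolding y_def by blast
qed

text \<open>The polynomial \<open>f(A + Z(P - A))\<close> in \<open>Z\<close> over \<open>K(t)\<close> has infinitely many roots, so \<open>f\<close> vanishes on
  the whole line through \<open>A\<close> and \<open>P\<close>. Its points with first coordinate \<open>a + 1\<close> and \<open>a + 2\<close> are
  nonconstant points of \<open>C\<close>, so \<open>C\<close> would be contained in two parallel lines.\<close>

lemma not_all_shifts_of_P_on_curve:
  assumes d: "d \<noteq> 0" and r: "r \<noteq> 0" and
    *: "\<And>j. feval f (ray A\<^sub>F (1 + rat_const (- (of_nat j * d)) / r) P) = 0"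
  shows False
proof -
  obtain W where W: "\<And>Z. poly W Z = feval f (rat_const (fst A) + Z * p, rat_const (snd A) + Z * q)"
    using feval_affine_poly by blast
  have W': "poly W Z = feval f (ray A\<^sub>F Z P)" for Z by (simp add: W ray_def)
  have "inj (\<lambda>j. 1 + rat_const (- (of_nat j * d)) / r)"
    by (rule injI) (use d r in simp)
  then have "infinite (range (\<lambda>j. 1 + rat_const (- (of_nat j * d)) / r))" by (rule range_inj_infinite)
  moreover have "range (\<lambda>j. 1 + rat_const (- (of_nat j * d)) / r) \<subseteq> {Z. poly W Z = 0}"
    using * by (auto simp: W')
  ultimately have "W = 0" using poly_roots_finite finite_subset by blast
  have fst_P: "fst P = rat_const (fst A + z)" if z: "z \<noteq> 0" for z
  proof -
    define y where "y = ray A\<^sub>F (rat_const z / p) P"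
    have y: "fst y = rat_const (fst A + z)" "snd y = rat_const (snd A) + rat_const z * (q / p)"
      using p_nonzero by (simp_all add: y_def ray_def rat_const.hom_add)
    have fy: "feval f y = 0" using \<open>W = 0\<close> W' unfolding y_def by (metis poly_0)
    have "snd y \<notin> range rat_const"
    proof
      assume "snd y \<in> range rat_const"
      then obtain c where "rat_const (snd A) + rat_const z * (q / p) = rat_const c" unfolding y by blast
      then have "rat_const z * (q / p) = rat_const (c - snd A)"
        by (simp add: rat_const.hom_diff algebra_simps)
      then have "rat_const z * q = rat_const (c - snd A) * p"
        using p_nonzero by (simp add: nonzero_divide_eq_eq)
      then have "rat_const (- (c - snd A)) * p + rat_const z * q = 0"
        unfolding rat_const.hom_minus by simp
      then show False using off_lines[OF nonconst_P f_P, of "- (c - snd A)" z] z by simp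
    qed
    then have "nonconst y" by (simp add: nonconst_def)
    moreover have "feval [:[:- (fst A + z), 1:]:] y = 0"
      unfolding feval_vertical_line y(1) by simp
    ultimately have "feval [:[:- (fst A + z), 1:]:] P = 0" using vanishes_at_P fy by blast
    then show ?thesis unfolding feval_vertical_line by simp
  qed
  have "rat_const (fst A + 1) = rat_const (fst A + 2)" using fst_P[of 1] fst_P[of 2] by simp
  then show False by simp
qed

text \<open>By properness \<open>t\<close>, and hence every element of \<open>K(t)\<close>, is the value at \<open>P\<close> of a quotient of polynomials.\<close>

lemma rational_function_on_curve:
  assumes "proper_parametrization C P"
  obtains k1 k2 where "feval k2 P \<noteq> 0" "feval k1 P = r * feval k2 P"
proof -
  obtain g h where g: "feval h P \<noteq> 0" "feval g P = tvar * feval h P"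
    using proper_parametrization_inverse[OF assms] .
  obtain r1 r2 where r: "r = Fract r1 r2" "r2 \<noteq> 0" by (cases r) auto
  define k where "k = max (degree r1) (degree r2)"
  have gh: "feval g P / feval h P = tvar" using g by simp
  obtain G1 where G1: "feval G1 P = feval h P ^ k * to_fract r1"
    using homogenization[of r1 k h g] g(1) gh poly_at_tvar unfolding k_def by (metis max.cobounded1)
  obtain G2 where G2: "feval G2 P = feval h P ^ k * to_fract r2"
    using homogenization[of r2 k h g] g(1) gh poly_at_tvar unfolding k_def by (metis max.cobounded2)
  have "feval G2 P \<noteq> 0" unfolding G2 using g(1) r(2) by simp
  moreover have "feval G1 P = r * feval G2 P" unfolding G1 G2 using r by (simp add: Fract_conv_to_fract)
  ultimately show ?thesis using that by blast
qed

text \<open>Here \<open>n(P) = r\<^sup>2\<close> and the sign of \<open>r\<close> is chosen so that \<open>Q\<close> is the shift of \<open>P\<close> by \<open>d\<close> along \<open>(P - A)/r\<close>,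
  after the substitution \<open>\<tau>\<close>. Write \<open>r = k\<^sub>1/k\<^sub>2\<close> as a rational function on \<open>C\<close>. The
  equations \<open>f(y) = 0\<close> and \<open>k\<^sub>1(y) = (s - d) k\<^sub>2(y)\<close> for \<open>y = A + (1 - d/s)(x - A)\<close> hold at \<open>x = Q\<close>, \<open>s = v\<close>; taking
  norms, they hold at every point of the irreducible conchoid for one of the two roots \<open>s\<close>. The
  shift of \<open>P\<close> by \<open>- d\<close> is such a point. One root leads back to \<open>P\<close> itself and contradicts
  \<open>k\<^sub>1(P) = r k\<^sub>2(P)\<close>; so the other one shows that the shift of \<open>P\<close> by \<open>- 2d\<close> is a point of
  \<open>C\<close> at which \<open>k\<^sub>1/k\<^sub>2\<close> has the value \<open>r - 2d\<close>. By properness it is \<open>P(\<tau>')\<close> with \<open>r(\<tau>') = r - 2d\<close>, and iterating the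
  substitution \<open>\<tau>'\<close> yields all shifts by multiples of \<open>- 2d\<close>.\<close>

lemma rational_conchoid_imp_norm_not_square:
  assumes d: "d \<noteq> 0" and proper: "proper_parametrization C P"
    and Q: "parametrization (conchoid A d C) Q"
    and v: "v\<^sup>2 = n Q" "v \<noteq> 0"
    and \<tau>: "\<tau> \<notin> range rat_const"
      "ray A\<^sub>F (1 + rat_const (- d) / v) Q = (rat_subst \<tau> (fst P), rat_subst \<tau> (snd P))"
    and r: "r\<^sup>2 = n P" "rat_subst \<tau> r = v - rat_const d"
    and circle: "n P \<noteq> rat_const (d\<^sup>2)"
  shows False
proof -
  let ?d = "rat_const d"
  obtain k1 k2 where k: "feval k2 P \<noteq> 0" "feval k1 P = r * feval k2 P"
    using rational_function_on_curve[OF proper] .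
  have r0: "r \<noteq> 0" using r(1) n_nonzero[OF nonconst_P f_P] by auto
  have rd: "- r + ?d \<noteq> 0"
  proof
    assume "- r + ?d = 0"
    then have "r = ?d" by simp
    then show False using circle r(1) by (simp add: rat_const.hom_power)
  qed
  \<comment> \<open>A linear combination of the two equations. Several values of \<open>l\<close> ensure that both equations
      hold for the same root.\<close>
  define \<phi> where "\<phi> l x s = feval f (ray A\<^sub>F (1 + rat_const (- d) / s) x) + rat_const l *
    (feval k1 (ray A\<^sub>F (1 + rat_const (- d) / s) x) -
      (s - ?d) * feval k2 (ray A\<^sub>F (1 + rat_const (- d) / s) x))" for l x s
  have reg: "regular A (\<phi> l)" for l
    unfolding \<phi>_def
    by (intro regular_add regular_mult regular_diff regular_const regular_dist regular_ray)
  have \<phi>Q: "\<phi> l Q v = 0" for l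
  proof -
    interpret \<sigma>: comm_ring_morphism "rat_subst \<tau>" by (rule rat_subst_morphism[OF \<tau>(1)])
    have fy: "feval h (rat_subst \<tau> (fst P), rat_subst \<tau> (snd P)) = rat_subst \<tau> (feval h P)" for h
      using rat_subst_feval[OF \<tau>(1), of h "fst P" "snd P"] by simp
    show ?thesis unfolding \<phi>_def \<tau>(2) fy by (simp add: f_P k(2) \<sigma>.hom_simps r(2))
  qed
  define x where "x = ray A\<^sub>F (1 + ?d / (- r)) P"
  have nx: "n x = (- r + ?d)\<^sup>2"
    unfolding x_def by (rule sqdist_ray_shift) (use r r0 in simp_all)
  have disj: "\<phi> l x (- r + ?d) = 0 \<or> \<phi> l x (- (- r + ?d)) = 0" for l
  proof -
    obtain F where F: "\<And>x s. s \<noteq> 0 \<Longrightarrow> s\<^sup>2 = n x \<Longrightarrow> feval F x = 0 \<longleftrightarrow> \<phi> l x s = 0 \<or> \<phi> l x (- s) = 0"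
      using regular_norm[OF reg] by blast
    have "feval F Q = 0" using F[OF v(2,1)] \<phi>Q by blast
    then have "\<forall>x\<in>conchoid A d C. eval2 F x = 0" using vanishes_on_curve_iff[OF Q] by blast
    then have "feval F x = 0"
      unfolding x_def by (rule vanishes_on_conchoid_point[OF d _ f_P]) (use r r0 in simp_all)
    then show ?thesis using F[OF rd nx[symmetric]] by blast
  qed
  have x1: "ray A\<^sub>F (1 + rat_const (- d) / (- r + ?d)) x = P"
    unfolding x_def using ray_shift[OF _ rd, of "A\<^sub>F" "rat_const (- d)" P] r0
    by (simp add: rat_const.hom_minus ray_1)
  have nz: "\<phi> l x (- r + ?d) \<noteq> 0" if l: "l \<noteq> 0" for l
  proof -
    have "\<phi> l x (- r + ?d) = rat_const l * (2 * r * feval k2 P)"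
      unfolding \<phi>_def x1 by (simp add: f_P k(2) algebra_simps)
    then show ?thesis using l k(1) r0 by simp
  qed
  define y where "y = ray A\<^sub>F (1 + rat_const (- (2 * d)) / r) P"
  have x2: "ray A\<^sub>F (1 + rat_const (- d) / (- (- r + ?d))) x = y"
  proof -
    have "rat_const (- d) / (- (- r + ?d)) = ?d / (- r + ?d)"
      unfolding rat_const.hom_minus by (rule minus_divide_divide)
    moreover have "ray A\<^sub>F (1 + ?d / (- r + ?d)) x = ray A\<^sub>F (1 + (?d + ?d) / (- r)) P"
      unfolding x_def by (rule ray_shift[OF _ rd]) (use r0 in simp)
    moreover have "(?d + ?d) / (- r) = rat_const (- (2 * d)) / r"
      by (simp add: rat_const.hom_simps)
    ultimately show ?thesis unfolding y_def by (simp only:)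
  qed
  define e where "e = feval k1 y - (r - 2 * ?d) * feval k2 y"
  have 0: "feval f y + rat_const l * e = 0" if "l \<noteq> 0" for l
  proof -
    have "\<phi> l x (- (- r + ?d)) = feval f y + rat_const l * e"
      unfolding \<phi>_def x2 e_def by (simp add: algebra_simps)
    then show ?thesis using disj[of l] nz[OF that] by simp
  qed
  have "feval f y + e = 0" using 0[of 1] by (simp add: rat_const.hom_one)
  moreover have "feval f y + 2 * e = 0" using 0[of 2] by (simp add: rat_const.hom_numeral)
  ultimately have e0: "e = 0" and fy: "feval f y = 0" by algebra+
  have ny: "n y = (r - 2 * ?d)\<^sup>2"
    using sqdist_ray_shift[OF r0 r(1), of "rat_const (- (2 * d))"]
    by (simp add: y_def rat_const.hom_simps)
  \<comment> \<open>If \<open>r = 2d\<close>, then \<open>n = 4 d\<^sup>2\<close> on \<open>C\<close>, but the shifted point is the focus.\<close>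
  have r2d: "r - 2 * ?d \<noteq> 0"
  proof
    assume eq: "r - 2 * ?d = 0"
    then have "r = rat_const (2 * d)" by (simp add: rat_const.hom_simps)
    then have "n P = rat_const ((2 * d)\<^sup>2)" by (simp only: rat_const.hom_power flip: r(1))
    then have "feval (sqdist_poly A - [:[:(2 * d)\<^sup>2:]:]) P = 0" by (simp add: feval.hom_diff)
    then have "feval (sqdist_poly A - [:[:(2 * d)\<^sup>2:]:]) y = 0" using vanishes_at_point fy by blast
    then have "rat_const ((2 * d)\<^sup>2) = 0" using ny eq by (simp add: feval.hom_diff)
    then show False using d by simp
  qed
  have "1 + rat_const (- (2 * d)) / r \<noteq> 0"
    using r2d r0 by (simp add: rat_const.hom_simps field_simps)
  then have "nonconst y" unfolding y_def by (rule nonconst_ray[OF nonconst_P f_P])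
  then obtain \<tau>' where \<tau>': "\<tau>' \<notin> range rat_const" "y = (rat_subst \<tau>' (fst P), rat_subst \<tau>' (snd P))"
    using proper_parametrization_lift[OF proper irreducible curve_eq _ fy] by blast
  interpret \<sigma>: comm_ring_morphism "rat_subst \<tau>'" by (rule rat_subst_morphism[OF \<tau>'(1)])
  have hy: "feval h y = rat_subst \<tau>' (feval h P)" for h
    using rat_subst_feval[OF \<tau>'(1), of h "fst P" "snd P"] \<tau>'(2) by simp
  have "feval k2 y \<noteq> 0" unfolding hy using k(1) rat_subst_eq_0_iff[OF \<tau>'(1)] by blast
  moreover have "rat_subst \<tau>' r * feval k2 y = (r - 2 * ?d) * feval k2 y"
    using e0 unfolding e_def hy k(2) by (simp add: \<sigma>.hom_mult)
  ultimately have \<sigma>r: "rat_subst \<tau>' r = r - 2 * ?d" by simp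
  have step: "feval f (ray A\<^sub>F (1 + rat_const (- (of_nat j * (2 * d))) / r) P) = 0" for j
  proof (induction j)
    case 0
    then show ?case by (simp add: rat_const.hom_zero ray_1 f_P)
  next
    case (Suc j)
    let ?c = "rat_const (- (of_nat j * (2 * d)))"
    have "rat_subst \<tau>' (feval f (ray A\<^sub>F (1 + ?c / r) P)) = 0" using Suc by (simp add: \<sigma>.hom_zero)
    then have "feval f (rat_subst \<tau>' (fst (ray A\<^sub>F (1 + ?c / r) P)), rat_subst \<tau>' (snd (ray A\<^sub>F (1 + ?c / r) P))) = 0"
      by (simp flip: rat_subst_feval[OF \<tau>'(1)])
    moreover have "(rat_subst \<tau>' (fst (ray A\<^sub>F (1 + ?c / r) P)), rat_subst \<tau>' (snd (ray A\<^sub>F (1 + ?c / r) P)))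
      = ray A\<^sub>F (1 + ?c / (r - 2 * ?d)) y"
      by (simp add: ray_def \<tau>'(2) \<sigma>.hom_simps rat_subst_rat_const[OF \<tau>'(1)]
          rat_subst_divide[OF \<tau>'(1)] \<sigma>r)
    moreover have "r - 2 * ?d = r + rat_const (- (2 * d))" by (simp add: rat_const.hom_simps)
    moreover have "ray A\<^sub>F (1 + ?c / (r + rat_const (- (2 * d)))) y =
        ray A\<^sub>F (1 + (rat_const (- (2 * d)) + ?c) / r) P"
      unfolding y_def by (rule ray_shift[OF r0]) (use r2d in \<open>simp add: rat_const.hom_simps\<close>)
    moreover have "rat_const (- (2 * d)) + ?c = rat_const (- (of_nat (Suc j) * (2 * d)))"
      unfolding rat_const.hom_add[symmetric] by (rule arg_cong[of _ _ rat_const]) (simp add: algebra_simps)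
    ultimately show ?case by (simp only:)
  qed
  show False by (rule not_all_shifts_of_P_on_curve[OF _ r0 step]) (use d in simp)
qed

text \<open>The point of \<open>C\<close> obtained by moving \<open>Q\<close> back by \<open>d\<close> is \<open>P(\<tau>)\<close>, and its square norm from the focus is
  \<open>(v - d)\<^sup>2\<close>.\<close>

lemma splitting_if_conchoid_rational:
  assumes d: "d \<noteq> 0" and proper: "proper_parametrization C P"
    and circle: "n P \<noteq> rat_const (d\<^sup>2)"
    and rational: "rational_curve (conchoid A d C)"
  shows splitting_condition
proof -
  obtain Q where Q: "parametrization (conchoid A d C) Q"
    using rational by (auto simp: rational_curve_def)
  obtain v where v: "v\<^sup>2 = n Q" "v \<noteq> 0" "v - rat_const d \<noteq> 0"
    and y: "feval f (ray A\<^sub>F (1 + rat_const (- d) / v) Q) = 0"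
      "nonconst (ray A\<^sub>F (1 + rat_const (- d) / v) Q)"
    using rational_conchoid_point[OF d Q] .
  obtain \<tau> where \<tau>: "\<tau> \<notin> range rat_const"
    "ray A\<^sub>F (1 + rat_const (- d) / v) Q = (rat_subst \<tau> (fst P), rat_subst \<tau> (snd P))"
    using proper_parametrization_lift[OF proper irreducible curve_eq y(2,1)] .
  interpret \<sigma>: comm_ring_morphism "rat_subst \<tau>" by (rule rat_subst_morphism[OF \<tau>(1)])
  have sq: "rat_subst \<tau> (n P) = (v - rat_const d)\<^sup>2"
    using sqdist_ray_shift[OF v(2,1), of "rat_const (- d)"] rat_subst_n[OF \<tau>(1), of P]
    unfolding \<tau>(2) by (simp add: rat_const.hom_minus)
  have "\<nexists>r. n P = r\<^sup>2"
  proof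
    assume "\<exists>r. n P = r\<^sup>2"
    then obtain r where r: "r\<^sup>2 = n P" by metis
    then have "(rat_subst \<tau> r)\<^sup>2 = (v - rat_const d)\<^sup>2" using sq by (simp flip: \<sigma>.hom_power)
    then have "rat_subst \<tau> r = v - rat_const d \<or> rat_subst \<tau> (- r) = v - rat_const d"
      unfolding \<sigma>.hom_minus power2_eq_iff by (metis minus_minus)
    then show False
      using rational_conchoid_imp_norm_not_square[OF d proper Q v(1,2) \<tau> _ _ circle] r by (metis power2_minus)
  qed
  then show ?thesis using sq \<tau>(1) unfolding splitting_condition_def by blast
qed

text \<open>The equation of the circle is irreducible: as a quadratic polynomial in \<open>x\<^sub>2\<close> its discriminant has
  the simple root \<open>a + d\<close>, so it is not a square.\<close>

lemma circle_if_constant_norm: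
  assumes d: "d \<noteq> 0" and "n P = rat_const (d\<^sup>2)"
  shows "C = {y. (fst y - fst A)\<^sup>2 + (snd y - snd A)\<^sup>2 = d\<^sup>2}"
proof -
  define a where "a = fst A"
  define b where "b = snd A"
  define g where "g = sqdist_poly A - [:[:d\<^sup>2:]:]"
  have g: "g = [: [:a\<^sup>2 + b\<^sup>2 - d\<^sup>2, - 2 * a, 1:], [:- 2 * b:], 1 :]"
    unfolding g_def sqdist_poly_def a_def b_def by (simp add: power2_eq_square one_pCons algebra_simps)
  have "irreducible g"
  proof (rule irreducible_quadratic)
    show "degree g = 2" by (simp add: g)
    show "content_free g" unfolding content_free_def
    proof (intro allI impI)
      fix c assume "[:c:] dvd g"
      then have "c dvd coeff g 2" by (metis const_poly_dvd_iff)
      then show "c dvd 1" by (simp add: g numeral_2_eq_2)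
    qed
    fix w show "w\<^sup>2 \<noteq> (coeff g 1)\<^sup>2 - 4 * coeff g 0 * coeff g 2"
    proof
      assume "w\<^sup>2 = (coeff g 1)\<^sup>2 - 4 * coeff g 0 * coeff g 2"
      also have "\<dots> = [:- 2 * b:]\<^sup>2 - 4 * [:a\<^sup>2 + b\<^sup>2 - d\<^sup>2, - 2 * a, 1:]"
        by (simp add: g numeral_2_eq_2)
      also have "\<dots> = [: 4 * (d\<^sup>2 - a\<^sup>2), 8 * a, - 4 :]"
        by (simp add: power2_eq_square numeral_poly algebra_simps)
      finally have w: "w\<^sup>2 = [: 4 * (d\<^sup>2 - a\<^sup>2), 8 * a, - 4 :]" .
      \<comment> \<open>A square that vanishes at \<open>a + d\<close> has zero derivative there, but the derivative is \<open>- 8 d\<close>.\<close>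
      have "(poly w (a + d))\<^sup>2 = 0"
        by (simp flip: poly_power add: w) (simp add: power2_eq_square algebra_simps)
      then have "poly w (a + d) = 0" by simp
      moreover have "poly (pderiv (w\<^sup>2)) (a + d) = - 8 * d"
        unfolding w by (simp add: pderiv_pCons algebra_simps)
      moreover have "pderiv (w\<^sup>2) = 2 * w * pderiv w"
        by (simp add: power2_eq_square pderiv_mult)
      ultimately show False using d by simp
    qed
  qed
  moreover have "feval g P = 0" using assms(2) by (simp add: g_def feval.hom_diff)
  ultimately have "C = zero_set g" using parametrized_curve_eq_zero_set[OF parametrization] by blast
  then show ?thesis by (simp add: zero_set_def g_def eval2.hom_diff sqdist_def)
qed

end

theorem theorem3p13:
  fixes a b d :: "'a::{alg_closed_field, field_char_0}"
    and C :: "('a \<times> 'a) set"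
  assumes "d \<noteq> 0"
    and "rational_curve C"
    and "\<And>i. i\<^sup>2 = -1 \<Longrightarrow> C \<noteq> {y. fst y + i * snd y = 0}"
    and "C \<noteq> {y. (fst y - a)\<^sup>2 + (snd y - b)\<^sup>2 = d\<^sup>2}"
    and "\<not> (\<exists>u v. (u, v) \<noteq> (0, 0) \<and> C = {y. u * (fst y - a) + v * (snd y - b) = 0})"
  shows "(rational_curve (conchoid (a, b) d C) \<longleftrightarrow>
            (\<exists>P. proper_parametrization C P \<and> rational_curve (reparametrizing_curve (a, b) P))) \<and>
         ((\<exists>P. proper_parametrization C P \<and> rational_curve (reparametrizing_curve (a, b) P)) \<longleftrightarrow>
            (\<forall>P. proper_parametrization C P \<longrightarrow> rational_curve (reparametrizing_curve (a, b) P)))"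
proof -
  have *: "rational_curve (conchoid (a, b) d C) \<longleftrightarrow> rational_curve (reparametrizing_curve (a, b) P)"
    if proper: "proper_parametrization C P" for P
  proof -
    have P: "parametrization C P" using proper by (simp add: proper_parametrization_def)
    obtain f where f: "irreducible f" "C = zero_set f" using parametrizationE[OF P] by metis
    interpret focal_curve "(a, b)" C f P
      by unfold_locales (use P f assms(5) in auto)
    have "n P \<noteq> rat_const (d\<^sup>2)" using circle_if_constant_norm[OF assms(1)] assms(4) by auto
    then show ?thesis
      using splitting_if_conchoid_rational[OF assms(1) proper] conchoid_rational_if_splitting[OF assms(1)]
        splitting_if_reparametrizing_curve_rational reparametrizing_curve_rational_if_splitting
      by blast
  qed
  obtain P where "proper_parametrization C P" using exists_proper_parametrization[OF assms(2)] .
  then show ?thesis using * by blast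
qed

end
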